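(* For every dimension $n$ there exists a constant $C$, depending only on $n$, such that the following holds. Let $0<\delta<1$, $1\leq r\leq p<\frac n\delta$, $f\in L^1_{\mathrm{loc}}(\mathbb R^n)$ and $w\in A_r$. Let $q$ be defined by \[ \frac1p-\frac1q=\frac{\delta}{nr}. \] Then \[ \inf_{c\in\mathbb R}\biggl(\frac1{w(Q)}\int_Q|f-c|^q\,w\,dx\biggr)^{\frac1q} \leq C\,q\,[w]_{A_p}^{\frac1p}[w]_{A_r}^{\frac{\delta}{nr}}[w]_{A_\infty}\,\frac{(1-\delta)^{\frac1p}}{\delta^{1-\frac1p}}\,\mathrm l(Q)^\delta\biggl(\frac1{w(Q)}\int_Q\int_Q\frac{|f(x)-f(y)|^p}{|x-y|^{n+\delta p}}\,dy\,w(x)\,dx\biggr)^{\frac1p} \] for every cube $Q\subset\mathbb R^n$.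
   Context: A cube is a closed axis-parallel cube in $\mathbb R^n$, with side length $\mathrm l(Q)$; $\mathcal L$ is Lebesgue measure. A weight is a function $w\in L^1_{\mathrm{loc}}(\mathbb R^n)$ with $w>0$ almost everywhere, and $w(Q)=\int_Q w\,dx$. The Hardy--Littlewood maximal function is $\mathrm M g(x)=\sup_{Q\ni x}\frac1{\mathcal L(Q)}\int_Q|g|\,dy$, the supremum over all cubes containing $x$. A weight $w$ is in $A_1$ if there is a constant $C$ with $\mathrm M w(x)\leq Cw(x)$ for almost every $x$; $[w]_{A_1}$ is the smallest such $C$. For $1<p<\infty$, $w\in A_p$ if \[ [w]_{A_p}=\sup_Q\biggl(\frac1{\mathcal L(Q)}\int_Q w\,dx\biggr)\biggl(\frac1{\mathcal L(Q)}\int_Q w^{1-p'}\,dx\biggr)^{p-1}<\infty,\qquad p'=\frac p{p-1}. \] $A_\infty=\bigcup_{1\leq p<\infty}A_p$ and $[w]_{A_\infty}=\sup_Q\frac1{w(Q)}\int_Q\mathrm M(1_Qw)\,dx$. *)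

theory Defs
  imports "HOL-Analysis.Analysis"
begin

definition cube :: "real ^ 'n \<Rightarrow> real \<Rightarrow> (real ^ 'n) set" where
  "cube a l = cbox a (\<chi> i. a $ i + l)"

(* l > 0 excludes the degenerate cubes: the empty set and single points. *)
definition cubes :: "(real ^ 'n) set set" where
  "cubes = {cube a l | a l. l > 0}"

definition locally_integrable :: "(real ^ 'n \<Rightarrow> real) \<Rightarrow> bool" where
  "locally_integrable f \<longleftrightarrow> (\<forall>K. compact K \<longrightarrow> f absolutely_integrable_on K)"

definition weight :: "(real ^ 'n \<Rightarrow> real) \<Rightarrow> bool" where
  "weight w \<longleftrightarrow> locally_integrable w \<and> (AE x in lebesgue. w x > 0)"

(* Only used for exponents a > 0, where the power of infinity is infinity. *)
definition ennpowr :: "ennreal \<Rightarrow> real \<Rightarrow> ennreal" (infixr "ennpowr" 80) where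
  "x ennpowr a = (if x = \<infinity> then \<infinity> else ennreal (enn2real x powr a))"

(* Integrals of nonnegative functions are taken in [0, infinity]. *)
definition weight_of :: "(real ^ 'n \<Rightarrow> real) \<Rightarrow> (real ^ 'n) set \<Rightarrow> ennreal" where
  "weight_of w Q = (\<integral>\<^sup>+x\<in>Q. ennreal (w x) \<partial>lebesgue)"

definition average :: "(real ^ 'n) set \<Rightarrow> (real ^ 'n \<Rightarrow> real) \<Rightarrow> ennreal" where
  "average Q g = (\<integral>\<^sup>+x\<in>Q. ennreal (g x) \<partial>lebesgue) / emeasure lebesgue Q"

definition maximal :: "(real ^ 'n \<Rightarrow> real) \<Rightarrow> real ^ 'n \<Rightarrow> ennreal" where
  "maximal g x = (SUP Q \<in> {Q \<in> cubes. x \<in> Q}. average Q (\<lambda>y. \<bar>g y\<bar>))"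

definition A1_const :: "(real ^ 'n \<Rightarrow> real) \<Rightarrow> ennreal" where
  "A1_const w = Inf {C. AE x in lebesgue. maximal w x \<le> C * ennreal (w x)}"

(* In the case p > 1, the exponent 1 - p / (p - 1) is 1 - p' for the conjugate exponent p'. *)
definition Ap_const :: "real \<Rightarrow> (real ^ 'n \<Rightarrow> real) \<Rightarrow> ennreal" where
  "Ap_const p w =
     (if p = 1 then A1_const w
      else (SUP Q \<in> cubes. average Q w * average Q (\<lambda>x. w x powr (1 - p / (p - 1))) ennpowr (p - 1)))"

definition Ainf_const :: "(real ^ 'n \<Rightarrow> real) \<Rightarrow> ennreal" where
  "Ainf_const w =
     (SUP Q \<in> cubes. (\<integral>\<^sup>+x\<in>Q. maximal (\<lambda>y. indicator Q y * w y) x \<partial>lebesgue) / weight_of w Q)"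

(* For p = 1 the infimum is finite iff maximal w \<le> C * w holds almost everywhere
   for some finite C. *)
definition Ap :: "real \<Rightarrow> (real ^ 'n \<Rightarrow> real) set" where
  "Ap p = {w. weight w \<and> Ap_const p w < \<infinity>}"

end

theory Submission
  imports Defs
begin

text \<open>
  On a single cube the oscillation at most doubles, up to the volume factor, when the
  distance of the compared points is doubled, because any two points can be compared through their
  midpoint. Many dyadic scales of the fractional seminorm therefore contribute equally, and together
  with the $A_p$ condition this bounds the oscillation on every subcube with the factor
  $(1-\delta)^{1/p}$. By the $A_r$ condition the $q$-th powers of these bounds are summable over
  disjoint subcubes.

  To pass from oscillations to the weighted $L^q$ norm, one measures the level sets of $f - c$, where
  $c$ is a median, by the dyadic cubes in which they have density more than one half. Between two
  levels whose ratio is $1 + 1/q$ one inserts about $[w]_{A_\infty}$ equally spaced levels. Cubes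
  whose parent has small oscillation form a sparse family, whose total weight is bounded by the
  definition of $[w]_{A_\infty}$, so the weight of the level set decays; all other cubes are covered
  by disjoint cubes of large oscillation. Applying this to the truncations of $f$ between
  consecutive levels gives the strong type estimate, since the seminorms of the truncations add up
  to at most the seminorm of $f$.
\<close>

section \<open>A stopping-time estimate in finite laminar families\<close>

text \<open>The linear dependence on \<open>q\<close> and on the A_infinity constant
  \<open>W\<close> comes from the spacing of the levels. Main levels have ratio 1 + 1/q because (1 +
  1/q)^q <= e, so t^q changes only by a constant factor from one level to the next. Sparse cubes
  contribute 2W/N times the weight at the previous level, and N >= 4eW brings the combined factor
  down to 1/2, which is absorbed after summation. The price is the small gap t/(qN) between inserted
  levels: cubes of large oscillation are counted with (qN)^q, whose q-th root is comparable to q W.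
  Truncation is forced by the unbounded number of levels, since the full seminorm at each of them
  could not be summed. Because q >= p, the powers q/p of the truncated energies still sum to at most
  the power of their sum. Absorption needs finite sums, so it is carried out with dyadic cubes of
  bounded depth, finitely many levels and a positive lowest level \<open>t0\<close>. The depth is
  removed in \<open>ladder\<close>, the other two restrictions in
  \<open>one_sided_bound\<close>.\<close>

lemma finite_laminar_maximal:
  fixes \<G> :: "'a set set"
  assumes fin: "finite \<G>"
    and lam: "\<And>P P'. P \<in> \<G> \<Longrightarrow> P' \<in> \<G> \<Longrightarrow> P \<inter> P' = {} \<or> P \<subseteq> P' \<or> P' \<subseteq> P"
  defines "\<M> \<equiv> {P \<in> \<G>. \<forall>P'\<in>\<G>. P \<subseteq> P' \<longrightarrow> P' = P}"
  shows "disjoint \<M>" "\<Union>\<M> = \<Union>\<G>" "\<And>P. P \<in> \<G> \<Longrightarrow> \<exists>P'\<in>\<M>. P \<subseteq> P'"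
proof -
  show max: "\<exists>P'\<in>\<M>. P \<subseteq> P'" if P: "P \<in> \<G>" for P
  proof -
    have "\<exists>m\<in>\<G>. P \<subseteq> m \<and> (\<forall>b\<in>\<G>. m \<subseteq> b \<longrightarrow> b = m)"
      using finite_has_maximal2[OF fin P] by metis
    then show ?thesis unfolding \<M>_def by blast
  qed
  show "disjoint \<M>"
  proof (rule disjointI)
    fix A B assume "A \<in> \<M>" "B \<in> \<M>" "A \<noteq> B"
    then show "A \<inter> B = {}" using lam[of A B] unfolding \<M>_def by auto
  qed
  show "\<Union>\<M> = \<Union>\<G>"
  proof (intro equalityI Union_least)
    fix P assume "P \<in> \<M>" then show "P \<subseteq> \<Union>\<G>" unfolding \<M>_def by blast
  next
    fix P assume "P \<in> \<G>" then show "P \<subseteq> \<Union>\<M>" using max[of P] by auto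
  qed
qed

text \<open>Models the dyadic subcubes of \<open>Q\<close> down to a fixed depth; \<open>d\<close>
  bounds the volume ratio of a parent to its child. Finiteness supplies maximal members, so
  \<open>finite_laminar_maximal\<close> takes the place of a covering lemma.\<close>

locale tree_family =
  fixes M :: "'a measure" and \<T> :: "'a set set" and Q :: "'a set" and d :: real
  assumes finite_T: "finite \<T>" and Q_T: "Q \<in> \<T>"
    and sub_Q: "\<And>P. P \<in> \<T> \<Longrightarrow> P \<subseteq> Q"
    and laminar: "\<And>P P'. P \<in> \<T> \<Longrightarrow> P' \<in> \<T> \<Longrightarrow> P \<inter> P' = {} \<or> P \<subseteq> P' \<or> P' \<subseteq> P"
    and fmeas: "\<And>P. P \<in> \<T> \<Longrightarrow> P \<in> fmeasurable M"
    and pos: "\<And>P. P \<in> \<T> \<Longrightarrow> measure M P > 0"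
    and parent: "\<And>P. P \<in> \<T> \<Longrightarrow> P \<noteq> Q \<Longrightarrow>
        \<exists>P'\<in>\<T>. P \<subset> P' \<and> measure M P' \<le> d * measure M P"
begin

definition dense :: "('a \<Rightarrow> real) \<Rightarrow> real \<Rightarrow> 'a set set" where
  "dense F s = {P \<in> \<T>. measure M (P \<inter> {x. F x > s}) > measure M P / 2}"

definition dense_union :: "('a \<Rightarrow> real) \<Rightarrow> real \<Rightarrow> 'a set" where
  "dense_union F s = \<Union>(dense F s)"

text \<open>These are the Calderon-Zygmund stopping cubes of the indicator of {F > s} at height
  1/2.\<close>

definition stopping :: "('a \<Rightarrow> real) \<Rightarrow> real \<Rightarrow> 'a set set" where
  "stopping F s = {P \<in> dense F s. \<forall>P'\<in>dense F s. P \<subseteq> P' \<longrightarrow> P' = P}"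

lemma dense_sub: "dense F s \<subseteq> \<T>" by (auto simp: dense_def)
lemma stopping_sub: "stopping F s \<subseteq> dense F s" by (auto simp: stopping_def)
lemma finite_dense: "finite (dense F s)" by (rule finite_subset[OF dense_sub finite_T])
lemma finite_stopping: "finite (stopping F s)" by (rule finite_subset[OF stopping_sub finite_dense])

lemma stopping_props:
  shows "disjoint (stopping F s)" and "\<Union>(stopping F s) = dense_union F s" "\<And>P. P \<in> dense F s \<Longrightarrow> \<exists>P'\<in>stopping F s. P \<subseteq> P'"
proof -
  have lam: "P \<inter> P' = {} \<or> P \<subseteq> P' \<or> P' \<subseteq> P" if "P \<in> dense F s" "P' \<in> dense F s" for P P'
    using laminar[of P P'] that dense_sub by blast
  note * = finite_laminar_maximal[of "dense F s", OF finite_dense lam, folded stopping_def dense_union_def]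
  show "disjoint (stopping F s)" "\<Union>(stopping F s) = dense_union F s" using * by auto
  show "\<exists>P'\<in>stopping F s. P \<subseteq> P'" if "P \<in> dense F s" for P using *(3) that by auto
qed

lemma nonempty: "P \<in> \<T> \<Longrightarrow> P \<noteq> {}" using pos by fastforce

lemma dense_union_sets: "dense_union F s \<in> fmeasurable M"
  unfolding dense_union_def by (rule fmeasurable.finite_Union[OF finite_dense]) (use dense_sub fmeas in blast)

lemma sets_level:
  fixes F :: "'a \<Rightarrow> real"
  assumes "F \<in> borel_measurable M" "P \<in> \<T>"
  shows "P \<inter> {x. F x > s} \<in> fmeasurable M" "P \<inter> {x. F x \<le> s} \<in> fmeasurable M"
proof -
  have P: "P \<in> sets M" "P \<subseteq> space M" using fmeas[OF assms(2)] sets.sets_into_space by auto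
  have "P \<inter> {x. F x > s} = P \<inter> {x\<in>space M. F x > s}" "P \<inter> {x. F x \<le> s} = P \<inter> {x\<in>space M. F x \<le> s}"
    using P by auto
  moreover have "{x\<in>space M. F x > s} \<in> sets M" "{x\<in>space M. F x \<le> s} \<in> sets M"
    using assms(1) borel_measurable_iff_greater borel_measurable_iff_le by blast+
  ultimately show "P \<inter> {x. F x > s} \<in> fmeasurable M" "P \<inter> {x. F x \<le> s} \<in> fmeasurable M"
    using fmeas[OF assms(2)] by (metis fmeasurable_Int_fmeasurable)+
qed

lemma dense_antimono:
  assumes "F \<in> borel_measurable M" "s \<le> s'"
  shows "dense F s' \<subseteq> dense F s"
proof
  fix P assume P: "P \<in> dense F s'"
  then have PT: "P \<in> \<T>" by (auto simp: dense_def)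
  have "measure M (P \<inter> {x. F x > s'}) \<le> measure M (P \<inter> {x. F x > s})"
  proof (rule measure_mono_fmeasurable)
    show "P \<inter> {x. F x > s'} \<subseteq> P \<inter> {x. F x > s}" using assms(2) by auto
    show "P \<inter> {x. F x > s'} \<in> sets M" by (rule fmeasurableD[OF sets_level(1)[OF assms(1) PT]])
  qed (rule sets_level(1)[OF assms(1) PT])
  then show "P \<in> dense F s" using P unfolding dense_def by auto
qed

text \<open>The dense family shrinks as the level rises, so stopping cubes of different levels are
  nested. This allows all levels to be localised to the stopping cubes of the lowest one.\<close>

lemma stopping_subset:
  assumes "F \<in> borel_measurable M" "s \<le> s'" "P \<in> stopping F s'"
  shows "\<exists>R\<in>stopping F s. P \<subseteq> R"
proof -
  have "P \<in> dense F s" using assms(3) stopping_sub dense_antimono[OF assms(1,2)] by blast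
  then show ?thesis by (rule stopping_props(3))
qed

lemma dense_union_antimono: "F \<in> borel_measurable M \<Longrightarrow> s \<le> s' \<Longrightarrow> dense_union F s' \<subseteq> dense_union F s"
  unfolding dense_union_def by (rule Union_mono) (rule dense_antimono)

text \<open>The dense cubes inside a stopping cube are controlled on its parent, where \<^term>\<open>F\<close>
  stays below the lower level on at least half of the points.\<close>

lemma good_cube_half:
  fixes osc :: "'a set \<Rightarrow> real"
  assumes F: "F \<in> borel_measurable M" and P: "P \<in> stopping F s" and PQ: "P \<noteq> Q" and "s \<le> s'"
    and oscb: "\<And>P. P \<in> \<T> \<Longrightarrow>
      D * measure M (P \<inter> {x. F x > s'}) * measure M (P \<inter> {x. F x \<le> s}) \<le> osc P"
    and good: "\<And>P'. P' \<in> \<T> \<Longrightarrow> P \<subseteq> P' \<Longrightarrow> osc P' \<le> (1 / (8 * d)) * D * (measure M P')\<^sup>2"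
    and D: "D > 0" and d: "d > 0"
  shows "measure M (P \<inter> dense_union F s') \<le> measure M P / 2"
proof -
  have PT: "P \<in> \<T>" using P stopping_sub dense_sub by blast
  obtain P' where P': "P' \<in> \<T>" "P \<subset> P'" "measure M P' \<le> d * measure M P"
    using parent[OF PT PQ] by blast
  have nb: "P' \<notin> dense F s" using P P' unfolding stopping_def by blast
  let ?m = "measure M"
  have split: "?m P' = ?m (P' \<inter> {x. F x > s}) + ?m (P' \<inter> {x. F x \<le> s})"
  proof -
    have "?m ((P' \<inter> {x. F x > s}) \<union> (P' \<inter> {x. F x \<le> s})) = ?m (P' \<inter> {x. F x > s}) + ?m (P' \<inter> {x. F x \<le> s})"
      by (rule measure_Un_AE) (use sets_level[OF F P'(1)] in auto)
    moreover have "(P' \<inter> {x. F x > s}) \<union> (P' \<inter> {x. F x \<le> s}) = P'" by auto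
    ultimately show ?thesis by simp
  qed
  have half: "?m (P' \<inter> {x. F x \<le> s}) \<ge> ?m P' / 2"
    using nb P'(1) split unfolding dense_def by auto
  \<comment> \<open>Origin of the constant 8 d: a factor 2 is lost on the half of \<open>P'\<close>
    where F <= s, a factor d in passing from \<open>P'\<close> to \<open>P\<close>, and the
    remaining 1/4 doubles to 1/2 when each dense cube is bounded by twice its part of {F >
    s'}.\<close>
  have "D * ?m (P' \<inter> {x. F x > s'}) * (?m P' / 2) \<le> D * ?m (P' \<inter> {x. F x > s'}) * ?m (P' \<inter> {x. F x \<le> s})"
    using half D by (intro mult_left_mono) auto
  also have "\<dots> \<le> (1 / (8 * d)) * D * (?m P')\<^sup>2"
    using oscb[OF P'(1)] good[OF P'(1)] P'(2) by force
  finally have "D * ?m P' * ?m (P' \<inter> {x. F x > s'}) \<le> D * ?m P' * (?m P' / (4 * d))"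
    using d by (simp add: power2_eq_square field_simps)
  moreover have "D * ?m P' > 0" using D pos[OF P'(1)] by simp
  ultimately have up: "?m (P' \<inter> {x. F x > s'}) \<le> ?m P' / (4 * d)"
    using mult_le_cancel_left_pos by blast
  also have "\<dots> \<le> d * ?m P / (4 * d)"
    using P'(3) d by (intro divide_right_mono) auto
  finally have up: "?m (P' \<inter> {x. F x > s'}) \<le> ?m P / 4" using d by simp
  define \<N> where "\<N> = {P2 \<in> stopping F s'. P2 \<subseteq> P}"
  have fin: "finite \<N>" unfolding \<N>_def using finite_stopping by auto
  have NT: "\<N> \<subseteq> \<T>" unfolding \<N>_def using stopping_sub dense_sub by blast
  have dis: "disjoint \<N>" using stopping_props(1)[of F s'] unfolding \<N>_def disjoint_def by blast
  \<comment> \<open>A stopping cube of the upper level that meets \<open>P\<close> lies in some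
    stopping cube of the lower level, and disjointness forces that cube to be
    \<open>P\<close>.\<close>
  have eq: "P \<inter> dense_union F s' \<subseteq> \<Union>\<N>"
  proof
    fix x assume x: "x \<in> P \<inter> dense_union F s'"
    then obtain P2 where P2: "P2 \<in> stopping F s'" "x \<in> P2" using stopping_props(2)[of F s'] by blast
    then obtain R where R: "R \<in> stopping F s" "P2 \<subseteq> R" using stopping_subset[OF F \<open>s \<le> s'\<close>] by blast
    then have "R = P" using P x P2 stopping_props(1)[of F s] unfolding disjoint_def by blast
    then show "x \<in> \<Union>\<N>" using P2 R unfolding \<N>_def by blast
  qed
  have "?m (P \<inter> dense_union F s') \<le> ?m (\<Union>\<N>)"
  proof (rule measure_mono_fmeasurable[OF eq])
    show "P \<inter> dense_union F s' \<in> sets M" by (intro sets.Int fmeasurableD fmeas[OF PT] dense_union_sets)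
    show "\<Union>\<N> \<in> fmeasurable M" using fin NT fmeas by (intro fmeasurable.finite_Union) auto
  qed
  also have "\<dots> \<le> (\<Sum>P2\<in>\<N>. ?m P2)"
    using measure_Union_le[OF fin] NT fmeas by (meson fmeasurableD subsetD)
  also have "\<dots> \<le> (\<Sum>P2\<in>\<N>. 2 * ?m (P2 \<inter> {x. F x > s'}))"
    using stopping_sub unfolding \<N>_def dense_def by (intro sum_mono) fastforce
  also have "\<dots> = 2 * (\<Sum>P2\<in>\<N>. ?m (P2 \<inter> {x. F x > s'}))" by (simp add: sum_distrib_left)
  also have "(\<Sum>P2\<in>\<N>. ?m (P2 \<inter> {x. F x > s'})) = ?m (\<Union>P2\<in>\<N>. P2 \<inter> {x. F x > s'})"
    using fin dis NT sets_level[OF F] unfolding disjoint_def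
    by (intro measure_UNION'[symmetric]) (auto simp: pairwise_def disjnt_def)
  also have "\<dots> \<le> ?m (P' \<inter> {x. F x > s'})"
  proof (rule measure_mono_fmeasurable)
    show "(\<Union>P2\<in>\<N>. P2 \<inter> {x. F x > s'}) \<subseteq> P' \<inter> {x. F x > s'}" using P'(2) unfolding \<N>_def by blast
    show "(\<Union>P2\<in>\<N>. P2 \<inter> {x. F x > s'}) \<in> sets M"
      using fin NT fmeasurableD[OF sets_level(1)[OF F]] by (intro sets.finite_UN) auto
  qed (rule sets_level(1)[OF F P'(1)])
  finally show ?thesis using up by linarith
qed

text \<open>A double count. A point of the highest dense union outside the bad cubes lies in a good
  stopping cube at each of the \<open>N\<close> levels below. On the other hand the good cubes of
  all levels are sparse: removing the next dense union from a good cube leaves at least half of it,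
  and the remainders are disjoint. Their total weight is therefore at most 2 W times that of the
  lowest dense union. Indices are pairs of level and cube because one cube may be a stopping cube at
  several levels.\<close>

lemma stopping_step:
  fixes \<mu> :: "'a measure" and osc :: "'a set \<Rightarrow> real" and N :: nat and D :: real
  assumes F: "F \<in> borel_measurable M" and NQ: "Q \<notin> dense F t" and D: "D > 0" and d: "d > 0"
    and osc: "\<And>P s s'. P \<in> \<T> \<Longrightarrow> t \<le> s \<Longrightarrow> s' \<le> t + real N * D \<Longrightarrow> s' = s + D \<Longrightarrow>
        D * measure M (P \<inter> {x. F x > s'}) * measure M (P \<inter> {x. F x \<le> s}) \<le> osc P"
    and sets_mu: "sets \<mu> = sets M" and fin_mu: "finite_measure \<mu>"
    and carleson: "\<And>R I (P :: nat \<times> 'a set \<Rightarrow> 'a set) E. R \<in> \<T> \<Longrightarrow> finite I \<Longrightarrow>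
        (\<And>i. i \<in> I \<Longrightarrow> P i \<in> \<T> \<and> P i \<subseteq> R \<and> E i \<in> sets M \<and> E i \<subseteq> P i) \<Longrightarrow>
        disjoint_family_on E I \<Longrightarrow>
        (\<Sum>i\<in>I. measure M (E i) * (measure \<mu> (P i) / measure M (P i))) \<le> W * measure \<mu> R"
  defines "bad \<equiv> {P \<in> \<T>. osc P > (1 / (8 * d)) * D * (measure M P)\<^sup>2}"
  shows "real N * measure \<mu> (dense_union F (t + real N * D) - \<Union>bad) \<le> 2 * W * measure \<mu> (dense_union F t)"
proof -
  interpret \<mu>: finite_measure \<mu> by (rule fin_mu)
  define s where "s m = t + real m * D" for m :: nat
  define G where "G m = {P \<in> stopping F (s m). \<forall>P'\<in>\<T>. P \<subseteq> P' \<longrightarrow> P' \<notin> bad}" for m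
  define I where "I = Sigma {..<N} G"
  define E where "E i = snd i - dense_union F (s (Suc (fst i)))" for i
  have s_mono: "s m \<le> s m'" if "m \<le> m'" for m m'
    unfolding s_def using that D by (simp add: mult_right_mono)
  have GT: "G m \<subseteq> \<T>" for m unfolding G_def using stopping_sub dense_sub by blast
  have setsT: "P \<in> sets \<mu>" if "P \<in> \<T>" for P using fmeasurableD[OF fmeas[OF that]] sets_mu by simp
  have setsOm: "dense_union F s \<in> sets M" for s by (rule fmeasurableD[OF dense_union_sets])
  have finG: "finite (G m)" for m by (rule finite_subset[OF _ finite_stopping[of F "s m"]]) (auto simp: G_def)
  have finI: "finite I" unfolding I_def using finG by auto
  have IT: "snd i \<in> \<T>" "snd i \<in> stopping F (s (fst i))" if "i \<in> I" for i
  proof -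
    have "snd i \<in> G (fst i)" using that unfolding I_def by auto
    then show "snd i \<in> \<T>" "snd i \<in> stopping F (s (fst i))" using GT[of "fst i"] by (auto simp: G_def)
  qed
  let ?A = "dense_union F (t + real N * D) - \<Union>bad"
  have cover: "?A \<subseteq> \<Union>(G m)" if m: "m < N" for m
  proof
    fix x assume x: "x \<in> ?A"
    have "x \<in> dense_union F (s m)"
      using x dense_union_antimono[OF F s_mono[of m N]] m unfolding s_def by auto
    then obtain P where P: "P \<in> stopping F (s m)" "x \<in> P" using stopping_props(2)[of F "s m"] by auto
    have "P' \<notin> bad" if "P \<subseteq> P'" for P' using x P(2) that by auto
    then show "x \<in> \<Union>(G m)" using P unfolding G_def by auto
  qed
  \<comment> \<open>The parent required by \<open>good_cube_half\<close> exists because the root is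
    not dense at the lowest level, hence at no higher one.\<close>
  have notQ: "P \<noteq> Q" if "P \<in> stopping F (s m)" for P m
  proof
    assume "P = Q"
    then have "Q \<in> dense F (s m)" using that stopping_sub by blast
    then show False using NQ dense_antimono[OF F s_mono[of 0 m]] unfolding s_def by auto
  qed
  have half: "measure M (E i) \<ge> measure M (snd i) / 2" if i: "i \<in> I" for i
  proof -
    let ?P = "snd i" and ?m = "fst i"
    have m: "?m < N" and PG: "?P \<in> G ?m" using i unfolding I_def by auto
    have "measure M (?P \<inter> dense_union F (s (Suc ?m))) \<le> measure M ?P / 2"
    proof (rule good_cube_half[OF F IT(2)[OF i] notQ[OF IT(2)[OF i]] s_mono, where osc = osc and D = D])
      fix P assume P: "P \<in> \<T>"
      have "real (Suc ?m) * D \<le> real N * D" using m D by (intro mult_right_mono) auto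
      then show "D * measure M (P \<inter> {x. s (Suc ?m) < F x}) * measure M (P \<inter> {x. F x \<le> s ?m}) \<le> osc P"
        using D by (intro osc[OF P]) (auto simp: s_def algebra_simps)
    next
      fix P' assume "P' \<in> \<T>" "?P \<subseteq> P'"
      then have "P' \<notin> bad" using PG unfolding G_def by blast
      then show "osc P' \<le> 1 / (8 * d) * D * (measure M P')\<^sup>2"
        using \<open>P' \<in> \<T>\<close> unfolding bad_def by auto
    qed (use D d in auto)
    moreover have "measure M ((?P \<inter> dense_union F (s (Suc ?m))) \<union> E i) = measure M (?P \<inter> dense_union F (s (Suc ?m))) + measure M (E i)"
    proof (rule measure_Un_AE)
      show "?P \<inter> dense_union F (s (Suc ?m)) \<in> fmeasurable M"
        by (rule fmeasurable_Int_fmeasurable[OF fmeas[OF IT(1)[OF i]] setsOm])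
      show "E i \<in> fmeasurable M" unfolding E_def
        by (rule fmeasurable_Diff[OF fmeas[OF IT(1)[OF i]] setsOm])
    qed (auto simp: E_def)
    moreover have "(?P \<inter> dense_union F (s (Suc ?m))) \<union> E i = ?P" unfolding E_def by auto
    ultimately show ?thesis by simp
  qed
  \<comment> \<open>For different levels, the later set lies in a dense union that was removed from
    the earlier set; on one level the stopping cubes themselves are disjoint.\<close>
  have disjE: "disjoint_family_on E I"
    unfolding disjoint_family_on_def
  proof (intro ballI impI)
    have lt: "E i \<inter> E j = {}" if "i \<in> I" "j \<in> I" "fst i < fst j" for i j
    proof -
      have "E j \<subseteq> dense_union F (s (fst j))" using IT(2)[OF that(2)] stopping_props(2)[of F "s (fst j)"] unfolding E_def by auto
      also have "\<dots> \<subseteq> dense_union F (s (Suc (fst i)))" using that(3) by (intro dense_union_antimono[OF F] s_mono) auto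
      finally show ?thesis unfolding E_def by auto
    qed
    fix i j assume ij: "i \<in> I" "j \<in> I" "i \<noteq> j"
    consider "fst i < fst j" | "fst j < fst i" | "fst i = fst j" "snd i \<noteq> snd j"
      using ij(3) by (metis linorder_neqE_nat prod_eqI)
    then show "E i \<inter> E j = {}"
    proof cases
      case 3
      then have "snd i \<inter> snd j = {}"
        using IT(2)[OF ij(1)] IT(2)[OF ij(2)] stopping_props(1)[of F "s (fst i)"] by (auto dest: disjointD)
      then show ?thesis unfolding E_def by auto
    qed (use lt ij in blast)+
  qed
  \<comment> \<open>The hypothesis \<open>carleson\<close> works inside a single cube, so the
    indices are grouped by the lowest-level stopping cube that contains them.\<close>
  define IR where "IR R = {i \<in> I. snd i \<subseteq> R}" for R
  have inR: "(\<Sum>i\<in>IR R. measure \<mu> (snd i)) \<le> 2 * W * measure \<mu> R" if R: "R \<in> stopping F t" for R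
  proof -
    have RT: "R \<in> \<T>" using R stopping_sub dense_sub by blast
    have "(\<Sum>i\<in>IR R. measure \<mu> (snd i)) \<le> (\<Sum>i\<in>IR R. 2 * (measure M (E i) * (measure \<mu> (snd i) / measure M (snd i))))"
    proof (rule sum_mono)
      fix i assume "i \<in> IR R"
      then have i: "i \<in> I" unfolding IR_def by auto
      have p: "measure M (snd i) > 0" using pos[OF IT(1)[OF i]] .
      have "measure \<mu> (snd i) = 2 * (measure M (snd i) / 2 * (measure \<mu> (snd i) / measure M (snd i)))"
        using p by simp
      also have "\<dots> \<le> 2 * (measure M (E i) * (measure \<mu> (snd i) / measure M (snd i)))"
        using half[OF i] p by (intro mult_left_mono mult_right_mono) auto
      finally show "measure \<mu> (snd i) \<le> 2 * (measure M (E i) * (measure \<mu> (snd i) / measure M (snd i)))" .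
    qed
    also have "\<dots> = 2 * (\<Sum>i\<in>IR R. measure M (E i) * (measure \<mu> (snd i) / measure M (snd i)))"
      by (simp add: sum_distrib_left)
    also have "(\<Sum>i\<in>IR R. measure M (E i) * (measure \<mu> (snd i) / measure M (snd i))) \<le> W * measure \<mu> R"
    proof (rule carleson[OF RT])
      show "finite (IR R)" unfolding IR_def using finI by auto
      show "disjoint_family_on E (IR R)" by (rule disjoint_family_on_mono[OF _ disjE]) (auto simp: IR_def)
      show "snd i \<in> \<T> \<and> snd i \<subseteq> R \<and> E i \<in> sets M \<and> E i \<subseteq> snd i" if "i \<in> IR R" for i
      proof -
        have i: "i \<in> I" "snd i \<subseteq> R" using that unfolding IR_def by auto
        have "E i \<in> sets M" unfolding E_def
          by (rule sets.Diff[OF fmeasurableD[OF fmeas[OF IT(1)[OF i(1)]]] setsOm])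
        then show ?thesis using i IT(1)[OF i(1)] unfolding E_def by auto
      qed
    qed
    finally show ?thesis by simp
  qed
  have Ieq: "I = (\<Union>R\<in>stopping F t. IR R)"
  proof (intro equalityI subsetI)
    fix i assume i: "i \<in> I"
    have "t \<le> s (fst i)" unfolding s_def using D by simp
    then obtain R where "R \<in> stopping F t" "snd i \<subseteq> R" using stopping_subset[OF F _ IT(2)[OF i]] by auto
    then show "i \<in> (\<Union>R\<in>stopping F t. IR R)" using i unfolding IR_def by auto
  qed (auto simp: IR_def)
  have "real N * measure \<mu> ?A = (\<Sum>m<N. measure \<mu> ?A)" by simp
  also have "\<dots> \<le> (\<Sum>m<N. \<Sum>P\<in>G m. measure \<mu> P)"
  proof (rule sum_mono)
    fix m assume "m \<in> {..<N}"
    then have "measure \<mu> ?A \<le> measure \<mu> (\<Union>(G m))"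
      using cover[of m] GT[of m] setsT finG[of m] by (intro \<mu>.finite_measure_mono sets.finite_Union) auto
    also have "\<dots> \<le> (\<Sum>P\<in>G m. measure \<mu> P)"
      using GT[of m] setsT by (intro measure_Union_le[OF finG]) auto
    finally show "measure \<mu> ?A \<le> (\<Sum>P\<in>G m. measure \<mu> P)" .
  qed
  also have "\<dots> = (\<Sum>i\<in>I. measure \<mu> (snd i))"
    unfolding I_def by (subst sum.Sigma) (auto simp: finG case_prod_unfold)
  also have "\<dots> = (\<Sum>R\<in>stopping F t. \<Sum>i\<in>IR R. measure \<mu> (snd i))"
    unfolding Ieq
  proof (rule sum.UNION_disjoint)
    show "\<forall>R\<in>stopping F t. finite (IR R)" unfolding IR_def using finI by auto
    show "\<forall>R\<in>stopping F t. \<forall>R'\<in>stopping F t. R \<noteq> R' \<longrightarrow> IR R \<inter> IR R' = {}"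
    proof (intro ballI impI equals0I)
      fix R R' i assume R: "R \<in> stopping F t" "R' \<in> stopping F t" "R \<noteq> R'" "i \<in> IR R \<inter> IR R'"
      then have "snd i \<subseteq> R \<inter> R'" "i \<in> I" unfolding IR_def by auto
      moreover have "R \<inter> R' = {}" using R stopping_props(1)[of F t] by (auto dest: disjointD)
      ultimately show False using nonempty[OF IT(1)] by auto
    qed
  qed (rule finite_stopping)
  also have "\<dots> \<le> (\<Sum>R\<in>stopping F t. 2 * W * measure \<mu> R)" by (intro sum_mono inR)
  also have "\<dots> = 2 * W * (\<Sum>R\<in>stopping F t. measure \<mu> R)" by (simp add: sum_distrib_left)
  also have "(\<Sum>R\<in>stopping F t. measure \<mu> R) = measure \<mu> (\<Union>(stopping F t))"
  proof (rule measure_Union'[symmetric])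
    show "P \<in> fmeasurable \<mu>" if "P \<in> stopping F t" for P
    proof -
      have "P \<in> \<T>" using that stopping_sub dense_sub by blast
      then show ?thesis using setsT \<mu>.fmeasurable_eq_sets by simp
    qed
    show "pairwise disjnt (stopping F t)" using stopping_props(1)[of F t] unfolding disjoint_def pairwise_def disjnt_def by simp
  qed (rule finite_stopping)
  finally show ?thesis using stopping_props(2)[of F t] by simp
qed

end

section \<open>Powers and the Holder inequality in the extended half-line\<close>

lemma ennpowr_ennreal: "x \<ge> 0 \<Longrightarrow> ennreal x ennpowr a = ennreal (x powr a)"
  by (simp add: ennpowr_def)

lemma ennpowr_top [simp]: "top ennpowr a = top"
  by (simp add: ennpowr_def)

lemma ennpowr_zero [simp]: "0 ennpowr a = 0"
  by (simp add: ennpowr_def)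

lemma ennpowr_one_left [simp]: "1 ennpowr a = 1"
  using ennpowr_ennreal[of 1 a] by simp

lemma ennpowr_one_right [simp]: "x ennpowr 1 = x"
  by (cases x) (auto simp: ennpowr_def)

lemma ennpowr_eq_0_iff [simp]: "x ennpowr a = 0 \<longleftrightarrow> x = 0"
  by (cases x) (auto simp: ennpowr_def)

lemma ennpowr_eq_top_iff [simp]: "x ennpowr a = top \<longleftrightarrow> x = top"
  by (cases x) (auto simp: ennpowr_def)

lemma ennpowr_mono: "x \<le> y \<Longrightarrow> a \<ge> 0 \<Longrightarrow> x ennpowr a \<le> y ennpowr a"
  by (cases x; cases y) (auto simp: ennpowr_def top_unique intro!: powr_mono2)

lemma ennpowr_mult: "(x * y) ennpowr a = x ennpowr a * y ennpowr a"
proof (cases x; cases y)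
  fix r s assume "0 \<le> r" "x = ennreal r" "0 \<le> s" "y = ennreal s"
  then show ?thesis
    by (simp add: ennreal_mult'[symmetric] ennpowr_ennreal powr_mult)
qed (auto simp: ennpowr_def ennreal_mult_top ennreal_top_mult)

lemma ennpowr_add: "x ennpowr a * x ennpowr b = x ennpowr (a + b)"
  by (cases x) (auto simp: ennpowr_def powr_add ennreal_mult' ennreal_top_mult)

lemma ennpowr_measurable [measurable]:
  assumes [measurable]: "f \<in> borel_measurable M"
  shows "(\<lambda>x. f x ennpowr a) \<in> borel_measurable M"
  unfolding ennpowr_def by measurable

text \<open>Young's inequality for the normalised functions, integrated. Raising everything to the
  power \<open>p\<close> avoids roots and matches the form of the A_p condition. If a factor on the
  right vanishes, so does the integrand almost everywhere; otherwise an infinite factor makes the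
  right side infinite.\<close>

lemma nn_integral_Holder:
  fixes f h :: "'a \<Rightarrow> ennreal" and p :: real
  assumes [measurable]: "f \<in> borel_measurable M" "h \<in> borel_measurable M" and p: "p > 1"
  shows "(\<integral>\<^sup>+x. f x * h x \<partial>M) ennpowr p
    \<le> (\<integral>\<^sup>+x. f x ennpowr p \<partial>M) * (\<integral>\<^sup>+x. h x ennpowr (p / (p - 1)) \<partial>M) ennpowr (p - 1)"
proof -
  define p' where "p' = p / (p - 1)"
  define A where "A = (\<integral>\<^sup>+x. f x ennpowr p \<partial>M)"
  define B where "B = (\<integral>\<^sup>+x. h x ennpowr p' \<partial>M)"
  have p': "p' > 1" "1 / p + 1 / p' = 1" using p by (auto simp: p'_def field_simps)
  consider "A = 0 \<or> B = 0" | "A \<noteq> 0" "B \<noteq> 0" "A = \<infinity> \<or> B = \<infinity>"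
    | "A \<noteq> 0" "B \<noteq> 0" "A \<noteq> \<infinity>" "B \<noteq> \<infinity>" by blast
  then have "(\<integral>\<^sup>+x. f x * h x \<partial>M) ennpowr p \<le> A * B ennpowr (p - 1)"
  proof cases
    case 1
    then have "(AE x in M. f x = 0) \<or> (AE x in M. h x = 0)"
      unfolding A_def B_def by (subst (asm) (1 2) nn_integral_0_iff_AE) auto
    then have "AE x in M. f x * h x = 0" by auto
    then have "(\<integral>\<^sup>+x. f x * h x \<partial>M) = 0" by (subst nn_integral_0_iff_AE) auto
    then show ?thesis by simp
  next
    case 2
    then have "A * B ennpowr (p - 1) = \<infinity>" by (auto simp: ennreal_mult_eq_top_iff)
    then show ?thesis by simp
  next
    case 3
    obtain a where a: "A = ennreal a" "a > 0" using 3 by (cases A) auto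
    obtain b where b: "B = ennreal b" "b > 0" using 3 by (cases B) auto
    \<comment> \<open>\<open>k\<close> is the classical Holder bound, the product of the two norms;
      Young's inequality is applied after dividing each function by its norm.\<close>
    define k where "k = a powr (1 / p) * b powr (1 / p')"
    have k: "k > 0" using a b by (simp add: k_def)
    have finf: "AE x in M. f x \<noteq> \<infinity>"
    proof -
      have "AE x in M. f x ennpowr p \<noteq> \<infinity>"
        using 3(3) unfolding A_def by (intro nn_integral_noteq_infinite) auto
      then show ?thesis by simp
    qed
    have finh: "AE x in M. h x \<noteq> \<infinity>"
    proof -
      have "AE x in M. h x ennpowr p' \<noteq> \<infinity>"
        using 3(4) unfolding B_def by (intro nn_integral_noteq_infinite) auto
      then show ?thesis by simp
    qed
    have "(\<integral>\<^sup>+x. f x * h x \<partial>M)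
      \<le> (\<integral>\<^sup>+x. ennreal (k / (p * a)) * (f x ennpowr p) + ennreal (k / (p' * b)) * (h x ennpowr p') \<partial>M)"
    proof (rule nn_integral_mono_AE)
      show "AE x in M. f x * h x \<le> ennreal (k / (p * a)) * (f x ennpowr p) + ennreal (k / (p' * b)) * (h x ennpowr p')"
        using finf finh
      proof eventually_elim
        case (elim x)
        obtain u where u: "f x = ennreal u" "u \<ge> 0" using elim by (cases "f x") auto
        obtain v where v: "h x = ennreal v" "v \<ge> 0" using elim by (cases "h x") auto
        have "(u / a powr (1 / p)) * (v / b powr (1 / p'))
          \<le> (u / a powr (1 / p)) powr p / p + (v / b powr (1 / p')) powr p' / p'"
          using a b p p' u v by (intro Youngs_inequality) auto
        also have "\<dots> = u powr p / (p * a) + v powr p' / (p' * b)"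
          using a b p p' u v by (simp add: powr_divide powr_powr field_simps)
        finally have "k * ((u / a powr (1 / p)) * (v / b powr (1 / p'))) \<le> k * (u powr p / (p * a) + v powr p' / (p' * b))"
          using k by (intro mult_left_mono) auto
        moreover have "k * ((u / a powr (1 / p)) * (v / b powr (1 / p'))) = u * v"
          using a b by (simp add: k_def)
        ultimately have "u * v \<le> k / (p * a) * u powr p + k / (p' * b) * v powr p'"
          by (simp add: algebra_simps)
        then have "ennreal (u * v) \<le> ennreal (k / (p * a) * u powr p + k / (p' * b) * v powr p')"
          by (rule ennreal_leI)
        also have "\<dots> = ennreal (k / (p * a)) * ennreal (u powr p) + ennreal (k / (p' * b)) * ennreal (v powr p')"
        proof -
          have "0 \<le> k / (p * a)" "0 \<le> k / (p' * b)" using k a b p p' by auto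
          then show ?thesis by (simp add: ennreal_plus ennreal_mult' del: times_divide_eq_left)
        qed
        finally show ?case using u v by (simp add: ennpowr_ennreal ennreal_mult')
      qed
    qed
    also have "\<dots> = ennreal (k / (p * a)) * A + ennreal (k / (p' * b)) * B"
      unfolding A_def B_def by (subst nn_integral_add) (auto simp: nn_integral_cmult)
    also have "\<dots> = ennreal (k / (p * a) * a + k / (p' * b) * b)"
    proof -
      have "0 \<le> k / (p * a)" "0 \<le> k / (p' * b)" using k a b p p' by auto
      then show ?thesis using a b by (simp add: ennreal_plus ennreal_mult' del: times_divide_eq_left)
    qed
    also have "k / (p * a) * a + k / (p' * b) * b = k * (1 / p + 1 / p')"
      using a b by (simp add: field_simps)
    finally have "(\<integral>\<^sup>+x. f x * h x \<partial>M) \<le> ennreal k" using p' by simp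
    then have "(\<integral>\<^sup>+x. f x * h x \<partial>M) ennpowr p \<le> ennreal k ennpowr p"
      using p by (intro ennpowr_mono) auto
    also have "\<dots> = ennreal (a * b powr (p - 1))"
      using k a b p by (simp add: ennpowr_ennreal k_def powr_mult powr_powr p'_def)
    also have "\<dots> = A * B ennpowr (p - 1)"
      using a b by (simp add: ennpowr_ennreal ennreal_mult')
    finally show ?thesis .
  qed
  then show ?thesis unfolding A_def B_def p'_def .
qed

section \<open>Comparison of two points through their midpoint\<close>

lemma nn_integral_lborel_midpoint:
  fixes x :: "real ^ 'n" and h :: "real ^ 'n \<Rightarrow> ennreal"
  assumes [measurable]: "h \<in> borel_measurable borel"
  shows "(\<integral>\<^sup>+y. h ((1/2) *\<^sub>R (x + y)) \<partial>lborel) = 2 ^ CARD('n) * (\<integral>\<^sup>+z. h z \<partial>lborel)"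
proof -
  have eq: "(1/2) *\<^sub>R (x + (- x + 2 *\<^sub>R z)) = z" for z :: "real ^ 'n" by simp
  have "(\<integral>\<^sup>+y. h ((1/2) *\<^sub>R (x + y)) \<partial>lborel)
    = (\<integral>\<^sup>+y. h ((1/2) *\<^sub>R (x + y)) \<partial>density (distr lborel borel (\<lambda>z. - x + 2 *\<^sub>R z)) (\<lambda>_. ennreal (\<bar>2\<bar> ^ DIM(real^'n))))"
    using lborel_affine[of 2 "- x"] by simp
  also have "\<dots> = (\<integral>\<^sup>+z. 2 ^ CARD('n) * h z \<partial>lborel)"
    by (simp add: nn_integral_density nn_integral_distr eq ennreal_power[symmetric] del: scaleR_add_right)
  also have "\<dots> = 2 ^ CARD('n) * (\<integral>\<^sup>+z. h z \<partial>lborel)" by (rule nn_integral_cmult) auto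
  finally show ?thesis .
qed

text \<open>Domain and distance restriction are put into the integrand, so that Fubini and the
  midpoint substitution run over the whole space.\<close>

definition near_diff :: "(real ^ 'n) set \<Rightarrow> (real ^ 'n \<Rightarrow> real) \<Rightarrow> real \<Rightarrow> real ^ 'n \<Rightarrow> real ^ 'n \<Rightarrow> ennreal" where
  "near_diff P g r x y = indicator P x * indicator P y * indicator {z. norm z \<le> r} (x - y) * ennreal \<bar>g x - g y\<bar>"

lemma near_diff_measurable [measurable]:
  fixes P :: "(real ^ 'n) set"
  assumes [measurable]: "P \<in> sets borel" "g \<in> borel_measurable borel"
  shows "(\<lambda>(x, y). near_diff P g r x y) \<in> borel_measurable (borel \<Otimes>\<^sub>M borel)"
  unfolding near_diff_def by measurable

text \<open>By convexity the midpoint stays in \<open>P\<close>, at half the distance from both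
  points. The triangle inequality produces two terms, and in each the substitution y = 2z - x costs
  the Jacobian 2^n; together this is 2^(n+1).\<close>

lemma midpoint_halving:
  fixes P :: "(real ^ 'n) set"
  assumes [measurable]: "P \<in> sets borel" "g \<in> borel_measurable borel" and cv: "convex P"
  shows "(\<integral>\<^sup>+x. \<integral>\<^sup>+y. near_diff P g r x y \<partial>lborel \<partial>lborel)
    \<le> 2 ^ (CARD('n) + 1) * (\<integral>\<^sup>+x. \<integral>\<^sup>+y. near_diff P g (r / 2) x y \<partial>lborel \<partial>lborel)"
proof -
  let ?m = "\<lambda>x y :: real ^ 'n. (1/2) *\<^sub>R (x + y)"
  define H where "H = near_diff P g (r / 2)"
  have H_meas[measurable]: "(\<lambda>(x, y). H x y) \<in> borel_measurable (borel \<Otimes>\<^sub>M borel)"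
    unfolding H_def by measurable
  have pt: "near_diff P g r x y \<le> H x (?m x y) + H y (?m x y)" for x y
  proof (cases "x \<in> P \<and> y \<in> P \<and> norm (x - y) \<le> r")
    case True
    have "?m x y \<in> P" using convexD[OF cv, of x y "1/2" "1/2"] True by (simp add: scaleR_add_right)
    moreover have "x - ?m x y = (1/2) *\<^sub>R (x - y)" by (simp add: algebra_simps vec_eq_iff)
    moreover have "y - ?m x y = (1/2) *\<^sub>R (y - x)" by (simp add: algebra_simps vec_eq_iff)
    moreover have "ennreal \<bar>g x - g y\<bar> \<le> ennreal \<bar>g x - g (?m x y)\<bar> + ennreal \<bar>g y - g (?m x y)\<bar>"
    proof -
      have "\<bar>g x - g y\<bar> \<le> \<bar>g x - g (?m x y)\<bar> + \<bar>g y - g (?m x y)\<bar>" by arith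
      then have "ennreal \<bar>g x - g y\<bar> \<le> ennreal (\<bar>g x - g (?m x y)\<bar> + \<bar>g y - g (?m x y)\<bar>)" by (rule ennreal_leI)
      then show ?thesis by (simp only: ennreal_plus abs_ge_zero)
    qed
    ultimately show ?thesis using True by (simp add: near_diff_def H_def norm_minus_commute)
  qed (auto simp: near_diff_def)
  have inner: "(\<integral>\<^sup>+y. H x (?m x y) \<partial>lborel) = 2 ^ CARD('n) * (\<integral>\<^sup>+y. H x y \<partial>lborel)" for x
    by (rule nn_integral_lborel_midpoint) measurable
  have A: "(\<integral>\<^sup>+x. \<integral>\<^sup>+y. H x (?m x y) \<partial>lborel \<partial>lborel) = 2 ^ CARD('n) * (\<integral>\<^sup>+x. \<integral>\<^sup>+y. H x y \<partial>lborel \<partial>lborel)"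
    unfolding inner by (rule nn_integral_cmult) measurable
  \<comment> \<open>After exchanging the order of integration the second term becomes the first,
    since the midpoint is symmetric.\<close>
  have "(\<integral>\<^sup>+x. \<integral>\<^sup>+y. H y (?m x y) \<partial>lborel \<partial>lborel) = (\<integral>\<^sup>+y. \<integral>\<^sup>+x. H y (?m x y) \<partial>lborel \<partial>lborel)"
    by (rule lborel_pair.Fubini') measurable
  also have "\<dots> = (\<integral>\<^sup>+x. \<integral>\<^sup>+y. H x (?m x y) \<partial>lborel \<partial>lborel)" by (simp add: add.commute)
  finally have B: "(\<integral>\<^sup>+x. \<integral>\<^sup>+y. H y (?m x y) \<partial>lborel \<partial>lborel) = 2 ^ CARD('n) * (\<integral>\<^sup>+x. \<integral>\<^sup>+y. H x y \<partial>lborel \<partial>lborel)"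
    using A by simp
  have "(\<integral>\<^sup>+x. \<integral>\<^sup>+y. near_diff P g r x y \<partial>lborel \<partial>lborel) \<le> (\<integral>\<^sup>+x. \<integral>\<^sup>+y. H x (?m x y) + H y (?m x y) \<partial>lborel \<partial>lborel)"
    by (intro nn_integral_mono pt)
  also have "\<dots> = (\<integral>\<^sup>+x. (\<integral>\<^sup>+y. H x (?m x y) \<partial>lborel) + (\<integral>\<^sup>+y. H y (?m x y) \<partial>lborel) \<partial>lborel)"
    by (intro nn_integral_cong nn_integral_add) measurable
  also have "\<dots> = (\<integral>\<^sup>+x. \<integral>\<^sup>+y. H x (?m x y) \<partial>lborel \<partial>lborel) + (\<integral>\<^sup>+x. \<integral>\<^sup>+y. H y (?m x y) \<partial>lborel \<partial>lborel)"
    by (intro nn_integral_add) measurable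
  also have "\<dots> = 2 ^ (CARD('n) + 1) * (\<integral>\<^sup>+x. \<integral>\<^sup>+y. H x y \<partial>lborel \<partial>lborel)"
    unfolding A B by (simp only: mult_2[symmetric] mult.assoc power_add power_one_right mult.left_commute)
  finally show ?thesis unfolding H_def .
qed

section \<open>Closed cubes and the weighted mean inequality for A_p weights\<close>

lemma cube_sets [measurable]: "cube a l \<in> sets borel"
  by (simp add: cube_def)

lemma emeasure_cube: "l \<ge> 0 \<Longrightarrow> emeasure lborel (cube (a :: real ^ 'n) l) = ennreal (l ^ CARD('n))"
proof -
  assume l: "l \<ge> 0"
  have "cube a l \<noteq> {}" unfolding cube_def using l by (simp add: interval_ne_empty_cart)
  then have "measure lborel (cube a l) = l ^ CARD('n)"
    unfolding cube_def by (subst content_cbox_cart) auto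
  moreover have "emeasure lborel (cube a l) \<noteq> \<infinity>" unfolding cube_def by (metis emeasure_lborel_cbox_finite infinity_ennreal_def less_irrefl)
  ultimately show ?thesis by (simp add: emeasure_eq_ennreal_measure)
qed

lemma weight_of_nonzero:
  fixes w :: "real ^ 'n \<Rightarrow> real"
  assumes [measurable]: "w \<in> borel_measurable lebesgue" "S \<in> sets lebesgue"
    and w: "AE x in lebesgue. w x > 0" and S: "emeasure lebesgue S \<noteq> 0"
  shows "weight_of w S \<noteq> 0"
proof
  assume "weight_of w S = 0"
  then have "AE x in lebesgue. ennreal (w x) * indicator S x = 0"
    unfolding weight_of_def by (subst (asm) nn_integral_0_iff_AE) auto
  with w have "AE x in lebesgue. x \<notin> S" by eventually_elim (auto simp: indicator_def split: if_splits)
  then have "emeasure lebesgue S = 0" by (subst (asm) AE_iff_measurable[of S]) auto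
  then show False using S by simp
qed

lemma average_cube:
  "l > 0 \<Longrightarrow> average (cube (a :: real ^ 'n) l) g = (\<integral>\<^sup>+x\<in>cube a l. ennreal (g x) \<partial>lebesgue) / ennreal (l ^ CARD('n))"
  unfolding average_def by (simp add: emeasure_cube)

lemma ennreal_divide_mult_cancel: "k > 0 \<Longrightarrow> X = ennreal k * (X / ennreal k)"
  by (simp add: ennreal_times_divide ennreal_mult_divide_eq mult.commute)

text \<open>The A_p condition in its testable form. For p > 1 it is Holder for the product of v
  w^(1/p) and w^(-1/p); for p = 1 the average of w is bounded by its maximal function, hence by a
  multiple of w itself. It is applied to oscillations in \<open>fractional_poincare_base\<close> and
  to indicators of subcubes in \<open>doubling\<close>.\<close>

lemma Ap_weighted_mean:
  fixes w :: "real ^ 'n \<Rightarrow> real" and v :: "real ^ 'n \<Rightarrow> ennreal" and a :: "real ^ 'n"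
  assumes w: "AE x in lebesgue. w x > 0" and p: "p \<ge> 1" and l: "l > 0"
    and [measurable]: "w \<in> borel_measurable lebesgue" "v \<in> borel_measurable lebesgue"
  defines "Q \<equiv> cube a l"
  shows "(\<integral>\<^sup>+x\<in>Q. v x \<partial>lebesgue) ennpowr p * weight_of w Q
    \<le> Ap_const p w * (ennreal (l ^ CARD('n)) ennpowr p) * (\<integral>\<^sup>+x\<in>Q. (v x ennpowr p) * ennreal (w x) \<partial>lebesgue)"
proof -
  let ?L = "l ^ CARD('n)"
  have L: "?L > 0" using l by simp
  have Qc: "Q \<in> cubes" unfolding Q_def cubes_def using l by blast
  have Qs[measurable]: "Q \<in> sets lebesgue" unfolding Q_def by simp
  note avg = average_cube[OF l, of a, folded Q_def]
  show ?thesis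
  proof (cases "p = 1")
    case True
    \<comment> \<open>The infimum defining \<open>A1_const\<close> is attained: it is the infimum of
      a sequence of admissible constants, and countably many exceptional null sets can be discarded
      together.\<close>
    define S where "S = {C. AE x in lebesgue. maximal w x \<le> C * ennreal (w x)}"
    have "AE x in lebesgue. maximal w x \<le> top * ennreal (w x)"
      using w by eventually_elim (auto simp: ennreal_top_mult)
    then have "S \<noteq> {}" unfolding S_def by blast
    then obtain c :: "nat \<Rightarrow> ennreal" where c: "range c \<subseteq> S" "Inf S = (INF i. c i)"
      using ennreal_Inf_countable_INF by metis
    have "AE x in lebesgue. \<forall>i. maximal w x \<le> c i * ennreal (w x)"
      using c(1) unfolding S_def by (subst AE_all_countable) auto
    then have C: "AE x in lebesgue. maximal w x \<le> A1_const w * ennreal (w x)"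
      using w
    proof eventually_elim
      case (elim x)
      then have "maximal w x / ennreal (w x) \<le> c i" for i
        by (intro divide_le_posI_ennreal) (auto simp: mult.commute)
      then have "maximal w x / ennreal (w x) \<le> A1_const w"
        unfolding A1_const_def S_def[symmetric] c(2) by (intro INF_greatest)
      then have "ennreal (w x) * (maximal w x / ennreal (w x)) \<le> ennreal (w x) * A1_const w"
        by (rule mult_left_mono) simp
      then show ?case using ennreal_divide_mult_cancel[OF elim(2), of "maximal w x"] by (simp add: mult.commute)
    qed
    have "(\<integral>\<^sup>+x\<in>Q. v x \<partial>lebesgue) * weight_of w Q \<le> A1_const w * (ennreal ?L * (\<integral>\<^sup>+x\<in>Q. v x * ennreal (w x) \<partial>lebesgue))"
    proof -
      let ?C = "A1_const w"
      have "(\<integral>\<^sup>+x\<in>Q. v x \<partial>lebesgue) * weight_of w Q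
          = ennreal ?L * (average Q w * (\<integral>\<^sup>+x\<in>Q. v x \<partial>lebesgue))"
        unfolding avg weight_of_def[symmetric] mult.assoc[symmetric]
          ennreal_divide_mult_cancel[OF L, of "weight_of w Q", symmetric] by (rule mult.commute)
      also have "average Q w * (\<integral>\<^sup>+x\<in>Q. v x \<partial>lebesgue) = (\<integral>\<^sup>+x. average Q w * (v x * indicator Q x) \<partial>lebesgue)"
        by (rule nn_integral_cmult[symmetric]) measurable
      also have "\<dots> \<le> (\<integral>\<^sup>+x. ?C * (v x * ennreal (w x) * indicator Q x) \<partial>lebesgue)"
      proof (rule nn_integral_mono_AE)
        show "AE x in lebesgue. average Q w * (v x * indicator Q x) \<le> ?C * (v x * ennreal (w x) * indicator Q x)"
          using C w
        proof eventually_elim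
          case (elim x)
          have "average Q w \<le> maximal w x" if "x \<in> Q"
          proof -
            have "average Q w \<le> average Q (\<lambda>y. \<bar>w y\<bar>)"
              unfolding average_def by (intro divide_right_mono_ennreal nn_integral_mono mult_right_mono ennreal_leI) auto
            also have "\<dots> \<le> maximal w x" unfolding maximal_def using Qc that by (intro SUP_upper) auto
            finally show ?thesis .
          qed
          show ?case
          proof (cases "x \<in> Q")
            case True
            then have "average Q w \<le> ?C * ennreal (w x)" using elim(1) \<open>x \<in> Q \<Longrightarrow> average Q w \<le> maximal w x\<close> by (meson order_trans)
            then have "average Q w * v x \<le> ?C * ennreal (w x) * v x" by (rule mult_right_mono) simp
            then show ?thesis using True by (simp add: mult_ac)
          qed simp
        qed
      qed
      also have "\<dots> = ?C * (\<integral>\<^sup>+x\<in>Q. v x * ennreal (w x) \<partial>lebesgue)"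
        by (rule nn_integral_cmult) measurable
      finally show ?thesis by (simp add: mult.left_commute mult_left_mono)
    qed
    then show ?thesis using True p by (simp add: Ap_const_def mult.assoc)
  next
    case False
    with p have p1: "p > 1" by simp
    define Y where "Y = (\<integral>\<^sup>+x\<in>Q. ennreal (w x powr (1 - p / (p - 1))) \<partial>lebesgue)"
    define V where "V = (\<integral>\<^sup>+x\<in>Q. (v x ennpowr p) * ennreal (w x) \<partial>lebesgue)"
    define f where "f x = v x * ennreal (w x powr (1 / p)) * indicator Q x" for x
    define h where "h x = ennreal (w x powr - (1 / p)) * indicator Q x" for x
    have fm: "f \<in> borel_measurable lebesgue" "h \<in> borel_measurable lebesgue"
      unfolding f_def h_def by measurable
    have "(\<integral>\<^sup>+x\<in>Q. v x \<partial>lebesgue) = (\<integral>\<^sup>+x. f x * h x \<partial>lebesgue)"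
    proof (rule nn_integral_cong_AE)
      show "AE x in lebesgue. v x * indicator Q x = f x * h x" using w
      proof eventually_elim
        case (elim x)
        have "ennreal (w x powr (1 / p)) * ennreal (w x powr - (1 / p)) = 1"
          using elim by (simp add: ennreal_mult'[symmetric] powr_add[symmetric])
        then show ?case unfolding f_def h_def by (simp add: mult.assoc indicator_def)
      qed
    qed
    moreover have "(\<integral>\<^sup>+x. f x ennpowr p \<partial>lebesgue) = V" unfolding V_def
    proof (rule nn_integral_cong_AE)
      show "AE x in lebesgue. f x ennpowr p = v x ennpowr p * ennreal (w x) * indicator Q x" using w
      proof eventually_elim
        case (elim x)
        then show ?case unfolding f_def using p1
          by (auto simp: ennpowr_mult ennpowr_ennreal powr_powr indicator_def)
      qed
    qed
    moreover have "(\<integral>\<^sup>+x. h x ennpowr (p / (p - 1)) \<partial>lebesgue) = Y" unfolding Y_def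
    proof (rule nn_integral_cong_AE)
      have e: "- (1 / p) * (p / (p - 1)) = 1 - p / (p - 1)" using p1 by (simp add: field_simps)
      show "AE x in lebesgue. h x ennpowr (p / (p - 1)) = ennreal (w x powr (1 - p / (p - 1))) * indicator Q x" using w
      proof eventually_elim
        case (elim x)
        have e2: "(w x powr - (1 / p)) powr (p / (p - 1)) = w x powr (1 - p / (p - 1))"
          by (simp only: powr_powr e)
        show ?case unfolding h_def using p1
          by (auto simp: ennpowr_mult ennpowr_ennreal indicator_def e2)
      qed
    qed
    ultimately have H: "(\<integral>\<^sup>+x\<in>Q. v x \<partial>lebesgue) ennpowr p \<le> V * Y ennpowr (p - 1)"
      using nn_integral_Holder[OF fm p1] by simp
    have "average Q w * average Q (\<lambda>x. w x powr (1 - p / (p - 1))) ennpowr (p - 1) \<le> Ap_const p w"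
      using Qc False unfolding Ap_const_def by (auto intro!: SUP_upper)
    then have A: "(weight_of w Q / ennreal ?L) * (Y / ennreal ?L) ennpowr (p - 1) \<le> Ap_const p w"
      unfolding avg Y_def weight_of_def .
    have Lp: "ennreal ?L ennpowr p = ennreal ?L * ennreal ?L ennpowr (p - 1)"
      using ennpowr_add[of "ennreal ?L" 1 "p - 1"] by simp
    have "(\<integral>\<^sup>+x\<in>Q. v x \<partial>lebesgue) ennpowr p * weight_of w Q \<le> V * Y ennpowr (p - 1) * weight_of w Q"
      using H by (rule mult_right_mono) simp
    also have "\<dots> = V * (ennreal ?L * (Y / ennreal ?L)) ennpowr (p - 1) * (ennreal ?L * (weight_of w Q / ennreal ?L))"
      unfolding ennreal_divide_mult_cancel[OF L, of Y, symmetric]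
        ennreal_divide_mult_cancel[OF L, of "weight_of w Q", symmetric] ..
    also have "\<dots> = V * (ennreal ?L ennpowr p) * ((weight_of w Q / ennreal ?L) * (Y / ennreal ?L) ennpowr (p - 1))"
      unfolding ennpowr_mult Lp by (simp only: mult_ac)
    also have "\<dots> \<le> V * (ennreal ?L ennpowr p) * Ap_const p w" by (intro mult_left_mono A) simp
    finally show ?thesis unfolding V_def by (simp only: mult_ac)
  qed
qed

section \<open>The oscillation of a function on one cube\<close>

lemma geometric_sum_le:
  fixes c :: real assumes "c \<ge> 2" shows "(\<Sum>i<Suc M. c ^ i) \<le> 2 * c ^ M"
proof (induction M)
  case (Suc M)
  have "2 * c ^ M \<le> c * c ^ M" using assms by (intro mult_right_mono) auto
  with Suc show ?case by simp
qed auto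

text \<open>Since s >= 1 the terms at least double, so the sum is at most twice its last term. With
  \<rho> = R / |x - y| this bounds a sum of dyadic cutoffs by the singular kernel, with a constant
  independent of s.\<close>

lemma dyadic_kernel_sum:
  fixes \<rho> s :: real assumes \<rho>: "\<rho> > 0" and s: "s \<ge> 1"
  shows "(\<Sum>i<M. if 2 ^ i \<le> \<rho> then 2 powr (real i * s) else 0) \<le> 2 * \<rho> powr s"
proof (induction M)
  case (Suc M)
  define c where "c = (2::real) powr s"
  have c: "c \<ge> 2" using powr_mono[of 1 s 2] s by (simp add: c_def)
  have ci: "2 powr (real i * s) = c ^ i" for i
    by (simp add: c_def powr_realpow[symmetric] powr_powr mult.commute)
  show ?case
  proof (cases "2 ^ M \<le> \<rho>")
    case True
    have "(\<Sum>i<Suc M. if 2 ^ i \<le> \<rho> then 2 powr (real i * s) else 0) \<le> (\<Sum>i<Suc M. c ^ i)"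
      by (intro sum_mono) (use c in \<open>auto simp: ci\<close>)
    also have "\<dots> \<le> 2 * c ^ M" by (rule geometric_sum_le[OF c])
    also have "c ^ M = (2 ^ M) powr s" by (simp add: ci[symmetric] powr_realpow[symmetric] powr_powr)
    also have "\<dots> \<le> \<rho> powr s" using True s by (intro powr_mono2) auto
    finally show ?thesis by simp
  qed (use Suc in simp)
qed (use \<rho> in auto)

lemma emeasure_norm_ball_le:
  fixes x :: "real ^ 'n" assumes r: "r > 0"
  shows "(\<integral>\<^sup>+y. indicator {z. norm z \<le> r} (x - y) \<partial>lborel) \<le> ennreal ((2 * r) ^ CARD('n))"
proof -
  have "(\<integral>\<^sup>+y. indicator {z. norm z \<le> r} (x - y) \<partial>lborel) \<le> (\<integral>\<^sup>+y. indicator (cube (\<chi> i. x $ i - r) (2 * r)) y \<partial>lborel)"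
  proof (rule nn_integral_mono)
    fix y
    have "y \<in> cube (\<chi> i. x $ i - r) (2 * r)" if "norm (x - y) \<le> r"
    proof -
      have "\<bar>x $ i - y $ i\<bar> \<le> r" for i using component_le_norm_cart[of "x - y" i] that by simp
      then have "x $ i - r \<le> y $ i" "y $ i \<le> r + x $ i" for i by (smt (verit))+
      then show ?thesis by (simp add: cube_def mem_box_cart)
    qed
    then show "indicator {z. norm z \<le> r} (x - y) \<le> (indicator (cube (\<chi> i. x $ i - r) (2 * r)) y :: ennreal)"
      by (auto simp: indicator_def)
  qed
  also have "\<dots> = ennreal ((2 * r) ^ CARD('n))" using r by (simp add: emeasure_cube)
  finally show ?thesis .
qed

text \<open>Holder on the ball of radius \<open>r\<close> about \<open>x\<close>, whose volume is at
  most (2r)^n. The factor r^(n(p-1)) is a gain at small scales, which later offsets part of the loss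
  from repeated halving.\<close>

lemma near_diff_power:
  fixes P :: "(real ^ 'n) set"
  assumes [measurable]: "P \<in> sets borel" "g \<in> borel_measurable borel" and r: "r > 0" and p: "p \<ge> 1"
  shows "(\<integral>\<^sup>+y. near_diff P g r x y \<partial>lborel) ennpowr p
    \<le> ennreal (((2 * r) ^ CARD('n)) powr (p - 1))
      * (\<integral>\<^sup>+y\<in>P. indicator {z. norm z \<le> r} (x - y) * ennreal (\<bar>g x - g y\<bar> powr p) \<partial>lborel)"
proof (cases "p = 1")
  case True
  have "(\<integral>\<^sup>+y. near_diff P g r x y \<partial>lborel) \<le> (\<integral>\<^sup>+y\<in>P. indicator {z. norm z \<le> r} (x - y) * ennreal (\<bar>g x - g y\<bar> powr p) \<partial>lborel)"
    unfolding near_diff_def True by (intro nn_integral_mono) (auto simp: indicator_def)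
  then show ?thesis using True r by simp
next
  case False
  with p have p1: "p > 1" by simp
  define f where "f y = indicator P x * indicator P y * indicator {z. norm z \<le> r} (x - y) * ennreal \<bar>g x - g y\<bar>" for y
  define h :: "real ^ 'n \<Rightarrow> ennreal" where "h y = indicator {z. norm z \<le> r} (x - y)" for y
  have [measurable]: "f \<in> borel_measurable lborel" "h \<in> borel_measurable lborel"
    unfolding f_def h_def by measurable
  have "(\<integral>\<^sup>+y. near_diff P g r x y \<partial>lborel) = (\<integral>\<^sup>+y. f y * h y \<partial>lborel)"
    unfolding near_diff_def f_def h_def by (intro nn_integral_cong) (auto simp: indicator_def)
  then have "(\<integral>\<^sup>+y. near_diff P g r x y \<partial>lborel) ennpowr p
      \<le> (\<integral>\<^sup>+y. f y ennpowr p \<partial>lborel) * (\<integral>\<^sup>+y. h y ennpowr (p / (p - 1)) \<partial>lborel) ennpowr (p - 1)"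
    using nn_integral_Holder[of f lborel h p] p1 by simp
  also have "\<dots> \<le> (\<integral>\<^sup>+y\<in>P. indicator {z. norm z \<le> r} (x - y) * ennreal (\<bar>g x - g y\<bar> powr p) \<partial>lborel)
      * ennreal ((2 * r) ^ CARD('n)) ennpowr (p - 1)"
  proof (intro mult_mono ennpowr_mono)
    show "(\<integral>\<^sup>+y. f y ennpowr p \<partial>lborel) \<le> (\<integral>\<^sup>+y\<in>P. indicator {z. norm z \<le> r} (x - y) * ennreal (\<bar>g x - g y\<bar> powr p) \<partial>lborel)"
      by (intro nn_integral_mono) (auto simp: f_def indicator_def ennpowr_ennreal)
    have "(\<integral>\<^sup>+y. h y ennpowr (p / (p - 1)) \<partial>lborel) = (\<integral>\<^sup>+y. indicator {z. norm z \<le> r} (x - y) \<partial>lborel)"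
      by (intro nn_integral_cong) (auto simp: h_def indicator_def)
    then show "(\<integral>\<^sup>+y. h y ennpowr (p / (p - 1)) \<partial>lborel) \<le> ennreal ((2 * r) ^ CARD('n))"
      using emeasure_norm_ball_le[OF r, of x] by simp
  qed (use p1 in auto)
  finally show ?thesis using r by (simp add: ennpowr_ennreal mult.commute)
qed

lemma norm_diff_cube:
  fixes x y :: "real ^ 'n"
  assumes "x \<in> cube b s" "y \<in> cube b s" shows "norm (x - y) \<le> real CARD('n) * s"
proof -
  have "norm (x - y) \<le> (\<Sum>i\<in>UNIV. \<bar>(x - y) $ i\<bar>)" by (rule norm_le_l1_cart)
  also have "\<dots> \<le> (\<Sum>i\<in>(UNIV :: 'n set). s)"
  proof (rule sum_mono)
    fix i :: 'n
    have "b $ i \<le> x $ i \<and> x $ i \<le> b $ i + s" "b $ i \<le> y $ i \<and> y $ i \<le> b $ i + s"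
      using assms by (auto simp: cube_def mem_box_cart)
    then show "\<bar>(x - y) $ i\<bar> \<le> s" by (simp add: abs_le_iff)
  qed
  finally show ?thesis by simp
qed

text \<open>The inner integral of the fractional seminorm. At y = x the quotient is 0 by convention,
  which affects only a null set.\<close>

definition gagliardo :: "real \<Rightarrow> real \<Rightarrow> (real ^ 'n) set \<Rightarrow> (real ^ 'n \<Rightarrow> real) \<Rightarrow> real ^ 'n \<Rightarrow> ennreal" where
  "gagliardo \<delta> p P g x = (\<integral>\<^sup>+y\<in>P. ennreal (\<bar>g x - g y\<bar> powr p / norm (x - y) powr (real CARD('n) + \<delta> * p)) \<partial>lborel)"

lemma gagliardo_measurable [measurable]:
  fixes P :: "(real ^ 'n) set"
  assumes [measurable]: "P \<in> sets borel" "g \<in> borel_measurable borel"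
  shows "gagliardo \<delta> p P g \<in> borel_measurable borel"
  unfolding gagliardo_def by measurable

text \<open>The cutoff |x - y| <= R / 2^i says 2^i <= R / |x - y|, so
  \<open>dyadic_kernel_sum\<close> applies to each pair of points. All scales are thus paid for by a
  single copy of the seminorm.\<close>

lemma gagliardo_ge_sum:
  fixes P :: "(real ^ 'n) set"
  assumes [measurable]: "P \<in> sets borel" "g \<in> borel_measurable borel" and R: "R > 0" and p: "p \<ge> 1" and \<delta>: "\<delta> > 0"
  defines "s \<equiv> real CARD('n) + \<delta> * p"
  shows "(\<Sum>i<M. ennreal (2 powr (real i * s)) * (\<integral>\<^sup>+y\<in>P. indicator {z. norm z \<le> R / 2 ^ i} (x - y) * ennreal (\<bar>g x - g y\<bar> powr p) \<partial>lborel))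
    \<le> ennreal (2 * R powr s) * gagliardo \<delta> p P g x"
proof -
  have s: "s \<ge> 1" unfolding s_def using p \<delta> by (smt (verit) mult_pos_pos of_nat_1 of_nat_mono zero_less_card_finite One_nat_def Suc_leI)
  have "(\<Sum>i<M. ennreal (2 powr (real i * s)) * (\<integral>\<^sup>+y\<in>P. indicator {z. norm z \<le> R / 2 ^ i} (x - y) * ennreal (\<bar>g x - g y\<bar> powr p) \<partial>lborel))
     = (\<integral>\<^sup>+y. (\<Sum>i<M. ennreal (2 powr (real i * s)) * (indicator {z. norm z \<le> R / 2 ^ i} (x - y) * ennreal (\<bar>g x - g y\<bar> powr p) * indicator P y)) \<partial>lborel)"
    by (subst nn_integral_sum) (auto simp: nn_integral_cmult)
  also have "\<dots> \<le> (\<integral>\<^sup>+y. ennreal (2 * R powr s) * (ennreal (\<bar>g x - g y\<bar> powr p / norm (x - y) powr s) * indicator P y) \<partial>lborel)"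
  proof (rule nn_integral_mono)
    fix y
    let ?G = "\<bar>g x - g y\<bar> powr p"
    let ?h = "\<lambda>i. indicator {z. norm z \<le> R / 2 ^ i} (x - y) * ennreal ?G * indicator P y"
    show "(\<Sum>i<M. ennreal (2 powr (real i * s)) * ?h i)
      \<le> ennreal (2 * R powr s) * (ennreal (?G / norm (x - y) powr s) * indicator P y)"
    proof (cases "x = y \<or> y \<notin> P")
      case False
      then have n: "norm (x - y) > 0" by simp
      have "(\<Sum>i<M. ennreal (2 powr (real i * s)) * ?h i)
        = (\<Sum>i<M. ennreal ((if 2 ^ i \<le> R / norm (x - y) then 2 powr (real i * s) else 0) * ?G))"
        using False n by (intro sum.cong) (auto simp: indicator_def field_simps ennreal_mult')
      also have "\<dots> = ennreal ((\<Sum>i<M. (if 2 ^ i \<le> R / norm (x - y) then 2 powr (real i * s) else 0)) * ?G)"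
        by (subst sum_ennreal) (auto simp: sum_distrib_right)
      also have "\<dots> \<le> ennreal ((2 * (R / norm (x - y)) powr s) * ?G)"
        using R n by (intro ennreal_leI mult_right_mono dyadic_kernel_sum s) auto
      also have "\<dots> = ennreal ((2 * R powr s) * (?G / norm (x - y) powr s))"
        using R n by (simp add: powr_divide)
      finally show ?thesis using False by (simp add: ennreal_mult' del: times_divide_eq_right)
    qed auto
  qed
  also have "\<dots> = ennreal (2 * R powr s) * gagliardo \<delta> p P g x"
    unfolding gagliardo_def s_def by (rule nn_integral_cmult) measurable
  finally show ?thesis .
qed

text \<open>After taking p-th roots the constant may depend only on n. So 4p is absorbed through 4p
  <= 8^p, and n^(\<delta> p) through n^p; only the factor 1 - \<delta> and the scaling s^(\<delta>
  p) are kept.\<close>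

lemma base_constant_bound:
  fixes R \<delta> p s :: real and n :: nat
  assumes \<delta>: "0 < \<delta>" "\<delta> < 1" and p: "p \<ge> 1" and s: "s > 0" and n: "n \<ge> 1"
  defines "R \<equiv> real n * s"
  shows "(1 - \<delta>) * p * (2 * (2 * R) powr (real n * (p - 1)) * (s ^ n) powr p * (2 * R powr (real n + \<delta> * p)))
    \<le> (1 - \<delta>) * (8 * 2 ^ n * real n ^ (n + 1) * (s ^ n) * (s ^ n)) powr p * s powr (\<delta> * p)"
proof -
  have R: "R > 0" unfolding R_def using s n by simp
  have p2: "p \<le> 2 powr p"
  proof -
    have "ln 2 \<ge> (1/2 :: real)" using ln2_ge_two_thirds by simp
    then have "(p - 1) * (1/2) \<le> (p - 1) * ln 2" using p by (intro mult_left_mono) auto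
    moreover have "1 + (p - 1) * ln 2 \<le> 2 powr (p - 1)"
      using exp_ge_add_one_self[of "(p - 1) * ln 2"] by (simp add: powr_def)
    ultimately have "p \<le> 2 powr (p - 1) * 2" by argo
    also have "\<dots> = 2 powr p" using powr_add[of 2 "p - 1" 1] by simp
    finally show ?thesis .
  qed
  have "4 * p \<le> 4 powr p * 2 powr p"
    using p2 p powr_mono[of 1 p 4] by (intro mult_mono) auto
  also have "\<dots> = 8 powr p" by (simp add: powr_mult[symmetric])
  finally have c8: "4 * p \<le> 8 powr p" .
  have e1: "(2 * R) powr (real n * (p - 1)) * R powr real n \<le> (2 * R) powr (real n * p)"
  proof -
    have "(2 * R) powr (real n * (p - 1)) * R powr real n \<le> (2 * R) powr (real n * (p - 1)) * (2 * R) powr real n"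
      using R by (intro mult_left_mono powr_mono2) auto
    also have "\<dots> = (2 * R) powr (real n * p)" by (simp add: powr_add[symmetric] algebra_simps)
    finally show ?thesis .
  qed
  have e2: "R powr (\<delta> * p) \<le> real n powr p * s powr (\<delta> * p)"
  proof -
    have "real n powr (\<delta> * p) \<le> real n powr p"
      using \<delta> p n by (intro powr_mono) (auto simp: mult_le_cancel_right1)
    then show ?thesis unfolding R_def using s n by (simp add: powr_mult mult_right_mono)
  qed
  have e3: "(2 * R) powr (real n * p) = (2 ^ n * real n ^ n * s ^ n) powr p"
  proof -
    have "(2 * R) powr (real n * p) = ((2 * R) powr real n) powr p" by (simp add: powr_powr)
    also have "(2 * R) powr real n = 2 ^ n * real n ^ n * s ^ n"
      using R by (simp add: powr_realpow R_def power_mult_distrib mult.assoc)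
    finally show ?thesis .
  qed
  have "p * (2 * (2 * R) powr (real n * (p - 1)) * (s ^ n) powr p * (2 * R powr (real n + \<delta> * p)))
    = (4 * p) * ((2 * R) powr (real n * (p - 1)) * R powr real n) * (s ^ n) powr p * R powr (\<delta> * p)"
    by (simp add: powr_add)
  also have "\<dots> \<le> (8 powr p) * ((2 ^ n * real n ^ n * s ^ n) powr p) * (s ^ n) powr p * (real n powr p * s powr (\<delta> * p))"
    using e1 e2 c8 p unfolding e3 by (intro mult_mono) auto
  also have "\<dots> = (8 * 2 ^ n * real n ^ (n + 1) * (s ^ n) * (s ^ n)) powr p * s powr (\<delta> * p)"
    using s by (simp add: powr_mult mult_ac)
  finally show ?thesis using \<delta> by (simp add: mult_left_mono mult.assoc)
qed

lemma ennreal_le_inverse_mult: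
  assumes "ennreal m * X \<le> Y" "m > 0" shows "X \<le> ennreal (1 / m) * Y"
proof -
  have "X = ennreal (1 / m) * (ennreal m * X)"
    using assms(2) by (simp add: mult.assoc[symmetric] ennreal_mult'[symmetric])
  also have "\<dots> \<le> ennreal (1 / m) * Y" by (intro mult_left_mono assms(1)) simp
  finally show ?thesis .
qed

text \<open>Halving the admissible distance at most multiplies the oscillation integral by $2^{n+1}$, while the
  kernel gains $2^{n + \delta p}$ in each $p$-th power. So about $1/((1-\delta)p)$ consecutive dyadic
  scales contribute equally to the seminorm, which produces the factor $1-\delta$.\<close>

lemma fractional_poincare_base:
  fixes g w :: "real ^ 'n \<Rightarrow> real" and b :: "real ^ 'n"
  assumes [measurable]: "g \<in> borel_measurable borel" "w \<in> borel_measurable lebesgue"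
    and w: "AE x in lebesgue. w x > 0"
    and \<delta>: "0 < \<delta>" "\<delta> < 1" and p: "p \<ge> 1" and s: "s > 0"
  defines "P \<equiv> cube b s" and "n \<equiv> CARD('n)"
  shows "(\<integral>\<^sup>+x\<in>P. (\<integral>\<^sup>+y\<in>P. ennreal \<bar>g x - g y\<bar> \<partial>lborel) \<partial>lborel) ennpowr p * weight_of w P
    \<le> ennreal ((1 - \<delta>) * (8 * 2 ^ n * real n ^ (n + 1) * (s ^ n) * (s ^ n)) powr p * s powr (\<delta> * p))
      * Ap_const p w * (\<integral>\<^sup>+x\<in>P. gagliardo \<delta> p P g x * ennreal (w x) \<partial>lebesgue)"
proof -
  let ?J = "\<lambda>h. \<integral>\<^sup>+x\<in>P. h x * ennreal (w x) \<partial>lebesgue"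
  have n: "n \<ge> 1" unfolding n_def by (simp add: Suc_leI)
  \<comment> \<open>\<open>R\<close> bounds the diameter of \<open>P\<close>, so at scale i = 0 the
    distance cutoff is no restriction.\<close>
  define R where "R = real n * s"
  have R: "R > 0" unfolding R_def using s n by simp
  define \<sigma> where "\<sigma> = real n + \<delta> * p"
  have [measurable]: "P \<in> sets borel" unfolding P_def by simp
  have cv: "convex P" unfolding P_def cube_def by (rule convex_box)
  define v where "v i x = (\<integral>\<^sup>+y. near_diff P g (R / 2 ^ i) x y \<partial>lborel)" for i x
  define V where "V i x = (\<integral>\<^sup>+y\<in>P. indicator {z. norm z \<le> R / 2 ^ i} (x - y) * ennreal (\<bar>g x - g y\<bar> powr p) \<partial>lborel)" for i x
  define T where "T i = (\<integral>\<^sup>+x. v i x \<partial>lborel)" for i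
  have v_meas[measurable]: "v i \<in> borel_measurable borel" for i
    unfolding v_def by measurable
  have V_meas[measurable]: "V i \<in> borel_measurable borel" for i
    unfolding V_def by measurable
  have leb: "f \<in> borel_measurable lebesgue" if "f \<in> borel_measurable borel" for f :: "real ^ 'n \<Rightarrow> ennreal"
    using that by (simp add: measurable_completion)
  have V_leb[measurable]: "V i \<in> borel_measurable lebesgue" for i by (rule leb[OF V_meas])
  have G_leb[measurable]: "gagliardo \<delta> p P g \<in> borel_measurable lebesgue"
    by (rule leb[OF gagliardo_measurable]) measurable
  have P_leb[measurable]: "P \<in> sets lebesgue" by simp
  have T0: "(\<integral>\<^sup>+x\<in>P. (\<integral>\<^sup>+y\<in>P. ennreal \<bar>g x - g y\<bar> \<partial>lborel) \<partial>lborel) = T 0"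
    unfolding T_def v_def
  proof (rule nn_integral_cong)
    fix x
    show "(\<integral>\<^sup>+y\<in>P. ennreal \<bar>g x - g y\<bar> \<partial>lborel) * indicator P x = (\<integral>\<^sup>+y. near_diff P g (R / 2 ^ 0) x y \<partial>lborel)"
    proof (cases "x \<in> P")
      case True
      then have "near_diff P g (R / 2 ^ 0) x y = ennreal \<bar>g x - g y\<bar> * indicator P y" for y
        using norm_diff_cube[of x b s y] unfolding near_diff_def P_def R_def n_def by (auto simp: indicator_def)
      then show ?thesis using True by simp
    qed (simp add: near_diff_def)
  qed
  have iter: "T 0 \<le> ennreal ((2 ^ (n + 1)) ^ i) * T i" for i
  proof (induction i)
    case (Suc i)
    have "T i \<le> ennreal (2 ^ (n + 1)) * T (Suc i)"
      using midpoint_halving[of P g "R / 2 ^ i", OF _ _ cv] unfolding T_def v_def n_def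
      by (simp add: field_simps ennreal_power[symmetric] ennreal_mult')
    then have "ennreal ((2 ^ (n + 1)) ^ i) * T i \<le> ennreal ((2 ^ (n + 1)) ^ i) * (ennreal (2 ^ (n + 1)) * T (Suc i))"
      by (rule mult_left_mono) simp
    also have "\<dots> = ennreal ((2 ^ (n + 1)) ^ Suc i) * T (Suc i)"
      by (simp only: mult.assoc[symmetric] ennreal_mult'[symmetric] power_Suc2 zero_le_power zero_le_numeral)
    finally show ?case using Suc by (rule order_trans[rotated])
  qed simp
  define A where "A = Ap_const p w"
  define L where "L = s ^ n"
  have L: "L > 0" unfolding L_def using s by simp
  define K where "K = 2 * (2 * R) powr (real n * (p - 1))"
  have K: "K > 0" unfolding K_def using R by simp
  let ?X = "T 0 ennpowr p * weight_of w P"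
  have scale: "?X \<le> ennreal (K * L powr p) * A * ?J (\<lambda>x. ennreal (2 powr (real i * \<sigma>)) * V i x)"
    if i: "real i * ((1 - \<delta>) * p) \<le> 1" for i
  proof -
    let ?k1 = "((2 ^ (n + 1)) ^ i) powr p :: real" and ?k2 = "((2 * (R / 2 ^ i)) ^ n) powr (p - 1)"
    have "T i = (\<integral>\<^sup>+x\<in>P. v i x \<partial>lebesgue)"
      unfolding T_def nn_integral_completion
      by (intro nn_integral_cong) (auto simp: v_def near_diff_def indicator_def)
    then have "T i ennpowr p * weight_of w P \<le> A * (ennreal L ennpowr p) * ?J (\<lambda>x. v i x ennpowr p)"
      using Ap_weighted_mean[OF w p s, of "v i" b] leb[OF v_meas] unfolding P_def A_def L_def n_def by simp
    also have "\<dots> \<le> A * (ennreal L ennpowr p) * ?J (\<lambda>x. ennreal ?k2 * V i x)"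
      unfolding v_def V_def n_def
      by (intro mult_left_mono nn_integral_mono mult_right_mono near_diff_power) (use R p in auto)
    finally have *: "T i ennpowr p * weight_of w P \<le> ennreal (L powr p) * A * ?J (\<lambda>x. ennreal ?k2 * V i x)"
      using L by (simp add: ennpowr_ennreal mult.commute)
    have "?X \<le> (ennreal ((2 ^ (n + 1)) ^ i) * T i) ennpowr p * weight_of w P"
      by (intro mult_right_mono ennpowr_mono iter) (use p in auto)
    also have "\<dots> = ennreal ?k1 * (T i ennpowr p * weight_of w P)"
      by (simp add: ennpowr_mult ennpowr_ennreal mult.assoc)
    also have "\<dots> \<le> ennreal ?k1 * (ennreal (L powr p) * A * ?J (\<lambda>x. ennreal ?k2 * V i x))"
      by (intro mult_left_mono *) simp
    also have "\<dots> = ennreal (L powr p) * A * (ennreal ?k1 * ?J (\<lambda>x. ennreal ?k2 * V i x))"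
      by (simp only: mult_ac)
    also have "\<dots> \<le> ennreal (L powr p) * A * (ennreal K * ?J (\<lambda>x. ennreal (2 powr (real i * \<sigma>)) * V i x))"
    proof (rule mult_left_mono)
      have "ennreal ?k1 * ?J (\<lambda>x. ennreal ?k2 * V i x)
          = (\<integral>\<^sup>+x. ennreal ?k1 * ((ennreal ?k2 * V i x) * ennreal (w x) * indicator P x) \<partial>lebesgue)"
        by (rule nn_integral_cmult[symmetric]) measurable
      also have "\<dots> \<le> (\<integral>\<^sup>+x. ennreal K * ((ennreal (2 powr (real i * \<sigma>)) * V i x) * ennreal (w x) * indicator P x) \<partial>lebesgue)"
      proof (rule nn_integral_mono)
        fix x
        \<comment> \<open>Exponents of 2^i: halving loses (n+1)p, Holder gains n(p-1), leaving n + p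
          = \<sigma> + (1-\<delta>)p. The kernel pays for \<sigma>, and the rest costs at most a
          factor 2 as long as i (1-\<delta>) p <= 1.\<close>
        have "?k1 * ?k2 = 2 powr (real (n + 1) * real i * p) * ((2 * R) powr (real n * (p - 1)) * 2 powr (- (real i * real n * (p - 1))))"
        proof -
          have "?k1 = 2 powr (real (n + 1) * real i * p)"
          proof -
            have "((2::real) ^ (n + 1)) ^ i = 2 powr real ((n + 1) * i)"
              by (subst powr_realpow) (auto simp: power_mult[symmetric] power_add)
            then show ?thesis by (simp only: powr_powr of_nat_mult)
          qed
          moreover have "?k2 = (2 * R) powr (real n * (p - 1)) * 2 powr (- (real i * real n * (p - 1)))"
          proof -
            have "(2 * (R / 2 ^ i)) ^ n = ((2 * R) * 2 powr (- real i)) powr real n"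
              using R by (simp add: powr_realpow powr_minus_divide)
            also have "\<dots> = (2 * R) powr real n * 2 powr (- (real i * real n))"
              using R by (simp add: powr_mult powr_powr)
            finally show ?thesis using R by (simp add: powr_mult powr_powr)
          qed
          ultimately show ?thesis by simp
        qed
        also have "\<dots> = (2 * R) powr (real n * (p - 1)) * (2 powr (real i * ((1 - \<delta>) * p)) * 2 powr (real i * \<sigma>))"
          by (simp add: powr_add[symmetric] \<sigma>_def algebra_simps)
        also have "\<dots> \<le> (2 * R) powr (real n * (p - 1)) * (2 powr 1 * 2 powr (real i * \<sigma>))"
          using i by (intro mult_left_mono mult_right_mono powr_mono) auto
        finally have "?k1 * ?k2 \<le> K * 2 powr (real i * \<sigma>)" by (simp add: K_def)
        then have "ennreal ?k1 * ennreal ?k2 \<le> ennreal K * ennreal (2 powr (real i * \<sigma>))"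
          using K by (simp add: ennreal_mult'[symmetric] ennreal_leI)
        then have "(ennreal ?k1 * ennreal ?k2) * (V i x * ennreal (w x) * indicator P x) \<le> (ennreal K * ennreal (2 powr (real i * \<sigma>))) * (V i x * ennreal (w x) * indicator P x)"
          by (rule mult_right_mono) simp
        then show "ennreal ?k1 * ((ennreal ?k2 * V i x) * ennreal (w x) * indicator P x) \<le> ennreal K * ((ennreal (2 powr (real i * \<sigma>)) * V i x) * ennreal (w x) * indicator P x)"
          by (simp only: mult.assoc)
      qed
      also have "\<dots> = ennreal K * ?J (\<lambda>x. ennreal (2 powr (real i * \<sigma>)) * V i x)"
        by (rule nn_integral_cmult) measurable
    finally show "ennreal ?k1 * ?J (\<lambda>x. ennreal ?k2 * V i x)
          \<le> ennreal K * ?J (\<lambda>x. ennreal (2 powr (real i * \<sigma>)) * V i x)" .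
    qed simp
    also have "\<dots> = ennreal (K * L powr p) * A * ?J (\<lambda>x. ennreal (2 powr (real i * \<sigma>)) * V i x)"
      using K L by (simp add: ennreal_mult' mult_ac)
    finally show ?thesis .
  qed
  \<comment> \<open>The number of scales at which \<open>scale\<close> applies; the indices i < M
    satisfy its condition. Adding up M equal lower bounds yields the factor 1/M <= (1-\<delta>)
    p.\<close>
  define M where "M = nat \<lceil>1 / ((1 - \<delta>) * p)\<rceil>"
  have dp: "(1 - \<delta>) * p > 0" using \<delta> p by simp
  have M1: "real M \<ge> 1 / ((1 - \<delta>) * p)" unfolding M_def by linarith
  have Mpos: "real M > 0" using M1 dp by (smt (verit) divide_pos_pos)
  have Mi: "real i * ((1 - \<delta>) * p) \<le> 1" if "i < M" for i
  proof -
    have "real i \<le> 1 / ((1 - \<delta>) * p)" using that unfolding M_def by linarith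
    then show ?thesis using dp by (simp add: field_simps)
  qed
  have "ennreal (real M) * ?X = (\<Sum>i<M. ?X)" by (simp add: ennreal_of_nat_eq_real_of_nat)
  also have "\<dots> \<le> (\<Sum>i<M. ennreal (K * L powr p) * A * ?J (\<lambda>x. ennreal (2 powr (real i * \<sigma>)) * V i x))"
    by (intro sum_mono scale Mi) auto
  also have "\<dots> = ennreal (K * L powr p) * A * (\<integral>\<^sup>+x. (\<Sum>i<M. (ennreal (2 powr (real i * \<sigma>)) * V i x) * ennreal (w x) * indicator P x) \<partial>lebesgue)"
    by (subst nn_integral_sum) (auto simp: sum_distrib_left)
  also have "(\<integral>\<^sup>+x. (\<Sum>i<M. (ennreal (2 powr (real i * \<sigma>)) * V i x) * ennreal (w x) * indicator P x) \<partial>lebesgue)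
      \<le> (\<integral>\<^sup>+x. ennreal (2 * R powr \<sigma>) * (gagliardo \<delta> p P g x * ennreal (w x) * indicator P x) \<partial>lebesgue)"
  proof (rule nn_integral_mono)
    fix x
    have "(\<Sum>i<M. ennreal (2 powr (real i * \<sigma>)) * V i x) * (ennreal (w x) * indicator P x) \<le> (ennreal (2 * R powr \<sigma>) * gagliardo \<delta> p P g x) * (ennreal (w x) * indicator P x)"
      unfolding V_def \<sigma>_def n_def using R p \<delta> by (intro mult_right_mono gagliardo_ge_sum) auto
    then show "(\<Sum>i<M. (ennreal (2 powr (real i * \<sigma>)) * V i x) * ennreal (w x) * indicator P x) \<le> ennreal (2 * R powr \<sigma>) * (gagliardo \<delta> p P g x * ennreal (w x) * indicator P x)"
      by (simp only: sum_distrib_right mult.assoc)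
  qed
  also have "\<dots> = ennreal (2 * R powr \<sigma>) * ?J (gagliardo \<delta> p P g)"
    by (rule nn_integral_cmult) measurable
  finally have fin: "ennreal (real M) * ?X \<le> ennreal (K * L powr p) * A * (ennreal (2 * R powr \<sigma>) * ?J (gagliardo \<delta> p P g))"
    by (simp add: mult_left_mono)
  have "?X \<le> ennreal (1 / real M) * (ennreal (K * L powr p) * A * (ennreal (2 * R powr \<sigma>) * ?J (gagliardo \<delta> p P g)))"
    by (rule ennreal_le_inverse_mult[OF fin Mpos])
  also have "\<dots> = ennreal (1 / real M * (K * L powr p * (2 * R powr \<sigma>))) * A * ?J (gagliardo \<delta> p P g)"
    using K by (simp add: ennreal_mult' mult_ac del: times_divide_eq_left times_divide_eq_right)
  also have "\<dots> \<le> ennreal ((1 - \<delta>) * (8 * 2 ^ n * real n ^ (n + 1) * (s ^ n) * (s ^ n)) powr p * s powr (\<delta> * p)) * A * ?J (gagliardo \<delta> p P g)"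
  proof (intro mult_right_mono ennreal_leI)
    have "1 / real M \<le> (1 - \<delta>) * p" using M1 Mpos dp by (simp add: field_simps)
    then have "1 / real M * (K * L powr p * (2 * R powr \<sigma>)) \<le> (1 - \<delta>) * p * (K * L powr p * (2 * R powr \<sigma>))"
      using K by (intro mult_right_mono) auto
    also have "\<dots> \<le> (1 - \<delta>) * (8 * 2 ^ n * real n ^ (n + 1) * (s ^ n) * (s ^ n)) powr p * s powr (\<delta> * p)"
      using base_constant_bound[OF \<delta> p s n] unfolding K_def L_def R_def \<sigma>_def by simp
    finally show "1 / real M * (K * L powr p * (2 * R powr \<sigma>)) \<le> (1 - \<delta>) * (8 * 2 ^ n * real n ^ (n + 1) * (s ^ n) * (s ^ n)) powr p * s powr (\<delta> * p)" .
  qed auto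
  finally show ?thesis unfolding T0 A_def .
qed

section \<open>Dyadic cubes and density\<close>

text \<open>Half-open cubes tile without overlap, which makes the dyadic family exactly laminar.
  They differ from the closed cubes by null sets, so integrals agree.\<close>

definition hcube :: "real ^ 'n \<Rightarrow> real \<Rightarrow> (real ^ 'n) set" where
  "hcube b s = {y. \<forall>i. b $ i \<le> y $ i \<and> y $ i < b $ i + s}"

lemma hcube_sets [measurable]: "hcube b s \<in> sets borel"
proof -
  have "hcube b s = {y \<in> space borel. \<forall>i. b $ i \<le> y $ i \<and> y $ i < b $ i + s}" by (simp add: hcube_def)
  also have "\<dots> \<in> sets borel" by measurable
  finally show ?thesis .
qed

lemma hcube_sub_cube: "hcube b s \<subseteq> cube b s"
  by (auto simp: hcube_def cube_def mem_box_cart less_imp_le)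

lemma emeasure_hcube:
  fixes b :: "real ^ 'n" assumes s: "s > 0"
  shows "emeasure lborel (hcube b s) = ennreal (s ^ CARD('n))"
proof (rule antisym)
  have "emeasure lborel (hcube b s) \<le> emeasure lborel (cube b s)"
    by (rule emeasure_mono[OF hcube_sub_cube]) simp
  then show "emeasure lborel (hcube b s) \<le> ennreal (s ^ CARD('n))" using emeasure_cube[of s b] s by simp
  have bx: "box b (\<chi> i. b $ i + s) \<subseteq> hcube b s" by (auto simp: hcube_def mem_box_cart less_imp_le)
  have "emeasure lborel (cube b s) = emeasure lborel (box b (\<chi> i. b $ i + s))"
    by (simp add: cube_def emeasure_lborel_cbox_eq emeasure_lborel_box_eq)
  also have "\<dots> \<le> emeasure lborel (hcube b s)" by (rule emeasure_mono[OF bx]) simp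
  finally show "ennreal (s ^ CARD('n)) \<le> emeasure lborel (hcube b s)" using emeasure_cube[of s b] s by simp
qed

lemma AE_cube_hcube:
  fixes b :: "real ^ 'n" assumes s: "s > 0"
  shows "AE x in lborel. x \<in> cube b s \<longleftrightarrow> x \<in> hcube b s"
proof -
  have "emeasure lborel (cube b s - hcube b s) = emeasure lborel (cube b s) - emeasure lborel (hcube b s)"
    by (rule emeasure_Diff) (use hcube_sub_cube emeasure_hcube[OF s, of b] in auto)
  also have "\<dots> = 0" using emeasure_hcube[OF s, of b] emeasure_cube[of s b] s by simp
  finally have "cube b s - hcube b s \<in> null_sets lborel" by auto
  then have "AE x in lborel. x \<notin> cube b s - hcube b s" by (rule AE_not_in)
  then show ?thesis by eventually_elim (use hcube_sub_cube[of b s] in auto)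
qed

lemma nn_integral_hcube:
  fixes b :: "real ^ 'n" assumes s: "s > 0"
  shows "(\<integral>\<^sup>+x\<in>hcube b s. f x \<partial>lebesgue) = (\<integral>\<^sup>+x\<in>cube b s. f x \<partial>lebesgue)"
  unfolding nn_integral_completion
  by (rule nn_integral_cong_AE, use AE_cube_hcube[OF s, of b] in eventually_elim) (simp add: indicator_def)

lemma measure_hcube:
  fixes b :: "real ^ 'n" assumes s: "s > 0"
  shows "measure lebesgue (hcube b s) = s ^ CARD('n)" "hcube b s \<in> fmeasurable lebesgue"
proof -
  have e: "emeasure lebesgue (hcube b s) = ennreal (s ^ CARD('n))" using emeasure_hcube[OF s, of b] by simp
  then show "measure lebesgue (hcube b s) = s ^ CARD('n)" unfolding measure_def using s by simp
  show "hcube b s \<in> fmeasurable lebesgue" by (rule fmeasurableI) (use e in auto)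
qed

text \<open>The dyadic cell of generation \<open>k\<close> around \<open>x\<close>, encoded as a
  class of equal integer parts: cells of one generation are then equal or disjoint by
  construction.\<close>

definition dcube :: "real ^ 'n \<Rightarrow> real \<Rightarrow> nat \<Rightarrow> real ^ 'n \<Rightarrow> (real ^ 'n) set" where
  "dcube a l k x = {y. \<forall>i. \<lfloor>2 ^ k * ((y $ i - a $ i) / l)\<rfloor> = \<lfloor>2 ^ k * ((x $ i - a $ i) / l)\<rfloor>}"

definition corner :: "real ^ 'n \<Rightarrow> real \<Rightarrow> nat \<Rightarrow> real ^ 'n \<Rightarrow> real ^ 'n" where
  "corner a l k x = (\<chi> i. a $ i + l * of_int \<lfloor>2 ^ k * ((x $ i - a $ i) / l)\<rfloor> / 2 ^ k)"

definition dyadic_cubes :: "real ^ 'n \<Rightarrow> real \<Rightarrow> nat \<Rightarrow> (real ^ 'n) set set" where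
  "dyadic_cubes a l K = {dcube a l k x | k x. k \<le> K \<and> x \<in> hcube a l}"

lemma dcube_self: "x \<in> dcube a l k x" by (simp add: dcube_def)

lemma dcube_eq: "y \<in> dcube a l k x \<Longrightarrow> dcube a l k y = dcube a l k x" by (simp add: dcube_def)

lemma dcube_hcube:
  fixes a x :: "real ^ 'n"
  assumes l: "l > 0"
  shows "dcube a l k x = hcube (corner a l k x) (l / 2 ^ k)"
proof -
  have "\<lfloor>2 ^ k * ((u - c) / l)\<rfloor> = m \<longleftrightarrow> c + l * of_int m / 2 ^ k \<le> u \<and> u < c + l * of_int m / 2 ^ k + l / 2 ^ k"
    for u c :: real and m
  proof -
    have "\<lfloor>2 ^ k * ((u - c) / l)\<rfloor> = m \<longleftrightarrow> of_int m \<le> 2 ^ k * ((u - c) / l) \<and> 2 ^ k * ((u - c) / l) < of_int m + 1"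
      by (rule floor_eq_iff)
    moreover have "of_int m \<le> 2 ^ k * ((u - c) / l) \<longleftrightarrow> c + l * of_int m / 2 ^ k \<le> u"
      using l by (simp add: field_simps)
    moreover have "2 ^ k * ((u - c) / l) < of_int m + 1 \<longleftrightarrow> u < c + l * of_int m / 2 ^ k + l / 2 ^ k"
      using l by (simp add: field_simps)
    ultimately show ?thesis by simp
  qed
  then show ?thesis unfolding dcube_def hcube_def corner_def by simp
qed

text \<open>The integer part at generation j is the integer quotient by 2^(k-j) of the one at
  generation k, so equal fine indices have equal coarse indices.\<close>

lemma dcube_mono:
  assumes "j \<le> k" shows "dcube a l k x \<subseteq> dcube a l j x"
proof -
  have "\<lfloor>2 ^ j * (u::real)\<rfloor> = \<lfloor>2 ^ k * u\<rfloor> div 2 ^ (k - j)" for u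
  proof -
    have "(2::real) ^ j * 2 ^ (k - j) = 2 ^ k" using assms by (simp add: power_add[symmetric])
    then have "2 ^ j * u = (2 ^ k * u) / real_of_int (2 ^ (k - j))" by (simp add: field_simps)
    then have "\<lfloor>2 ^ j * u\<rfloor> = \<lfloor>(2 ^ k * u) / real_of_int (2 ^ (k - j))\<rfloor>" by simp
    also have "\<dots> = \<lfloor>2 ^ k * u\<rfloor> div 2 ^ (k - j)" by (rule floor_divide_real_eq_div) simp
    finally show ?thesis .
  qed
  then have "\<lfloor>2 ^ j * u\<rfloor> = \<lfloor>2 ^ j * v\<rfloor>" if "\<lfloor>2 ^ k * u\<rfloor> = \<lfloor>2 ^ k * v\<rfloor>" for u v :: real
    using that by simp
  then show ?thesis unfolding dcube_def by blast
qed

lemma dcube_0: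
  fixes a x :: "real ^ 'n"
  assumes l: "l > 0" "x \<in> hcube a l" shows "dcube a l 0 x = hcube a l"
proof -
  have "corner a l 0 x = a"
  proof (rule vec_eq_iff[THEN iffD2], rule allI)
    fix i :: 'n
    have "0 \<le> (x $ i - a $ i) / l" "(x $ i - a $ i) / l < 1"
      using assms by (auto simp: hcube_def field_simps)
    then have "\<lfloor>(x $ i - a $ i) / l\<rfloor> = 0" by (simp add: floor_eq_iff)
    then show "corner a l 0 x $ i = a $ i" by (simp add: corner_def)
  qed
  then show ?thesis using dcube_hcube[OF l(1), of a 0 x] by simp
qed

lemma dcube_sub: "l > 0 \<Longrightarrow> x \<in> hcube a l \<Longrightarrow> dcube a l k x \<subseteq> hcube a l"
  using dcube_mono[of 0 k a l x] dcube_0[of l x a] by simp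

lemma dyadic_cubes_cube:
  fixes a :: "real ^ 'n"
  assumes "l > 0" "P \<in> dyadic_cubes a l K"
  obtains b s where "s > 0" "s \<le> l" "P = hcube b s" "P \<subseteq> hcube a l"
proof -
  from assms(2) obtain k x where kx: "P = dcube a l k x" "x \<in> hcube a l" unfolding dyadic_cubes_def by blast
  show ?thesis
  proof (rule that)
    show "0 < l / 2 ^ k" "l / 2 ^ k \<le> l" using assms(1) by (auto simp: field_simps)
    show "P = hcube (corner a l k x) (l / 2 ^ k)" unfolding kx(1) by (rule dcube_hcube[OF assms(1)])
    show "P \<subseteq> hcube a l" unfolding kx(1) by (rule dcube_sub[OF assms(1) kx(2)])
  qed
qed

lemma finite_dyadic_cubes:
  fixes a :: "real ^ 'n" assumes l: "l > 0"
  shows "finite (dyadic_cubes a l K)"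
proof -
  let ?S = "\<lambda>k. {m :: 'n \<Rightarrow> int. \<forall>i. m i \<in> {0..2 ^ k}}"
  let ?h = "\<lambda>k m. {y :: real ^ 'n. \<forall>i. \<lfloor>2 ^ k * ((y $ i - a $ i) / l)\<rfloor> = m i}"
  have fin: "finite (?S k)" for k
  proof -
    have "?S k = PiE UNIV (\<lambda>_. {0..2 ^ k})" by auto
    then show ?thesis by (simp add: finite_PiE)
  qed
  have "dyadic_cubes a l K \<subseteq> (\<Union>k\<le>K. ?h k ` ?S k)"
  proof
    fix P assume "P \<in> dyadic_cubes a l K"
    then obtain k x where kx: "P = dcube a l k x" "k \<le> K" "x \<in> hcube a l" unfolding dyadic_cubes_def by blast
    let ?m = "\<lambda>i. \<lfloor>2 ^ k * ((x $ i - a $ i) / l)\<rfloor>"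
    have "?m i \<in> {0..2 ^ k}" for i
    proof -
      have u: "0 \<le> (x $ i - a $ i) / l" "(x $ i - a $ i) / l \<le> 1"
        using kx(3) l by (auto simp: hcube_def field_simps less_imp_le)
      then have "2 ^ k * ((x $ i - a $ i) / l) \<le> 2 ^ k" by (intro mult_left_le) auto
      then have "?m i \<le> \<lfloor>(2 ^ k :: real)\<rfloor>" by (rule floor_mono)
      then show ?thesis using u by (simp del: times_divide_eq_right)
    qed
    then have mS: "?m \<in> ?S k" by simp
    have Peq: "P = ?h k ?m" using kx(1) unfolding dcube_def by simp
    have "P \<in> ?h k ` ?S k" by (rule image_eqI[where f = "?h k", OF Peq mS])
    then show "P \<in> (\<Union>k\<le>K. ?h k ` ?S k)" by (rule UN_I[of k, rotated]) (simp add: kx(2))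
  qed
  then show ?thesis by (rule finite_subset) (use fin in auto)
qed

lemma dyadic_cubes_tree:
  fixes a :: "real ^ 'n" assumes l: "l > 0"
  shows "tree_family lebesgue (dyadic_cubes a l K) (hcube a l) (2 ^ CARD('n))"
proof unfold_locales
  have aQ: "a \<in> hcube a l" using l by (simp add: hcube_def)
  show "finite (dyadic_cubes a l K)" by (rule finite_dyadic_cubes[OF l])
  show "hcube a l \<in> dyadic_cubes a l K"
    using dcube_0[OF l aQ] aQ unfolding dyadic_cubes_def by blast
next
  fix P assume P: "P \<in> dyadic_cubes a l K"
  then obtain b s where bs: "s > 0" "P = hcube b s" "P \<subseteq> hcube a l" by (rule dyadic_cubes_cube[OF l])
  show "P \<subseteq> hcube a l" by fact
  show "P \<in> fmeasurable lebesgue" unfolding bs(2) by (rule measure_hcube(2)[OF bs(1)])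
  show "0 < measure lebesgue P" using bs measure_hcube(1)[OF bs(1), of b] by simp
next
  have main: "P \<inter> P' = {} \<or> P' \<subseteq> P" if "P = dcube a l j x" "P' = dcube a l k y" "j \<le> k" for P P' j k x y
  proof (cases "P \<inter> P' = {}")
    case False
    then obtain z where z: "z \<in> P" "z \<in> P'" by auto
    then have "P = dcube a l j z" "P' = dcube a l k z" using that(1,2) dcube_eq[of z] by auto
    then show ?thesis using dcube_mono[OF that(3), of a l z] by simp
  qed simp
  fix P P' assume "P \<in> dyadic_cubes a l K" "P' \<in> dyadic_cubes a l K"
  then obtain j k x y where "P = dcube a l j x" "P' = dcube a l k y" unfolding dyadic_cubes_def by blast
  then show "P \<inter> P' = {} \<or> P \<subseteq> P' \<or> P' \<subseteq> P"
    using main[of P j x P' k y] main[of P' k y P j x] by (cases "j \<le> k") auto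
next
  fix P assume P: "P \<in> dyadic_cubes a l K" "P \<noteq> hcube a l"
  then obtain k x where kx: "P = dcube a l k x" "k \<le> K" "x \<in> hcube a l" unfolding dyadic_cubes_def by blast
  have "k \<noteq> 0" using P(2) kx(1) dcube_0[OF l kx(3)] by auto
  then obtain j where j: "k = Suc j" by (cases k) auto
  let ?P' = "dcube a l j x"
  have mj: "measure lebesgue (dcube a l i x) = (l / 2 ^ i) ^ CARD('n)" for i
    using dcube_hcube[OF l, of a i x] measure_hcube(1)[of "l / 2 ^ i" "corner a l i x"] l by simp
  have eq: "measure lebesgue ?P' = 2 ^ CARD('n) * measure lebesgue P"
    unfolding kx(1) mj j by (simp add: power_divide power_mult_distrib)
  moreover have "measure lebesgue P > 0" unfolding kx(1) mj using l by simp
  \<comment> \<open>The parent has strictly larger volume because n >= 1, so the inclusion is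
    strict.\<close>
  moreover have "(2::real) ^ CARD('n) \<ge> 2 ^ 1" by (intro power_increasing) (auto simp: Suc_leI)
  ultimately have "measure lebesgue ?P' \<noteq> measure lebesgue P" by simp
  moreover have "P \<subseteq> ?P'" unfolding kx(1) j by (rule dcube_mono) simp
  moreover have "?P' \<in> dyadic_cubes a l K" using kx j unfolding dyadic_cubes_def by (auto intro!: exI[of _ j])
  ultimately show "\<exists>P'\<in>dyadic_cubes a l K. P \<subset> P' \<and> measure lebesgue P' \<le> 2 ^ CARD('n) * measure lebesgue P"
    using eq by (intro bexI[of _ ?P']) auto
qed

lemma dcube_in_open:
  fixes a x :: "real ^ 'n"
  assumes l: "l > 0" and U: "open U" "x \<in> U"
  shows "\<exists>k. dcube a l k x \<subseteq> U"
proof -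
  obtain e where e: "e > 0" "ball x e \<subseteq> U" using U openE by blast
  obtain k where k: "real CARD('n) * l / e < 2 ^ k" using real_arch_pow[of 2] by auto
  have "dcube a l k x \<subseteq> ball x e"
  proof
    fix y assume y: "y \<in> dcube a l k x"
    have "dcube a l k x \<subseteq> cube (corner a l k x) (l / 2 ^ k)"
      using dcube_hcube[OF l, of a k x] hcube_sub_cube[of "corner a l k x" "l / 2 ^ k"] by simp
    then have "norm (x - y) \<le> real CARD('n) * (l / 2 ^ k)"
      using norm_diff_cube[of x _ _ y] dcube_self[of x a l k] y by blast
    also have "\<dots> < e" using k e(1) by (simp add: field_simps)
    finally show "y \<in> ball x e" by (simp add: dist_norm)
  qed
  then show ?thesis using e(2) by blast
qed

text \<open>A stand-in for the level set {F > t} built from cubes of depth at most \<open>K\<close>.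
  It grows with \<open>K\<close>, and in the limit contains almost every point of the level set in
  the cube.\<close>

definition level_cover :: "real ^ 'n \<Rightarrow> real \<Rightarrow> nat \<Rightarrow> (real ^ 'n \<Rightarrow> real) \<Rightarrow> real \<Rightarrow> (real ^ 'n) set" where
  "level_cover a l K F t = tree_family.dense_union lebesgue (dyadic_cubes a l K) F t"

lemma level_cover_eq:
  assumes l: "l > 0"
  shows "level_cover a l K F t = \<Union>{P \<in> dyadic_cubes a l K. measure lebesgue (P \<inter> {x. F x > t}) > measure lebesgue P / 2}"
  using tree_family.dense_union_def[OF dyadic_cubes_tree[OF l, of a K], of F t]
    tree_family.dense_def[OF dyadic_cubes_tree[OF l, of a K], of F t] by (simp add: level_cover_def)

lemma level_cover_sets: "l > 0 \<Longrightarrow> level_cover a l K F t \<in> sets lebesgue"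
  unfolding level_cover_def by (rule fmeasurableD[OF tree_family.dense_union_sets[OF dyadic_cubes_tree]])

lemma level_cover_sub:
  assumes "l > 0" shows "level_cover a l K F t \<subseteq> hcube a l"
  unfolding level_cover_eq[OF assms] using tree_family.sub_Q[OF dyadic_cubes_tree[OF assms, of a K]] by blast

lemma dyadic_cubes_mono: "K \<le> K' \<Longrightarrow> dyadic_cubes a l K \<subseteq> dyadic_cubes a l K'"
  unfolding dyadic_cubes_def by fastforce

lemma level_cover_mono: "l > 0 \<Longrightarrow> K \<le> K' \<Longrightarrow> level_cover a l K F t \<subseteq> level_cover a l K' F t"
  unfolding level_cover_eq using dyadic_cubes_mono[of K K' a l] by blast

text \<open>A dyadic density theorem, from outer regularity alone: a set that fills at most half of each dyadic
  cube meeting it fills at most half of each open set containing it.\<close>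

lemma AE_in_level_cover:
  fixes a :: "real ^ 'n"
  assumes l: "l > 0" and F: "F \<in> borel_measurable lebesgue"
  shows "AE x in lebesgue. x \<in> hcube a l \<longrightarrow> F x > t \<longrightarrow> (\<exists>K. x \<in> level_cover a l K F t)"
proof -
  let ?m = "measure lebesgue"
  define E where "E = {x. F x > t}"
  have E: "E \<in> sets lebesgue" unfolding E_def using F borel_measurable_iff_greater[of F lebesgue] by simp
  define Z where "Z = hcube a l \<inter> E - (\<Union>K. level_cover a l K F t)"
  have Qf: "hcube a l \<in> fmeasurable lebesgue" by (rule measure_hcube(2)[OF l])
  have Zs: "Z \<in> sets lebesgue" unfolding Z_def
    by (intro sets.Diff sets.Int E fmeasurableD[OF Qf] sets.countable_UN) (auto intro: level_cover_sets[OF l])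
  have Zf: "Z \<in> fmeasurable lebesgue"
    by (rule fmeasurableI2[OF Qf _ Zs]) (auto simp: Z_def)
  have half: "?m (Z \<inter> P) \<le> ?m P / 2" if P: "P \<in> dyadic_cubes a l K" for P K
  proof (cases "Z \<inter> P = {}")
    case False
    then have "?m (P \<inter> E) \<le> ?m P / 2"
      using P unfolding Z_def level_cover_eq[OF l] E_def by (force simp: not_less)
    moreover have "?m (Z \<inter> P) \<le> ?m (P \<inter> E)"
    proof (rule measure_mono_fmeasurable)
      have Pf: "P \<in> fmeasurable lebesgue" by (rule tree_family.fmeas[OF dyadic_cubes_tree[OF l] P])
      show "Z \<inter> P \<in> sets lebesgue" by (rule sets.Int[OF Zs fmeasurableD[OF Pf]])
      show "P \<inter> E \<in> fmeasurable lebesgue" by (rule fmeasurable_Int_fmeasurable[OF Pf E])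
    qed (auto simp: Z_def)
    ultimately show ?thesis by simp
  qed simp
  have "?m Z = 0"
  proof (rule ccontr)
    assume "?m Z \<noteq> 0"
    then have z: "?m Z > 0" by (simp add: zero_less_measure_iff)
    \<comment> \<open>\<open>U\<close> has less than twice the measure of \<open>Z\<close>. The
      dyadic cubes inside \<open>U\<close> exhaust \<open>Z\<close>, and \<open>Z\<close> fills at
      most half of each, so in the limit \<open>Z\<close> has at most half the measure of
      \<open>U\<close>, a contradiction.\<close>
    obtain U where U: "open U" "Z \<subseteq> U" and UZ: "U - Z \<in> lmeasurable" "emeasure lebesgue (U - Z) < ennreal (?m Z)"
      using sets_lebesgue_outer_open[OF Zs z] .
    have Ueq: "U = Z \<union> (U - Z)" using U(2) by blast
    have Uf: "U \<in> lmeasurable" by (subst Ueq) (intro fmeasurable.Un Zf UZ(1))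
    have Um: "?m U < ?m Z + ?m Z"
    proof -
      have "?m (U - Z) < ?m Z" using UZ z by (simp add: emeasure_eq_measure2 ennreal_less_iff)
      moreover have "?m U = ?m Z + ?m (U - Z)"
        by (subst Ueq, rule measure_Un_AE) (use Zf UZ(1) in auto)
      ultimately show ?thesis by simp
    qed
    define C where "C K = {P \<in> dyadic_cubes a l K. P \<subseteq> U}" for K
    have bound: "?m (Z \<inter> \<Union>(C K)) \<le> ?m U / 2" for K
    proof -
      interpret tree_family lebesgue "dyadic_cubes a l K" "hcube a l" "2 ^ CARD('n)"
        by (rule dyadic_cubes_tree[OF l])
      have lam: "P \<inter> P' = {} \<or> P \<subseteq> P' \<or> P' \<subseteq> P" if "P \<in> C K" "P' \<in> C K" for P P'
        using laminar[of P P'] that unfolding C_def by blast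
      have finC: "finite (C K)" unfolding C_def using finite_T by simp
      define \<M> where "\<M> = {P \<in> C K. \<forall>P'\<in>C K. P \<subseteq> P' \<longrightarrow> P' = P}"
      note mx = finite_laminar_maximal[of "C K", OF finC lam, folded \<M>_def]
      have fin: "finite \<M>" unfolding \<M>_def using finC by simp
      have MT: "P \<in> dyadic_cubes a l K" "P \<subseteq> U" if "P \<in> \<M>" for P using that unfolding \<M>_def C_def by auto
      have Ps: "P \<in> sets lebesgue" if "P \<in> \<M>" for P using fmeasurableD[OF fmeas[OF MT(1)[OF that]]] .
      have "Z \<inter> \<Union>(C K) = (\<Union>P\<in>\<M>. Z \<inter> P)" using mx(2) by auto
      then have "?m (Z \<inter> \<Union>(C K)) \<le> (\<Sum>P\<in>\<M>. ?m (Z \<inter> P))"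
        using measure_UNION_le[OF fin, of "\<lambda>P. Z \<inter> P" lebesgue] Ps Zs by auto
      also have "\<dots> \<le> (\<Sum>P\<in>\<M>. ?m P / 2)" using half MT(1) by (intro sum_mono) blast
      also have "\<dots> = (\<Sum>P\<in>\<M>. ?m P) / 2" by (simp add: sum_divide_distrib)
      also have "(\<Sum>P\<in>\<M>. ?m P) = ?m (\<Union>\<M>)"
        by (rule measure_Union'[symmetric, OF fin])
          (use mx(1) fmeas MT(1) in \<open>auto simp: disjoint_def pairwise_def disjnt_def\<close>)
      also have "\<dots> \<le> ?m U"
        by (rule measure_mono_fmeasurable[OF _ _ Uf]) (use MT(2) Ps fin in \<open>auto intro!: sets.finite_Union\<close>)
      finally show ?thesis by simp
    qed
    have Zeq: "Z = (\<Union>K. Z \<inter> \<Union>(C K))"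
    proof (intro equalityI subsetI)
      fix x assume x: "x \<in> Z"
      then have "x \<in> U" using U(2) by blast
      then obtain k where k: "dcube a l k x \<subseteq> U" using dcube_in_open[OF l U(1)] by blast
      have "x \<in> hcube a l" using x unfolding Z_def by blast
      then have "dcube a l k x \<in> C k" using k unfolding C_def dyadic_cubes_def by blast
      then show "x \<in> (\<Union>K. Z \<inter> \<Union>(C K))" using x dcube_self[of x a l k] by blast
    qed auto
    have CS: "Z \<inter> \<Union>(C K) \<in> sets lebesgue" for K
    proof -
      have "P \<in> sets lebesgue" if "P \<in> C K" for P
        using fmeasurableD[OF tree_family.fmeas[OF dyadic_cubes_tree[OF l, of a K]]] that unfolding C_def by blast
      moreover have "finite (C K)" unfolding C_def using finite_dyadic_cubes[OF l, of a K] by simp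
      ultimately show ?thesis using Zs by (intro sets.Int sets.finite_Union) auto
    qed
    have "(\<lambda>K. ?m (Z \<inter> \<Union>(C K))) \<longlonglongrightarrow> ?m (\<Union>K. Z \<inter> \<Union>(C K))"
    proof (rule Lim_measure_incseq)
      show "range (\<lambda>K. Z \<inter> \<Union>(C K)) \<subseteq> sets lebesgue" using CS by auto
      show "incseq (\<lambda>K. Z \<inter> \<Union>(C K))"
      proof (rule incseq_SucI)
        fix K show "Z \<inter> \<Union>(C K) \<subseteq> Z \<inter> \<Union>(C (Suc K))"
          using dyadic_cubes_mono[of K "Suc K" a l] unfolding C_def by auto
      qed
      show "emeasure lebesgue (\<Union>K. Z \<inter> \<Union>(C K)) \<noteq> \<infinity>" unfolding Zeq[symmetric] using fmeasurableD2[OF Zf] by simp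
    qed
    then have "?m Z \<le> ?m U / 2" unfolding Zeq[symmetric] using bound by (intro LIMSEQ_le_const2) auto
    then show False using Um by simp
  qed
  then have "Z \<in> null_sets lebesgue" using Zf by (simp add: null_sets_def emeasure_eq_measure2 Zs)
  then have "AE x in lebesgue. x \<notin> Z" by (rule AE_not_in)
  then show ?thesis by eventually_elim (auto simp: Z_def E_def)
qed

section \<open>The weighted measure and the Carleson estimate from the A_infinity constant\<close>

definition wmeasure :: "(real ^ 'n \<Rightarrow> real) \<Rightarrow> (real ^ 'n) set \<Rightarrow> (real ^ 'n) measure" where
  "wmeasure w S = density lebesgue (\<lambda>x. ennreal (w x) * indicator S x)"

lemma emeasure_wmeasure:
  assumes [measurable]: "w \<in> borel_measurable lebesgue" "S \<in> sets lebesgue" "A \<in> sets lebesgue" and "A \<subseteq> S"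
  shows "emeasure (wmeasure w S) A = weight_of w A"
  unfolding wmeasure_def weight_of_def
  by (subst emeasure_density) (use assms(4) in \<open>auto intro!: nn_integral_cong simp: indicator_def\<close>)

lemma finite_wmeasure:
  assumes [measurable]: "w \<in> borel_measurable lebesgue" "S \<in> sets lebesgue" and "weight_of w S < \<infinity>"
  shows "finite_measure (wmeasure w S)"
proof
  have "emeasure (wmeasure w S) (space (wmeasure w S)) = weight_of w S"
    unfolding wmeasure_def weight_of_def by (subst emeasure_density) (auto intro!: nn_integral_cong)
  then show "emeasure (wmeasure w S) (space (wmeasure w S)) \<noteq> \<infinity>" using assms(3) by simp
qed

lemma weight_of_hcube: "s > 0 \<Longrightarrow> weight_of w (hcube b s) = weight_of w (cube b s)"
  unfolding weight_of_def by (rule nn_integral_hcube)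

text \<open>On \<open>E i\<close> the average of w over \<open>P i\<close> is at most M(1_R w), as
  \<open>P i\<close> is contained in \<open>R\<close> and contains the point. Disjointness of the
  sets \<open>E i\<close> then bounds the sum by the integral of M(1_R w) over \<open>R\<close>,
  which is the numerator in the definition of the A_infinity constant.\<close>

lemma Ainf_Carleson:
  fixes a :: "real ^ 'n" and P :: "'i \<Rightarrow> (real ^ 'n) set"
  assumes l: "l > 0" and w[measurable]: "w \<in> borel_measurable lebesgue" and wfin: "weight_of w (hcube a l) < \<infinity>"
    and wpos: "AE x in lebesgue. w x > 0"
    and W: "Ainf_const w = ennreal W" "W \<ge> 0"
    and R: "R \<in> dyadic_cubes a l K" and I: "finite I"
    and PE: "\<And>i. i \<in> I \<Longrightarrow> P i \<in> dyadic_cubes a l K \<and> P i \<subseteq> R \<and> E i \<in> sets lebesgue \<and> E i \<subseteq> P i"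
    and disj: "disjoint_family_on E I"
  defines "\<mu> \<equiv> wmeasure w (hcube a l)"
  shows "(\<Sum>i\<in>I. measure lebesgue (E i) * (measure \<mu> (P i) / measure lebesgue (P i))) \<le> W * measure \<mu> R"
proof -
  interpret tree_family lebesgue "dyadic_cubes a l K" "hcube a l" "2 ^ CARD('n)"
    by (rule dyadic_cubes_tree[OF l])
  have Qs: "hcube a l \<in> sets lebesgue" by simp
  interpret \<mu>: finite_measure \<mu> unfolding \<mu>_def by (rule finite_wmeasure[OF w Qs wfin])
  have em: "emeasure \<mu> P = weight_of w P" if "P \<in> dyadic_cubes a l K" for P
    unfolding \<mu>_def by (rule emeasure_wmeasure[OF w Qs fmeasurableD[OF fmeas[OF that]] sub_Q[OF that]])
  obtain b s where bs: "s > 0" "R = hcube b s" by (rule dyadic_cubes_cube[OF l R])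
  let ?Rc = "cube b s"
  let ?M = "maximal (\<lambda>y. indicator ?Rc y * w y)"
  define c where "c i = measure \<mu> (P i) / measure lebesgue (P i)" for i
  have c0: "c i \<ge> 0" for i unfolding c_def by simp
  have cmax: "ennreal (c i) \<le> ?M x" if i: "i \<in> I" and x: "x \<in> P i" for i x
  proof -
    obtain b' s' where bs': "s' > 0" "P i = hcube b' s'" using PE[OF i] dyadic_cubes_cube[OF l] by metis
    let ?Pc = "cube b' s'"
    have "ennreal (c i) = weight_of w (P i) / ennreal (s' ^ CARD('n))"
      unfolding c_def bs'(2) using measure_hcube(1)[OF bs'(1), of b'] em[of "P i"] PE[OF i] bs'
      by (simp add: divide_ennreal[symmetric] \<mu>.emeasure_eq_measure[symmetric])
    also have "\<dots> \<le> average ?Pc (\<lambda>y. \<bar>indicator ?Rc y * w y\<bar>)"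
      unfolding average_cube[OF bs'(1)] weight_of_def
    proof (intro divide_right_mono_ennreal nn_integral_mono)
      fix y
      have "y \<in> ?Pc \<and> y \<in> ?Rc" if "y \<in> P i"
        using that PE[OF i] bs bs' hcube_sub_cube by blast
      then show "ennreal (w y) * indicator (P i) y \<le> ennreal \<bar>indicator ?Rc y * w y\<bar> * indicator ?Pc y"
        by (auto simp: indicator_def intro!: ennreal_leI)
    qed
    also have "\<dots> \<le> ?M x"
      unfolding maximal_def
    proof (rule SUP_upper)
      show "?Pc \<in> {Q \<in> cubes. x \<in> Q}" using bs' x hcube_sub_cube unfolding cubes_def by blast
    qed
    finally show ?thesis .
  qed
  have "ennreal (\<Sum>i\<in>I. measure lebesgue (E i) * c i) = (\<Sum>i\<in>I. ennreal (c i) * emeasure lebesgue (E i))"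
  proof -
    have "emeasure lebesgue (E i) = ennreal (measure lebesgue (E i))" if i: "i \<in> I" for i
    proof -
      have "E i \<in> fmeasurable lebesgue" using PE[OF i] fmeas fmeasurableI2 by blast
      then show ?thesis by (simp add: emeasure_eq_measure2)
    qed
    then show ?thesis using c0 by (subst sum_ennreal[symmetric]) (auto simp: ennreal_mult' mult.commute intro!: sum.cong)
  qed
  also have "\<dots> = (\<integral>\<^sup>+x. (\<Sum>i\<in>I. ennreal (c i) * indicator (E i) x) \<partial>lebesgue)"
    using PE by (subst nn_integral_sum)
      (auto simp: nn_integral_cmult_indicator intro!: borel_measurable_times_ennreal borel_measurable_indicator)
  also have "\<dots> \<le> (\<integral>\<^sup>+x\<in>?Rc. ?M x \<partial>lebesgue)"
  proof (rule nn_integral_mono)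
    fix x
    show "(\<Sum>i\<in>I. ennreal (c i) * indicator (E i) x) \<le> ?M x * indicator ?Rc x"
    proof (cases "\<exists>i\<in>I. x \<in> E i")
      case True
      then obtain i where i: "i \<in> I" "x \<in> E i" by blast
      have "(\<Sum>j\<in>I. ennreal (c j) * indicator (E j) x) = (\<Sum>j\<in>I. if j = i then ennreal (c i) else 0)"
      proof (rule sum.cong)
        fix j assume j: "j \<in> I"
        have "x \<notin> E j" if "j \<noteq> i" using disj i j that unfolding disjoint_family_on_def by blast
        then show "ennreal (c j) * indicator (E j) x = (if j = i then ennreal (c i) else 0)" using i by auto
      qed simp
      also have "\<dots> = ennreal (c i)" using i I by simp
      also have "\<dots> \<le> ?M x" using cmax[OF i(1)] PE[OF i(1)] i(2) by blast
      also have "x \<in> ?Rc" using PE[OF i(1)] i(2) bs(2) hcube_sub_cube by blast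
      then have "?M x = ?M x * indicator ?Rc x" by simp
      finally show ?thesis .
    next
      case False
      then have "(\<Sum>i\<in>I. ennreal (c i) * indicator (E i) x) = 0" by (intro sum.neutral) auto
      then show ?thesis by simp
    qed
  qed
  \<comment> \<open>Multiplying out the quotient in [0, infinity] requires the weight of the cube to
    be neither 0 nor infinite.\<close>
  also have "\<dots> \<le> Ainf_const w * weight_of w ?Rc"
  proof -
    have "weight_of w ?Rc = emeasure \<mu> R" using em[OF R] weight_of_hcube[OF bs(1), of w b] bs(2) by simp
    then have f: "weight_of w ?Rc \<noteq> \<infinity>" by (simp add: \<mu>.emeasure_eq_measure)
    have p: "weight_of w ?Rc \<noteq> 0"
      by (rule weight_of_nonzero[OF w _ wpos]) (use emeasure_cube[of s b] bs(1) in auto)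
    have "(\<integral>\<^sup>+x\<in>?Rc. ?M x \<partial>lebesgue) / weight_of w ?Rc \<le> Ainf_const w"
      unfolding Ainf_const_def by (rule SUP_upper) (use bs(1) in \<open>auto simp: cubes_def\<close>)
    then have "(\<integral>\<^sup>+x\<in>?Rc. ?M x \<partial>lebesgue) / weight_of w ?Rc * weight_of w ?Rc \<le> Ainf_const w * weight_of w ?Rc"
      by (rule mult_right_mono) simp
    then show ?thesis using f p by (simp add: ennreal_divide_times ennreal_divide_self less_top)
  qed
  also have "\<dots> = ennreal (W * measure \<mu> R)"
    using W em[OF R] weight_of_hcube[OF bs(1), of w b] bs(2) by (simp add: \<mu>.emeasure_eq_measure ennreal_mult')
  finally show ?thesis using W(2) unfolding c_def by (simp add: ennreal_le_iff)
qed

section \<open>Inequalities for real numbers\<close>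

lemma powr_superadditive:
  fixes x y s :: real
  assumes "x \<ge> 0" "y \<ge> 0" "s \<ge> 1"
  shows "x powr s + y powr s \<le> (x + y) powr s"
proof -
  have split: "u powr s = u * u powr (s - 1)" if "u \<ge> 0" for u :: real
    using that powr_mult_base[of u "s - 1"] by simp
  have "x powr s + y powr s = x * x powr (s - 1) + y * y powr (s - 1)"
    using assms by (simp add: split[symmetric])
  also have "\<dots> \<le> x * (x + y) powr (s - 1) + y * (x + y) powr (s - 1)"
    using assms by (intro add_mono mult_left_mono powr_mono2) auto
  also have "\<dots> = (x + y) powr s" using assms split[of "x + y"] by (simp add: algebra_simps)
  finally show ?thesis .
qed

text \<open>Used with exponent q/p >= 1 to sum local bounds, once over disjoint cubes and once over
  the truncations, and with exponent p for the layers of a difference.\<close>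

lemma sum_powr_le_powr_sum:
  fixes f :: "'a \<Rightarrow> real"
  assumes "\<And>i. i \<in> I \<Longrightarrow> f i \<ge> 0" "s \<ge> 1"
  shows "(\<Sum>i\<in>I. f i powr s) \<le> (\<Sum>i\<in>I. f i) powr s"
  using assms(1)
proof (induction I rule: infinite_finite_induct)
  case (insert i I)
  then have "(\<Sum>i\<in>insert i I. f i powr s) \<le> f i powr s + (\<Sum>i\<in>I. f i) powr s" by simp
  also have "\<dots> \<le> (f i + (\<Sum>i\<in>I. f i)) powr s"
    using insert.prems by (intro powr_superadditive assms(2) sum_nonneg) auto
  finally show ?case using insert by simp
qed (use assms(2) in auto)

text \<open>The side length is traded for weight: \<open>doubling\<close> gives (s/l)^\<delta> <=
  (Ar mu / muQ)^\<tau> with \<tau> = \<delta>/(nr). The relation between the exponents says \<tau> -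
  1/p = -1/q, so after raising to the power q the weight of the small cube appears exactly as
  mu^(-1) and cancels. Only the energy \<open>nu\<close> still depends on the small cube.\<close>

lemma oscillation_exponents:
  fixes osc mu muQ nu s l \<delta> p q r A Ar c0 :: real and n :: nat
  assumes pos: "osc \<ge> 0" "mu > 0" "muQ > 0" "nu \<ge> 0" "s > 0" "l > 0" "A > 0" "Ar > 0" "c0 > 0" "n \<ge> 1"
    and ex: "0 < \<delta>" "\<delta> < 1" "p \<ge> 1" "r \<ge> 1" "q > 0" "1 / p - 1 / q = \<delta> / (real n * r)"
    and poincare: "osc powr p * mu \<le> (1 - \<delta>) * c0 powr p * s powr (\<delta> * p) * A * nu"
    and doubling: "(s ^ n / l ^ n) powr r \<le> Ar * mu / muQ"
  shows "osc powr q * mu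
    \<le> (c0 * ((1 - \<delta>) powr (1 / p) * A powr (1 / p)) * l powr \<delta> * (Ar / muQ) powr (\<delta> / (real n * r))) powr q * nu powr (q / p)"
proof -
  define \<tau> where "\<tau> = \<delta> / (real n * r)"
  have \<tau>: "\<tau> > 0" unfolding \<tau>_def using ex pos by simp
  have q\<tau>: "q * \<tau> = q / p - 1"
  proof -
    have "1 / p - 1 / q = \<tau>" using ex by (simp add: \<tau>_def)
    then show ?thesis using ex(3,5) by (simp add: field_simps)
  qed
  have sl: "s powr \<delta> \<le> l powr \<delta> * ((Ar / muQ) powr \<tau> * mu powr \<tau>)"
  proof -
    have "((s ^ n / l ^ n) powr r) powr \<tau> \<le> (Ar * mu / muQ) powr \<tau>"
      using doubling \<tau> by (intro powr_mono2) auto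
    moreover have "((s ^ n / l ^ n) powr r) powr \<tau> = (s / l) powr \<delta>"
    proof -
      have "s ^ n / l ^ n = (s / l) powr real n" using pos by (simp add: powr_realpow power_divide)
      then have "((s ^ n / l ^ n) powr r) powr \<tau> = (s / l) powr (real n * r * \<tau>)" by (simp add: powr_powr mult.assoc)
      also have "real n * r * \<tau> = \<delta>" using pos ex by (simp add: \<tau>_def)
      finally show ?thesis .
    qed
    moreover have "(Ar * mu / muQ) powr \<tau> = (Ar / muQ) powr \<tau> * mu powr \<tau>"
      using pos by (simp add: powr_mult[symmetric])
    ultimately have "(s / l) powr \<delta> \<le> (Ar / muQ) powr \<tau> * mu powr \<tau>" by simp
    then have "l powr \<delta> * (s / l) powr \<delta> \<le> l powr \<delta> * ((Ar / muQ) powr \<tau> * mu powr \<tau>)"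
      by (intro mult_left_mono) auto
    moreover have "l powr \<delta> * (s / l) powr \<delta> = s powr \<delta>" using pos by (simp add: powr_divide)
    ultimately show ?thesis by simp
  qed
  let ?k = "c0 * ((1 - \<delta>) powr (1 / p) * A powr (1 / p))"
  let ?c = "?k * l powr \<delta> * (Ar / muQ) powr \<tau>"
  have "osc powr p \<le> (1 - \<delta>) * c0 powr p * s powr (\<delta> * p) * A * nu / mu"
    using poincare pos by (simp add: field_simps)
  then have "(osc powr p) powr (1 / p) \<le> ((1 - \<delta>) * c0 powr p * s powr (\<delta> * p) * A * nu / mu) powr (1 / p)"
    using ex by (intro powr_mono2) auto
  also have "(osc powr p) powr (1 / p) = osc" using pos ex by (simp add: powr_powr)
  also have "((1 - \<delta>) * c0 powr p * s powr (\<delta> * p) * A * nu / mu) powr (1 / p)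
      = ?k * s powr \<delta> * (nu powr (1 / p) * mu powr (- (1 / p)))"
    using pos ex by (simp add: powr_mult powr_divide powr_powr powr_minus divide_inverse inverse_powr mult_ac)
  also have "\<dots> \<le> ?k * (l powr \<delta> * ((Ar / muQ) powr \<tau> * mu powr \<tau>)) * (nu powr (1 / p) * mu powr (- (1 / p)))"
    using sl pos by (intro mult_right_mono mult_left_mono) auto
  also have "\<dots> = ?c * (nu powr (1 / p) * mu powr (\<tau> - 1 / p))"
    by (simp add: powr_diff powr_minus divide_inverse)
  finally have "osc powr q \<le> (?c * (nu powr (1 / p) * mu powr (\<tau> - 1 / p))) powr q"
    using pos ex by (intro powr_mono2) auto
  also have "\<dots> = ?c powr q * (nu powr (q / p) * mu powr (- 1))"
  proof -
    have "(\<tau> - 1 / p) * q = - 1" using q\<tau> by (simp add: algebra_simps)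
    then show ?thesis using pos by (simp add: powr_mult powr_powr)
  qed
  finally have "osc powr q * mu \<le> ?c powr q * (nu powr (q / p) * mu powr (- 1)) * mu"
    using pos by (intro mult_right_mono) auto
  also have "\<dots> = ?c powr q * nu powr (q / p)"
    using pos by (simp add: powr_minus)
  finally show ?thesis unfolding \<tau>_def .
qed

text \<open>For t <= t' this is z - t truncated to the interval from 0 to t' - t. As a difference of
  minima it telescopes over consecutive levels.\<close>

definition layer :: "real \<Rightarrow> real \<Rightarrow> real \<Rightarrow> real" where
  "layer t t' z = min z t' - min z t"

lemma sum_layer_diff:
  assumes "incseq t"
  shows "(\<Sum>k<M. \<bar>layer (t k) (t (Suc k)) u - layer (t k) (t (Suc k)) v\<bar>) \<le> \<bar>u - v\<bar>"
proof -
  let ?d = "\<lambda>u v k. \<bar>layer (t k) (t (Suc k)) u - layer (t k) (t (Suc k)) v\<bar>"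
  have main: "(\<Sum>k<M. ?d u v k) \<le> u - v" if "v \<le> u" for u v
  proof -
    have mono: "layer (t k) (t (Suc k)) v \<le> layer (t k) (t (Suc k)) u" for k
      using that incseq_SucD[OF assms, of k] unfolding layer_def by linarith
    have tele: "(\<Sum>k<M. layer (t k) (t (Suc k)) z) = min z (t M) - min z (t 0)" for z
      unfolding layer_def by (rule sum_lessThan_telescope)
    have "(\<Sum>k<M. ?d u v k)
        = (\<Sum>k<M. layer (t k) (t (Suc k)) u) - (\<Sum>k<M. layer (t k) (t (Suc k)) v)"
      using mono by (simp add: sum_subtractf)
    also have "\<dots> \<le> u - v" unfolding tele using that by linarith
    finally show ?thesis .
  qed
  show ?thesis
  proof (cases "v \<le> u")
    case True then show ?thesis using main[of v u] by simp
  next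
    case False then show ?thesis using main[of u v] by (simp add: abs_minus_commute)
  qed
qed

lemma sum_layer_powr:
  assumes "incseq t" "p \<ge> 1"
  shows "(\<Sum>k<M. \<bar>layer (t k) (t (Suc k)) u - layer (t k) (t (Suc k)) v\<bar> powr p) \<le> \<bar>u - v\<bar> powr p"
proof -
  let ?d = "\<lambda>k. \<bar>layer (t k) (t (Suc k)) u - layer (t k) (t (Suc k)) v\<bar>"
  have "(\<Sum>k<M. ?d k powr p)
      \<le> (\<Sum>k<M. ?d k) powr p"
    by (rule sum_powr_le_powr_sum) (use assms in auto)
  also have "\<dots> \<le> \<bar>u - v\<bar> powr p"
    using assms sum_layer_diff[OF assms(1)] by (intro powr_mono2 sum_nonneg) auto
  finally show ?thesis .
qed

text \<open>Summing the recursion bounds the sum by half of itself plus the error; as the sum is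
  finite, that half can be subtracted.\<close>

lemma ladder_absorption:
  fixes a :: "nat \<Rightarrow> real"
  assumes nonneg: "\<And>k. a k \<ge> 0" and step: "\<And>k. a (Suc k) \<le> a k / 2 + e k" and e: "(\<Sum>k<M. e k) \<le> E"
  shows "(\<Sum>k<M. a k) \<le> 2 * a 0 + 2 * E"
proof -
  have "(\<Sum>k<M. a k) \<le> a 0 + (\<Sum>k<M. a (Suc k))"
  proof -
    have "(\<Sum>k<M. a k) \<le> (\<Sum>k<Suc M. a k)" using nonneg by simp
    also have "\<dots> = a 0 + (\<Sum>k<M. a (Suc k))" by (rule sum.lessThan_Suc_shift)
    finally show ?thesis .
  qed
  also have "(\<Sum>k<M. a (Suc k)) \<le> (\<Sum>k<M. a k / 2 + e k)" by (intro sum_mono step)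
  also have "\<dots> = (\<Sum>k<M. a k) / 2 + (\<Sum>k<M. e k)" by (simp add: sum.distrib sum_divide_distrib)
  finally show ?thesis using e by linarith
qed

lemma one_plus_inverse_powr_le: "q > 0 \<Longrightarrow> (1 + 1 / q) powr q \<le> exp (1::real)"
proof -
  assume q: "q > 0"
  have "(1 + 1 / q) powr q \<le> exp (1 / q) powr q"
    using q exp_ge_add_one_self[of "1 / q"] by (intro powr_mono2) auto
  also have "\<dots> = exp 1" using q by (simp add: powr_def)
  finally show ?thesis .
qed

section \<open>Medians\<close>

lemma measure_superlevel_le:
  fixes f :: "'a \<Rightarrow> real"
  assumes S: "S \<in> fmeasurable M" and f[measurable]: "f \<in> borel_measurable M"
    and le: "\<And>t. t > c \<Longrightarrow> measure M (S \<inter> {x. f x > t}) \<le> b"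
  shows "measure M (S \<inter> {x. f x > c}) \<le> b"
proof (rule LIMSEQ_le_const2)
  have Ss[measurable]: "S \<in> sets M" and Ssp: "S \<subseteq> space M" using S sets.sets_into_space by auto
  define G where "G t = S \<inter> {x. f x > t}" for t
  have Gf: "G t \<in> fmeasurable M" for t
  proof (rule fmeasurableI2[OF S])
    have "G t = S \<inter> {x \<in> space M. f x > t}" unfolding G_def using Ssp by auto
    moreover have "S \<inter> {x \<in> space M. f x > t} \<in> sets M" by measurable
    ultimately show "G t \<in> sets M" by simp
  qed (auto simp: G_def)
  have eq: "(\<Union>k::nat. G (c + 1 / real (Suc k))) = S \<inter> {x. f x > c}"
  proof (intro equalityI subsetI)
    fix x assume x: "x \<in> S \<inter> {x. f x > c}"
    then obtain k :: nat where "1 / real (Suc k) < f x - c" using nat_approx_posE[of "f x - c"] by auto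
    then show "x \<in> (\<Union>k::nat. G (c + 1 / real (Suc k)))" using x unfolding G_def by (auto intro!: exI[of _ k])
  next
    fix x assume "x \<in> (\<Union>k::nat. G (c + 1 / real (Suc k)))"
    then obtain k :: nat where k: "x \<in> S" "c + 1 / real (Suc k) < f x" unfolding G_def by blast
    have "0 < 1 / real (Suc k)" by simp
    then have "c < f x" using k(2) by linarith
    then show "x \<in> S \<inter> {x. f x > c}" using k(1) by simp
  qed
  show "(\<lambda>k::nat. measure M (G (c + 1 / real (Suc k)))) \<longlonglongrightarrow> measure M (S \<inter> {x. f x > c})"
    unfolding eq[symmetric]
  proof (rule Lim_measure_incseq)
    show "range (\<lambda>k::nat. G (c + 1 / real (Suc k))) \<subseteq> sets M" using fmeasurableD[OF Gf] by auto
    show "incseq (\<lambda>k::nat. G (c + 1 / real (Suc k)))"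
    proof (rule incseq_SucI)
      fix k :: nat
      have "1 / real (Suc (Suc k)) \<le> 1 / real (Suc k)" by (intro divide_left_mono) auto
      then show "G (c + 1 / real (Suc k)) \<subseteq> G (c + 1 / real (Suc (Suc k)))" unfolding G_def by auto
    qed
    show "emeasure M (\<Union>k::nat. G (c + 1 / real (Suc k))) \<noteq> \<infinity>" unfolding eq using fmeasurableD2[OF Gf[of c]] by (simp add: G_def)
  qed
  have "measure M (G (c + 1 / real (Suc k))) \<le> b" for k :: nat
    unfolding G_def by (rule le) simp
  then show "\<exists>N. \<forall>k\<ge>N. measure M (G (c + 1 / real (Suc k))) \<le> b" by blast
qed

text \<open>The median is the infimum of all levels with at most half of the mass above them.
  Continuity from below turns the bounds at levels beyond \<open>c\<close>, on either side, into
  bounds for the strict superlevel and sublevel sets at \<open>c\<close>.\<close>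

lemma exists_median:
  fixes f :: "'a \<Rightarrow> real"
  assumes S: "S \<in> fmeasurable M" and f[measurable]: "f \<in> borel_measurable M" and mS: "measure M S > 0"
  shows "\<exists>c. measure M (S \<inter> {x. f x > c}) \<le> measure M S / 2 \<and> measure M (S \<inter> {x. f x < c}) \<le> measure M S / 2"
proof -
  have Ss[measurable]: "S \<in> sets M" and Ssp: "S \<subseteq> space M" using S sets.sets_into_space by auto
  define G where "G t = S \<inter> {x. f x > t}" for t
  define L where "L t = S \<inter> {x. f x \<le> t}" for t
  have Gf: "G t \<in> fmeasurable M" and Lf: "L t \<in> fmeasurable M" for t
  proof -
    have "G t = S \<inter> {x \<in> space M. f x > t}" "L t = S \<inter> {x \<in> space M. f x \<le> t}" unfolding G_def L_def using Ssp by auto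
    moreover have "S \<inter> {x \<in> space M. f x > t} \<in> sets M" "S \<inter> {x \<in> space M. f x \<le> t} \<in> sets M" by measurable
    ultimately have "G t \<in> sets M" "L t \<in> sets M" by simp_all
    then show "G t \<in> fmeasurable M" "L t \<in> fmeasurable M"
      by (auto intro!: fmeasurableI2[OF S] simp: G_def L_def)
  qed
  have Gm: "measure M (G t) \<le> measure M (G u)" if "u \<le> t" for t u
    by (rule measure_mono_fmeasurable[OF _ fmeasurableD[OF Gf] Gf]) (use that in \<open>auto simp: G_def\<close>)
  have split: "measure M S = measure M (G t) + measure M (L t)" for t
  proof -
    have "measure M (G t \<union> L t) = measure M (G t) + measure M (L t)"
      by (rule measure_Un_AE[OF _ Gf Lf]) (auto simp: G_def L_def)
    moreover have "G t \<union> L t = S" unfolding G_def L_def by auto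
    ultimately show ?thesis by simp
  qed
  define T where "T = {t. measure M (G t) \<le> measure M S / 2}"
  \<comment> \<open>The limits at plus and minus infinity show that \<open>T\<close> is nonempty and
    bounded below, so that its infimum is a genuine level.\<close>
  have "(\<lambda>k::nat. measure M (L (real k))) \<longlonglongrightarrow> measure M (\<Union>k::nat. L (real k))"
  proof (rule Lim_measure_incseq)
    show "range (\<lambda>k::nat. L (real k)) \<subseteq> sets M" using fmeasurableD[OF Lf] by auto
    show "incseq (\<lambda>k::nat. L (real k))" by (rule incseq_SucI) (auto simp: L_def)
    have "(\<Union>k::nat. L (real k)) = S" using real_arch_simple by (fastforce simp: L_def)
    then show "emeasure M (\<Union>k::nat. L (real k)) \<noteq> \<infinity>" using fmeasurableD2[OF S] by simp
  qed
  moreover have "(\<Union>k::nat. L (real k)) = S" using real_arch_simple by (fastforce simp: L_def)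
  ultimately have "(\<lambda>k::nat. measure M (L (real k))) \<longlonglongrightarrow> measure M S" by simp
  then have "eventually (\<lambda>k. measure M (L (real k)) > measure M S / 2) sequentially"
    by (rule order_tendstoD(1)) (use mS in simp)
  then obtain k1 :: nat where "measure M (L (real k1)) > measure M S / 2" by (auto simp: eventually_sequentially)
  then have Tne: "real k1 \<in> T" unfolding T_def using split[of "real k1"] by simp
  have "(\<lambda>k::nat. measure M (G (- real k))) \<longlonglongrightarrow> measure M (\<Union>k::nat. G (- real k))"
  proof (rule Lim_measure_incseq)
    show "range (\<lambda>k::nat. G (- real k)) \<subseteq> sets M" using fmeasurableD[OF Gf] by auto
    show "incseq (\<lambda>k::nat. G (- real k))" by (rule incseq_SucI) (auto simp: G_def)
    have "(\<Union>k::nat. G (- real k)) \<subseteq> S" by (auto simp: G_def)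
    then have "emeasure M (\<Union>k::nat. G (- real k)) \<le> emeasure M S" by (rule emeasure_mono) simp
    then show "emeasure M (\<Union>k::nat. G (- real k)) \<noteq> \<infinity>" using fmeasurableD2[OF S] by (auto simp: top_unique)
  qed
  moreover have "(\<Union>k::nat. G (- real k)) = S"
  proof (intro equalityI subsetI)
    fix x assume x: "x \<in> S"
    obtain k :: nat where "- f x < real k" using reals_Archimedean2 by blast
    then have "x \<in> G (- real k)" using x unfolding G_def by simp
    then show "x \<in> (\<Union>k::nat. G (- real k))" by blast
  qed (auto simp: G_def)
  ultimately have "(\<lambda>k::nat. measure M (G (- real k))) \<longlonglongrightarrow> measure M S" by simp
  then have "eventually (\<lambda>k. measure M (G (- real k)) > measure M S / 2) sequentially"
    by (rule order_tendstoD(1)) (use mS in simp)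
  then obtain k2 :: nat where k2: "measure M (G (- real k2)) > measure M S / 2" by (auto simp: eventually_sequentially)
  have lower: "- real k2 \<le> t" if "t \<in> T" for t
  proof (rule ccontr)
    assume "\<not> - real k2 \<le> t"
    then show False using Gm[of t "- real k2"] k2 that unfolding T_def by simp
  qed
  then have bdd: "bdd_below T" by (auto simp: bdd_below_def)
  define c where "c = Inf T"
  have above: "measure M (G t) \<le> measure M S / 2" if t: "t > c" for t
  proof -
    obtain u where u: "u \<in> T" "u < t" using cInf_lessD[of T t] Tne t unfolding c_def by blast
    then show ?thesis using Gm[of u t] unfolding T_def by simp
  qed
  have below: "measure M (L t) \<le> measure M S / 2" if "t < c" for t
  proof -
    have "t \<notin> T" using cInf_lower[OF _ bdd, of t] that unfolding c_def by auto
    then show ?thesis using split[of t] unfolding T_def by simp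
  qed
  have "measure M (S \<inter> {x. f x > c}) \<le> measure M S / 2"
    by (rule measure_superlevel_le[OF S f]) (use above in \<open>simp add: G_def\<close>)
  moreover have "measure M (S \<inter> {x. - f x > - c}) \<le> measure M S / 2"
  proof (rule measure_superlevel_le[OF S])
    fix t assume t: "t > - c"
    have "measure M (S \<inter> {x. - f x > t}) \<le> measure M (L (- t))"
    proof (rule measure_mono_fmeasurable[OF _ _ Lf])
      have "S \<inter> {x. - f x > t} = S \<inter> {x \<in> space M. - f x > t}" using Ssp by auto
      moreover have "S \<inter> {x \<in> space M. - f x > t} \<in> sets M" by measurable
      ultimately show "S \<inter> {x. - f x > t} \<in> sets M" by simp
    qed (auto simp: L_def)
    also have "\<dots> \<le> measure M S / 2" by (rule below) (use t in simp)
    finally show "measure M (S \<inter> {x. - f x > t}) \<le> measure M S / 2" .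
  qed measurable
  ultimately show ?thesis by auto
qed

section \<open>Self-improvement on a weighted cube\<close>

text \<open>All three weight constants are positive real numbers here. Infinite constants and
  degenerate energies are treated in \<open>weighted_fractional_poincare\<close>.\<close>

locale weighted_cube =
  fixes a :: "real ^ 'n" and l \<delta> p q r A Ar W :: real and w :: "real ^ 'n \<Rightarrow> real"
  assumes l: "l > 0" and \<delta>: "0 < \<delta>" "\<delta> < 1" and r: "1 \<le> r" and p: "1 \<le> p" and q: "q > 0"
    and pq: "1 / p - 1 / q = \<delta> / (real CARD('n) * r)"
    and w_meas [measurable]: "w \<in> borel_measurable lebesgue" and w_pos: "AE x in lebesgue. w x > 0"
    and w_fin: "weight_of w (cube a l) < \<infinity>"
    and A: "Ap_const p w = ennreal A" "A > 0" and Ar: "Ap_const r w = ennreal Ar" "Ar > 0"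
    and W: "Ainf_const w = ennreal W" "W \<ge> 1"
begin

abbreviation "Q \<equiv> cube a l"
abbreviation "Q0 \<equiv> hcube a l"
abbreviation "m \<equiv> measure lebesgue"
abbreviation "\<D> \<equiv> dyadic_cubes a l"

definition \<mu> :: "(real ^ 'n) measure" where "\<mu> = wmeasure w Q0"

definition c0 :: real where "c0 = 8 * 2 ^ CARD('n) * real CARD('n) ^ (CARD('n) + 1)"

definition B :: real where
  "B = c0 * ((1 - \<delta>) powr (1 / p) * A powr (1 / p)) * l powr \<delta>
    * (Ar / measure \<mu> Q0) powr (\<delta> / (real CARD('n) * r))"

definition osc :: "(real ^ 'n \<Rightarrow> real) \<Rightarrow> (real ^ 'n) set \<Rightarrow> ennreal" where
  "osc g P = (\<integral>\<^sup>+x\<in>P. (\<integral>\<^sup>+y\<in>P. ennreal \<bar>g x - g y\<bar> \<partial>lborel) \<partial>lborel)"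

text \<open>The inner integral always runs over the whole cube \<open>Q\<close>, so the energy is a
  measure in \<open>S\<close> and can be added over disjoint subcubes. For a subcube it dominates
  the seminorm taken on that subcube alone.\<close>

definition energy :: "(real ^ 'n \<Rightarrow> real) \<Rightarrow> (real ^ 'n) set \<Rightarrow> ennreal" where
  "energy g S = (\<integral>\<^sup>+x\<in>S. gagliardo \<delta> p Q g x * ennreal (w x) \<partial>lebesgue)"

lemma c0_pos: "c0 > 0" unfolding c0_def by simp

lemma Q_sets [measurable]: "Q0 \<in> sets lebesgue" "Q \<in> sets lebesgue" by auto

lemma weight_fin: "weight_of w Q0 < \<infinity>" using w_fin weight_of_hcube[OF l, of w a] by simp

lemma finite_mu: "finite_measure \<mu>"
  unfolding \<mu>_def by (rule finite_wmeasure[OF w_meas Q_sets(1) weight_fin])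

sublocale \<mu>: finite_measure \<mu> by (rule finite_mu)

lemma sets_mu: "sets \<mu> = sets lebesgue" unfolding \<mu>_def wmeasure_def by simp

lemma tree: "tree_family lebesgue (\<D> K) Q0 (2 ^ CARD('n))" by (rule dyadic_cubes_tree[OF l])

lemma emeasure_mu: "S \<in> sets lebesgue \<Longrightarrow> S \<subseteq> Q0 \<Longrightarrow> emeasure \<mu> S = weight_of w S"
  unfolding \<mu>_def by (rule emeasure_wmeasure[OF w_meas Q_sets(1)])

lemma weight_mu: "P \<in> \<D> K \<Longrightarrow> weight_of w P = ennreal (measure \<mu> P)"
  using emeasure_mu[of P] tree_family.sub_Q[OF tree, of P K] fmeasurableD[OF tree_family.fmeas[OF tree, of P K]]
  by (simp add: \<mu>.emeasure_eq_measure)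

lemma Q0_in: "Q0 \<in> \<D> K" by (rule tree_family.Q_T[OF tree])

lemma energy_mono:
  assumes "S \<subseteq> T" shows "energy g S \<le> energy g T"
  unfolding energy_def by (intro nn_integral_mono mult_left_mono) (use assms in \<open>auto simp: indicator_def\<close>)

lemma mu_pos:
  assumes P: "P \<in> \<D> K" shows "measure \<mu> P > 0"
proof -
  have Pf: "P \<in> fmeasurable lebesgue" by (rule tree_family.fmeas[OF tree P])
  have "emeasure lebesgue P \<noteq> 0"
    using tree_family.pos[OF tree P] by (auto simp: measure_def)
  then have "weight_of w P \<noteq> 0" by (rule weight_of_nonzero[OF w_meas fmeasurableD[OF Pf] w_pos])
  then show ?thesis using weight_mu[OF P] by (simp add: zero_less_measure_iff)
qed

text \<open>\<open>Ap_weighted_mean\<close> with exponent \<open>r\<close> for the indicator of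
  \<open>P\<close>.\<close>

lemma doubling:
  assumes P: "P \<in> \<D> K" and s: "s > 0" "P = hcube b s"
  shows "(s ^ CARD('n) / l ^ CARD('n)) powr r \<le> Ar * measure \<mu> P / measure \<mu> Q0"
proof -
  let ?n = "CARD('n)"
  have PQ: "P \<subseteq> Q" using tree_family.sub_Q[OF tree P] hcube_sub_cube by blast
  have [measurable]: "P \<in> sets lebesgue" by (rule fmeasurableD[OF tree_family.fmeas[OF tree P]])
  have "(\<integral>\<^sup>+x\<in>Q. indicator P x \<partial>lebesgue) ennpowr r * weight_of w Q
    \<le> Ap_const r w * (ennreal (l ^ ?n) ennpowr r) * (\<integral>\<^sup>+x\<in>Q. (indicator P x ennpowr r) * ennreal (w x) \<partial>lebesgue)"
    by (rule Ap_weighted_mean[OF w_pos r l w_meas]) measurable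
  moreover have "(\<integral>\<^sup>+x\<in>Q. indicator P x \<partial>lebesgue) = ennreal (s ^ ?n)"
  proof -
    have "(\<integral>\<^sup>+x\<in>Q. indicator P x \<partial>lebesgue) = (\<integral>\<^sup>+x. indicator P x \<partial>lebesgue)"
      by (intro nn_integral_cong) (use PQ in \<open>auto simp: indicator_def\<close>)
    then show ?thesis using emeasure_hcube[OF s(1), of b] s(2) by simp
  qed
  moreover have "(\<integral>\<^sup>+x\<in>Q. (indicator P x ennpowr r) * ennreal (w x) \<partial>lebesgue) = ennreal (measure \<mu> P)"
    unfolding weight_mu[OF P, symmetric] weight_of_def
    by (intro nn_integral_cong) (use PQ in \<open>auto simp: indicator_def\<close>)
  moreover have "weight_of w Q = ennreal (measure \<mu> Q0)"
    using weight_mu[OF Q0_in] weight_of_hcube[OF l, of w a] by simp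
  ultimately have "ennreal ((s ^ ?n) powr r * measure \<mu> Q0) \<le> ennreal (Ar * (l ^ ?n) powr r * measure \<mu> P)"
    using l s Ar by (simp add: ennpowr_ennreal ennreal_mult')
  then have "(s ^ ?n) powr r * measure \<mu> Q0 \<le> Ar * (l ^ ?n) powr r * measure \<mu> P"
    using Ar(2) by (simp add: ennreal_le_iff)
  moreover have "measure \<mu> Q0 > 0" by (rule mu_pos[OF Q0_in])
  moreover have "(l ^ ?n) powr r > 0" using l by simp
  ultimately show ?thesis using l s(1) by (simp add: powr_divide field_simps)
qed

text \<open>\<open>fractional_poincare_base\<close> on \<open>P\<close>, with s^\<delta> converted
  into weight by \<open>doubling\<close> as in \<open>oscillation_exponents\<close>. Unlike the
  unweighted form, the right side refers to \<open>P\<close> only through its energy, which makes it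
  summable.\<close>

lemma cube_oscillation:
  assumes g[measurable]: "g \<in> borel_measurable borel" and fin: "energy g Q < \<infinity>" and P: "P \<in> \<D> K"
  shows "osc g P < \<infinity>"
    "(enn2real (osc g P) / (m P)\<^sup>2) powr q * measure \<mu> P \<le> B powr q * enn2real (energy g P) powr (q / p)"
proof -
  let ?n = "CARD('n)"
  obtain b s where s: "s > 0" "P = hcube b s" and PQ0: "P \<subseteq> Q0" by (rule dyadic_cubes_cube[OF l P])
  have PQ: "P \<subseteq> Q" using PQ0 hcube_sub_cube by blast
  have mP: "m P = s ^ ?n" unfolding s(2) by (rule measure_hcube(1)[OF s(1)])
  let ?Pc = "cube b s"
  let ?X = "\<integral>\<^sup>+x\<in>?Pc. (\<integral>\<^sup>+y\<in>?Pc. ennreal \<bar>g x - g y\<bar> \<partial>lborel) \<partial>lborel"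
  let ?k = "(1 - \<delta>) * (c0 * s ^ ?n * s ^ ?n) powr p * s powr (\<delta> * p)"
  have muP: "measure \<mu> P > 0" by (rule mu_pos[OF P])
  have fP: "energy g P < \<infinity>" using energy_mono[OF PQ, of g] fin by (rule le_less_trans)
  then obtain e where e: "energy g P = ennreal e" "e \<ge> 0" by (cases "energy g P") auto
  have oX: "osc g P \<le> ?X" unfolding osc_def
    by (intro nn_integral_mono mult_mono) (use hcube_sub_cube[of b s] in \<open>auto simp: indicator_def s(2)\<close>)
  have wP: "weight_of w ?Pc = ennreal (measure \<mu> P)"
    using weight_mu[OF P] weight_of_hcube[OF s(1), of w b] s(2) by simp
  have "?X ennpowr p * weight_of w ?Pc
    \<le> ennreal ?k * Ap_const p w * (\<integral>\<^sup>+x\<in>?Pc. gagliardo \<delta> p ?Pc g x * ennreal (w x) \<partial>lebesgue)"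
    unfolding c0_def by (rule fractional_poincare_base[OF g w_meas w_pos \<delta> p s(1)])
  also have "(\<integral>\<^sup>+x\<in>?Pc. gagliardo \<delta> p ?Pc g x * ennreal (w x) \<partial>lebesgue) = (\<integral>\<^sup>+x\<in>P. gagliardo \<delta> p ?Pc g x * ennreal (w x) \<partial>lebesgue)"
    unfolding s(2) by (rule nn_integral_hcube[OF s(1), symmetric])
  also have "ennreal ?k * Ap_const p w * (\<integral>\<^sup>+x\<in>P. gagliardo \<delta> p ?Pc g x * ennreal (w x) \<partial>lebesgue) \<le> ennreal ?k * Ap_const p w * energy g P"
    unfolding energy_def
  proof (intro mult_left_mono nn_integral_mono mult_right_mono)
    fix x
    have "gagliardo \<delta> p ?Pc g x = gagliardo \<delta> p P g x"
      unfolding gagliardo_def s(2)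
      by (rule nn_integral_hcube[OF s(1), unfolded nn_integral_completion, symmetric])
    also have "\<dots> \<le> gagliardo \<delta> p Q g x"
      unfolding gagliardo_def by (intro nn_integral_mono mult_left_mono) (use PQ in \<open>auto simp: indicator_def\<close>)
    finally show "gagliardo \<delta> p ?Pc g x \<le> gagliardo \<delta> p Q g x" .
  qed auto
  also have "\<dots> = ennreal (?k * A * e)" using e A \<delta> by (simp add: ennreal_mult')
  finally have base: "?X ennpowr p * ennreal (measure \<mu> P) \<le> ennreal (?k * A * e)" unfolding wP .
  \<comment> \<open>\<open>P\<close> has positive weight, so an infinite oscillation would
    contradict the finite bound just obtained.\<close>
  have Xfin: "?X \<noteq> \<infinity>"
  proof
    assume "?X = \<infinity>"
    then have "?X ennpowr p * ennreal (measure \<mu> P) = \<infinity>" using muP by (simp add: ennreal_top_mult)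
    then show False using base by (simp add: top_unique)
  qed
  show "osc g P < \<infinity>" by (rule le_less_trans[OF oX]) (use Xfin in \<open>simp add: less_top[symmetric]\<close>)
  obtain z where z: "?X = ennreal z" "z \<ge> 0" using Xfin by (cases ?X) auto
  define x where "x = enn2real (osc g P)"
  have xz: "x \<le> z" unfolding x_def using oX z by (simp add: enn2real_leI)
  have "z powr p * measure \<mu> P \<le> ?k * A * e"
    using base z e A(2) \<delta> by (simp add: ennpowr_ennreal ennreal_mult'[symmetric] ennreal_le_iff)
  moreover have "x powr p * measure \<mu> P \<le> z powr p * measure \<mu> P"
    using xz p by (intro mult_right_mono powr_mono2) (auto simp: x_def)
  ultimately have xk: "x powr p * measure \<mu> P \<le> ?k * A * e" by linarith
  define L where "L = (m P)\<^sup>2"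
  have L: "L > 0" unfolding L_def mP using s(1) by simp
  have k: "?k = (1 - \<delta>) * (c0 powr p * L powr p) * s powr (\<delta> * p)"
    unfolding L_def mP using s(1) c0_pos by (simp add: powr_mult power2_eq_square mult.assoc)
  have "(x / L) powr p * measure \<mu> P = x powr p * measure \<mu> P / L powr p"
    using L by (simp add: powr_divide x_def)
  also have "\<dots> \<le> ?k * A * e / L powr p" using xk by (intro divide_right_mono) auto
  also have "\<dots> = (1 - \<delta>) * c0 powr p * s powr (\<delta> * p) * A * e"
    unfolding k using L by (simp add: field_simps)
  finally have poinc: "(x / L) powr p * measure \<mu> P \<le> (1 - \<delta>) * c0 powr p * s powr (\<delta> * p) * A * e" .
  have n1: "CARD('n) \<ge> 1" by (simp add: Suc_leI)
  have "(x / L) powr q * measure \<mu> P \<le> B powr q * e powr (q / p)"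
    unfolding B_def
    by (rule oscillation_exponents[OF _ muP mu_pos[OF Q0_in[of 0]] e(2) s(1) l A(2) Ar(2) c0_pos n1 \<delta> p r q pq poinc doubling[OF P s]])
       (use L in \<open>simp add: x_def\<close>)
  then show "(enn2real (osc g P) / (m P)\<^sup>2) powr q * measure \<mu> P \<le> B powr q * enn2real (energy g P) powr (q / p)"
    unfolding x_def L_def using e by simp
qed

section \<open>Cubes of large oscillation and the energies of truncations\<close>

lemma q_ge_p: "q \<ge> p"
proof -
  have "1 / p - 1 / q \<ge> 0" unfolding pq using \<delta> r by simp
  then show ?thesis using p q by (simp add: field_simps)
qed

definition bad :: "nat \<Rightarrow> (real ^ 'n \<Rightarrow> real) \<Rightarrow> real \<Rightarrow> (real ^ 'n) set set" where
  "bad K g \<tau> = {P \<in> \<D> K. enn2real (osc g P) > \<tau> * (m P)\<^sup>2}"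

lemma gagliardo_meas [measurable]:
  assumes "g \<in> borel_measurable borel"
  shows "gagliardo \<delta> p Q g \<in> borel_measurable lebesgue"
  by (rule measurable_completion) (simp add: gagliardo_measurable assms)

lemma energy_disjoint:
  assumes g[measurable]: "g \<in> borel_measurable borel" and fin: "energy g Q < \<infinity>"
    and M: "finite \<M>" "\<M> \<subseteq> \<D> K" "disjoint \<M>"
  shows "(\<Sum>P\<in>\<M>. enn2real (energy g P)) \<le> enn2real (energy g Q)"
proof -
  have Ps: "P \<in> sets lebesgue" "P \<subseteq> Q" if "P \<in> \<M>" for P
    using that M(2) fmeasurableD[OF tree_family.fmeas[OF tree, of P K]] tree_family.sub_Q[OF tree, of P K] hcube_sub_cube[of a l] by blast+
  have "(\<Sum>P\<in>\<M>. energy g P) = (\<integral>\<^sup>+x. (\<Sum>P\<in>\<M>. gagliardo \<delta> p Q g x * ennreal (w x) * indicator P x) \<partial>lebesgue)"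
    unfolding energy_def using Ps by (subst nn_integral_sum) (auto intro!: borel_measurable_times_ennreal borel_measurable_indicator measurable_compose[OF w_meas measurable_ennreal])
  also have "\<dots> \<le> energy g Q" unfolding energy_def
  proof (rule nn_integral_mono)
    fix x
    have "(\<Sum>P\<in>\<M>. indicator P x) \<le> (indicator Q x :: ennreal)"
    proof (cases "\<exists>P\<in>\<M>. x \<in> P")
      case True
      then obtain P where P: "P \<in> \<M>" "x \<in> P" by blast
      have "(\<Sum>P'\<in>\<M>. indicator P' x) = (\<Sum>P'\<in>\<M>. if P' = P then 1 else (0::ennreal))"
      proof (rule sum.cong)
        fix P' assume "P' \<in> \<M>"
        then show "indicator P' x = (if P' = P then 1 else (0::ennreal))" using P M(3) by (auto simp: indicator_def dest: disjointD)
      qed simp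
      also have "\<dots> = 1" using P M(1) by simp
      finally show ?thesis using Ps(2)[OF P(1)] P(2) by auto
    qed (auto simp: indicator_def)
    then have "(gagliardo \<delta> p Q g x * ennreal (w x)) * (\<Sum>P\<in>\<M>. indicator P x) \<le> (gagliardo \<delta> p Q g x * ennreal (w x)) * indicator Q x"
      by (rule mult_left_mono) simp
    then show "(\<Sum>P\<in>\<M>. gagliardo \<delta> p Q g x * ennreal (w x) * indicator P x) \<le> gagliardo \<delta> p Q g x * ennreal (w x) * indicator Q x"
      by (simp add: sum_distrib_left)
  qed
  finally have le: "(\<Sum>P\<in>\<M>. energy g P) \<le> energy g Q" .
  have "energy g P = ennreal (enn2real (energy g P))" if "P \<in> \<M>" for P
  proof -
    have "energy g P < top" using energy_mono[OF Ps(2)[OF that], of g] fin by (simp add: le_less_trans)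
    then show ?thesis by (rule ennreal_enn2real[symmetric])
  qed
  then have "(\<Sum>P\<in>\<M>. energy g P) = ennreal (\<Sum>P\<in>\<M>. enn2real (energy g P))"
    by (subst sum_ennreal[symmetric]) auto
  then have "ennreal (\<Sum>P\<in>\<M>. enn2real (energy g P)) \<le> ennreal (enn2real (energy g Q))"
    using le fin by (simp add: less_top[symmetric])
  then show ?thesis by (simp add: ennreal_le_iff)
qed

lemma B_pos: "B > 0"
  unfolding B_def using c0_pos \<delta> A Ar l mu_pos[OF Q0_in[of 0]] by simp

text \<open>A weak-type bound: maximal bad cubes are disjoint, each has weight controlled by a power
  q/p of its energy, and these powers add up because q >= p.\<close>

lemma bad_measure:
  assumes g: "g \<in> borel_measurable borel" and fin: "energy g Q < \<infinity>" and \<tau>: "\<tau> > 0"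
  shows "measure \<mu> (\<Union>(bad K g \<tau>)) \<le> (B / \<tau>) powr q * enn2real (energy g Q) powr (q / p)"
proof -
  interpret tree_family lebesgue "\<D> K" Q0 "2 ^ CARD('n)" by (rule tree)
  have badD: "bad K g \<tau> \<subseteq> \<D> K" unfolding bad_def by auto
  have finb: "finite (bad K g \<tau>)" by (rule finite_subset[OF badD finite_T])
  have lam: "P \<inter> P' = {} \<or> P \<subseteq> P' \<or> P' \<subseteq> P" if "P \<in> bad K g \<tau>" "P' \<in> bad K g \<tau>" for P P'
    using laminar[of P P'] that badD by blast
  define \<M> where "\<M> = {P \<in> bad K g \<tau>. \<forall>P'\<in>bad K g \<tau>. P \<subseteq> P' \<longrightarrow> P' = P}"
  note mx = finite_laminar_maximal[of "bad K g \<tau>", OF finb lam, folded \<M>_def]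
  have Mb: "\<M> \<subseteq> bad K g \<tau>" unfolding \<M>_def by auto
  have finM: "finite \<M>" by (rule finite_subset[OF Mb finb])
  have each: "measure \<mu> P \<le> (B / \<tau>) powr q * enn2real (energy g P) powr (q / p)" if "P \<in> \<M>" for P
  proof -
    have P: "P \<in> \<D> K" "enn2real (osc g P) > \<tau> * (m P)\<^sup>2" using that Mb unfolding bad_def by auto
    have mP: "m P > 0" by (rule pos[OF P(1)])
    have "\<tau> \<le> enn2real (osc g P) / (m P)\<^sup>2" using P(2) mP by (simp add: field_simps)
    then have "\<tau> powr q * measure \<mu> P \<le> (enn2real (osc g P) / (m P)\<^sup>2) powr q * measure \<mu> P"
      using \<tau> q by (intro mult_right_mono powr_mono2) auto
    also have "\<dots> \<le> B powr q * enn2real (energy g P) powr (q / p)" by (rule cube_oscillation(2)[OF g fin P(1)])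
    finally show ?thesis using \<tau> B_pos by (simp add: powr_divide field_simps)
  qed
  have "measure \<mu> (\<Union>(bad K g \<tau>)) = measure \<mu> (\<Union>\<M>)" using mx(2) by simp
  also have "\<dots> \<le> (\<Sum>P\<in>\<M>. measure \<mu> P)"
  proof (rule measure_Union_le[OF finM])
    fix P assume "P \<in> \<M>"
    then have "P \<in> \<D> K" using Mb badD by blast
    then show "P \<in> sets \<mu>" unfolding sets_mu by (rule fmeasurableD[OF fmeas])
  qed
  also have "\<dots> \<le> (\<Sum>P\<in>\<M>. (B / \<tau>) powr q * enn2real (energy g P) powr (q / p))" by (intro sum_mono each)
  also have "\<dots> = (B / \<tau>) powr q * (\<Sum>P\<in>\<M>. enn2real (energy g P) powr (q / p))" by (simp add: sum_distrib_left)
  also have "(\<Sum>P\<in>\<M>. enn2real (energy g P) powr (q / p)) \<le> (\<Sum>P\<in>\<M>. enn2real (energy g P)) powr (q / p)"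
    by (rule sum_powr_le_powr_sum) (use q_ge_p p in \<open>auto simp: field_simps\<close>)
  also have "\<dots> \<le> enn2real (energy g Q) powr (q / p)"
    using energy_disjoint[OF g fin finM _ mx(1), of K] Mb badD p q by (intro powr_mono2 sum_nonneg) auto
  finally show ?thesis by (simp add: mult_left_mono)
qed

text \<open>Every pair of a point in {F > s'} and a point in {F <= s} contributes at least
  \<open>D\<close> to the double integral. This converts small oscillation into the product bound
  used in the stopping argument.\<close>

lemma osc_lower_bound:
  fixes F :: "real ^ 'n \<Rightarrow> real"
  assumes F[measurable]: "F \<in> borel_measurable borel" and g[measurable]: "g \<in> borel_measurable borel"
    and P: "P \<in> \<D> K" and D: "D > 0"
    and gap: "\<And>x y. F x > s' \<Longrightarrow> F y \<le> s \<Longrightarrow> D \<le> \<bar>g x - g y\<bar>"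
    and fin: "osc g P < \<infinity>"
  shows "D * m (P \<inter> {x. F x > s'}) * m (P \<inter> {x. F x \<le> s}) \<le> enn2real (osc g P)"
proof -
  obtain b t where bt: "t > 0" "P = hcube b t" by (rule dyadic_cubes_cube[OF l P])
  have Pb[measurable]: "P \<in> sets borel" unfolding bt(2) by simp
  let ?U = "P \<inter> {x. F x > s'}" and ?V = "P \<inter> {x. F x \<le> s}"
  have UVb: "?U \<in> sets borel" "?V \<in> sets borel" by measurable
  have UVf: "?U \<in> fmeasurable lebesgue" "?V \<in> fmeasurable lebesgue"
    by (rule fmeasurableI2[OF tree_family.fmeas[OF tree P]]; use UVb in auto)+
  have "ennreal (D * m ?U * m ?V) = ennreal D * (emeasure lborel ?U * emeasure lborel ?V)"
  proof -
    have "emeasure lborel ?U = ennreal (m ?U)" "emeasure lborel ?V = ennreal (m ?V)"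
      using emeasure_eq_measure2[OF UVf(1)] emeasure_eq_measure2[OF UVf(2)] UVb by simp_all
    then show ?thesis using D by (simp add: ennreal_mult' mult.assoc)
  qed
  also have "\<dots> = (\<integral>\<^sup>+x. (\<integral>\<^sup>+y. ennreal D * indicator ?U x * indicator ?V y \<partial>lborel) \<partial>lborel)"
    using UVb by (simp add: nn_integral_cmult nn_integral_multc mult.assoc)
  also have "\<dots> \<le> osc g P" unfolding osc_def
  proof (rule nn_integral_mono)
    fix x
    show "(\<integral>\<^sup>+y. ennreal D * indicator ?U x * indicator ?V y \<partial>lborel) \<le> (\<integral>\<^sup>+y\<in>P. ennreal \<bar>g x - g y\<bar> \<partial>lborel) * indicator P x"
    proof (cases "x \<in> ?U")
      case True
      have "(\<integral>\<^sup>+y. ennreal D * indicator ?U x * indicator ?V y \<partial>lborel) \<le> (\<integral>\<^sup>+y\<in>P. ennreal \<bar>g x - g y\<bar> \<partial>lborel)"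
        by (intro nn_integral_mono) (use True gap[of x] in \<open>auto simp: indicator_def intro!: ennreal_leI\<close>)
      then show ?thesis using True by simp
    qed simp
  qed
  also have "osc g P = ennreal (enn2real (osc g P))" using fin by simp
  finally show ?thesis by (simp add: ennreal_le_iff)
qed

lemma energy_layers:
  fixes F :: "real ^ 'n \<Rightarrow> real"
  assumes F[measurable]: "F \<in> borel_measurable borel" and t: "incseq t"
  shows "(\<Sum>k<M. energy (\<lambda>x. layer (t k) (t (Suc k)) (F x)) Q) \<le> energy F Q"
proof -
  let ?g = "\<lambda>k x. layer (t k) (t (Suc k)) (F x)"
  have g[measurable]: "?g k \<in> borel_measurable borel" for k unfolding layer_def by measurable
  have "(\<Sum>k<M. energy (?g k) Q) = (\<integral>\<^sup>+x. (\<Sum>k<M. gagliardo \<delta> p Q (?g k) x * ennreal (w x) * indicator Q x) \<partial>lebesgue)"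
    unfolding energy_def by (subst nn_integral_sum) (auto intro!: borel_measurable_times_ennreal gagliardo_meas g)
  also have "\<dots> \<le> energy F Q" unfolding energy_def
  proof (rule nn_integral_mono)
    fix x
    have "(\<Sum>k<M. gagliardo \<delta> p Q (?g k) x)
      = (\<integral>\<^sup>+y. (\<Sum>k<M. ennreal (\<bar>?g k x - ?g k y\<bar> powr p / norm (x - y) powr (real CARD('n) + \<delta> * p)) * indicator Q y) \<partial>lborel)"
      unfolding gagliardo_def by (subst nn_integral_sum) auto
    also have "\<dots> \<le> gagliardo \<delta> p Q F x" unfolding gagliardo_def
    proof (rule nn_integral_mono)
      fix y
      let ?d = "norm (x - y) powr (real CARD('n) + \<delta> * p)"
      have "(\<Sum>k<M. ennreal (\<bar>?g k x - ?g k y\<bar> powr p / ?d)) = ennreal ((\<Sum>k<M. \<bar>?g k x - ?g k y\<bar> powr p) / ?d)"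
        by (subst sum_ennreal) (auto simp: sum_divide_distrib)
      also have "\<dots> \<le> ennreal (\<bar>F x - F y\<bar> powr p / ?d)"
        by (intro ennreal_leI divide_right_mono sum_layer_powr t p) auto
      finally have "(\<Sum>k<M. ennreal (\<bar>?g k x - ?g k y\<bar> powr p / ?d)) * indicator Q y \<le> ennreal (\<bar>F x - F y\<bar> powr p / ?d) * indicator Q y"
        by (rule mult_right_mono) simp
      then show "(\<Sum>k<M. ennreal (\<bar>?g k x - ?g k y\<bar> powr p / ?d) * indicator Q y) \<le> ennreal (\<bar>F x - F y\<bar> powr p / ?d) * indicator Q y"
        by (simp only: sum_distrib_right)
    qed
    finally have "(\<Sum>k<M. gagliardo \<delta> p Q (?g k) x) * (ennreal (w x) * indicator Q x) \<le> gagliardo \<delta> p Q F x * (ennreal (w x) * indicator Q x)"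
      by (rule mult_right_mono) simp
    then show "(\<Sum>k<M. gagliardo \<delta> p Q (?g k) x * ennreal (w x) * indicator Q x) \<le> gagliardo \<delta> p Q F x * ennreal (w x) * indicator Q x"
      by (simp add: sum_distrib_right mult.assoc)
  qed
  finally show ?thesis .
qed

text \<open>One rung of the ladder: \<open>stopping_step\<close> outside the bad cubes,
  \<open>bad_measure\<close> on them. Using the truncation \<open>g\<close> instead of
  \<open>F\<close> charges only the energy between the two levels.\<close>

lemma level_step:
  fixes N :: nat and F :: "real ^ 'n \<Rightarrow> real"
  assumes F: "F \<in> borel_measurable borel"
    and g: "g = (\<lambda>x. layer t (t + real N * D) (F x))" and fin: "energy g Q < \<infinity>"
    and half: "m (Q0 \<inter> {x. F x > t}) \<le> m Q0 / 2" and D: "D > 0" and N: "N > 0"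
  shows "measure \<mu> (level_cover a l K F (t + real N * D))
    \<le> (2 * W / N) * measure \<mu> (level_cover a l K F t)
      + (B * (8 * 2 ^ CARD('n)) / D) powr q * enn2real (energy g Q) powr (q / p)"
proof -
  interpret tree_family lebesgue "\<D> K" Q0 "2 ^ CARD('n)" by (rule tree)
  have dense_union: "level_cover a l K F s = dense_union F s" for s by (simp add: level_cover_def)
  have g_meas: "g \<in> borel_measurable borel" unfolding g layer_def using F by measurable
  have F_leb: "F \<in> borel_measurable lebesgue" using F by (simp add: measurable_completion)
  \<comment> \<open>The threshold of \<open>stopping_step\<close> for d = 2^n.\<close>
  define \<tau> where "\<tau> = (1 / (8 * 2 ^ CARD('n))) * D"
  have \<tau>: "\<tau> > 0" unfolding \<tau>_def using D by simp
  have NQ: "Q0 \<notin> dense F t" unfolding dense_def using half by simp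
  have W0: "W \<ge> 0" using W(2) by simp
  \<comment> \<open>Both levels lie in the window from \<open>t\<close> to
    \<open>t + real N * D\<close>, where truncation preserves the gap: points above s' and below s
    differ by at least \<open>D\<close> also under \<open>g\<close>.\<close>
  have oscb: "D * m (P \<inter> {x. F x > s'}) * m (P \<inter> {x. F x \<le> s}) \<le> enn2real (osc g P)"
    if P: "P \<in> \<D> K" and s: "t \<le> s" "s' \<le> t + real N * D" "s' = s + D" for P s s'
    by (rule osc_lower_bound[OF F g_meas P D _ cube_oscillation(1)[OF g_meas fin P]])
      (use s D in \<open>auto simp: g layer_def\<close>)
  have "real N * measure \<mu> (dense_union F (t + real N * D) - \<Union>{P \<in> \<D> K. enn2real (osc g P) > 1 / (8 * 2 ^ CARD('n)) * D * (m P)\<^sup>2})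
    \<le> 2 * W * measure \<mu> (dense_union F t)"
    by (rule stopping_step[OF F_leb NQ D _ oscb sets_mu finite_mu,
          OF _ _ _ _ _ Ainf_Carleson[OF l w_meas weight_fin w_pos W(1) W0, folded \<mu>_def]]) auto
  then have "real N * measure \<mu> (dense_union F (t + real N * D) - \<Union>(bad K g \<tau>)) \<le> 2 * W * measure \<mu> (dense_union F t)"
    unfolding bad_def \<tau>_def .
  then have s1: "measure \<mu> (dense_union F (t + real N * D) - \<Union>(bad K g \<tau>)) \<le> (2 * W / N) * measure \<mu> (dense_union F t)"
    using N by (simp add: field_simps)
  have bs: "\<Union>(bad K g \<tau>) \<in> sets \<mu>"
    by (rule sets.finite_Union) (use finite_T fmeas sets_mu in \<open>auto simp: bad_def\<close>)
  have os: "dense_union F s \<in> sets \<mu>" for s using dense_union_sets sets_mu by auto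
  have "measure \<mu> (dense_union F (t + real N * D)) \<le> measure \<mu> ((dense_union F (t + real N * D) - \<Union>(bad K g \<tau>)) \<union> \<Union>(bad K g \<tau>))"
    by (rule \<mu>.finite_measure_mono) (use bs os in auto)
  also have "\<dots> \<le> measure \<mu> (dense_union F (t + real N * D) - \<Union>(bad K g \<tau>)) + measure \<mu> (\<Union>(bad K g \<tau>))"
    by (rule measure_Un_le) (use bs os in auto)
  also have "\<dots> \<le> (2 * W / N) * measure \<mu> (dense_union F t) + (B / \<tau>) powr q * enn2real (energy g Q) powr (q / p)"
    by (intro add_mono s1 bad_measure[OF g_meas fin \<tau>])
  also have "B / \<tau> = B * (8 * 2 ^ CARD('n)) / D" unfolding \<tau>_def using D by (simp add: field_simps)
  finally show ?thesis unfolding dense_union .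
qed

text \<open>Large enough that exp 1 * 2 W / N <= 1/2, as absorption requires. Since e <= 3 and W >=
  1, rounding up keeps it below 13 W.\<close>

definition N :: nat where "N = nat \<lceil>4 * exp 1 * W\<rceil>"

lemma N_bounds: "real N \<ge> 4 * exp 1 * W" "real N \<le> 13 * W" "N > 0"
proof -
  show a: "real N \<ge> 4 * exp 1 * W" unfolding N_def by linarith
  have "4 * exp 1 * W > 0" using W by simp
  then show "N > 0" using a by linarith
  have "real N \<le> 4 * exp 1 * W + 1" unfolding N_def using W by (smt (verit) \<open>4 * exp 1 * W > 0\<close> of_int_ceiling_le_add_one of_nat_nat zero_le_ceiling)
  also have "\<dots> \<le> 4 * 3 * W + 1 * W" using exp_le W by (intro add_mono mult_right_mono) auto
  finally show "real N \<le> 13 * W" by simp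
qed

text \<open>The bound for the bad cubes of all levels together: exp 1 comes from comparing
  consecutive levels, and q N is the ratio of a level to the gap chosen there.\<close>

definition total :: "(real ^ 'n \<Rightarrow> real) \<Rightarrow> real" where
  "total F = exp 1 * (8 * 2 ^ CARD('n) * B * q * N) powr q * enn2real (energy F Q) powr (q / p)"

lemma half_mono:
  fixes F :: "real ^ 'n \<Rightarrow> real"
  assumes F: "F \<in> borel_measurable borel" and half: "m (Q0 \<inter> {x. F x > 0}) \<le> m Q0 / 2" and t: "t \<ge> 0"
  shows "m (Q0 \<inter> {x. F x > t}) \<le> m Q0 / 2"
proof -
  have F_leb: "F \<in> borel_measurable lebesgue" using F by (simp add: measurable_completion)
  have "m (Q0 \<inter> {x. F x > t}) \<le> m (Q0 \<inter> {x. F x > 0})"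
    by (rule measure_mono_fmeasurable[OF _ fmeasurableD[OF tree_family.sets_level(1)[OF tree F_leb Q0_in]] tree_family.sets_level(1)[OF tree F_leb Q0_in]])
      (use t in auto)
  then show ?thesis using half by simp
qed

text \<open>With weights t_k^q the sparse part of \<open>level_step\<close> contracts by 1/2 and the
  bad part is independent of k apart from the energy of its truncation, so
  \<open>ladder_absorption\<close> applies.\<close>

lemma ladder_finite_depth:
  fixes F :: "real ^ 'n \<Rightarrow> real"
  assumes F: "F \<in> borel_measurable borel" and fin: "energy F Q < \<infinity>"
    and half: "m (Q0 \<inter> {x. F x > 0}) \<le> m Q0 / 2" and t0: "t0 > 0"
  defines "t \<equiv> \<lambda>k. t0 * (1 + 1 / q) ^ k"
  shows "(\<Sum>k<M. t k powr q * measure \<mu> (level_cover a l K F (t k))) \<le> 2 * (t0 powr q * measure \<mu> Q0) + 2 * total F"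
proof -
  define g where "g k = (\<lambda>x. layer (t k) (t (Suc k)) (F x))" for k
  let ?e = "\<lambda>k. enn2real (energy (g k) Q)"
  define a' where "a' k = t k powr q * measure \<mu> (level_cover a l K F (t k))" for k
  define c where "c = exp 1 * (8 * 2 ^ CARD('n) * B * q * N) powr q"
  define e where "e k = c * ?e k powr (q / p)" for k
  have tp: "t k > 0" for k unfolding t_def using t0 q by (simp add: add_pos_pos)
  have inc: "incseq t"
  proof (rule incseq_SucI)
    fix k show "t k \<le> t (Suc k)" using tp[of k] q unfolding t_def by (simp add: algebra_simps)
  qed
  have sumE: "(\<Sum>k<M. energy (g k) Q) \<le> energy F Q" for M
    unfolding g_def by (rule energy_layers[OF F inc])
  have finE: "energy (g k) Q < \<infinity>" for k
  proof -
    have "energy (g k) Q \<le> (\<Sum>j<Suc k. energy (g j) Q)" by simp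
    then show ?thesis using sumE[of "Suc k"] fin by (meson le_less_trans)
  qed
  have step: "a' (Suc k) \<le> a' k / 2 + e k" for k
  proof -
    \<comment> \<open>The difference t_(k+1) - t_k = t_k / q is cut into \<open>N\<close> equal
      parts; the ratio of t_k to this gap is the same for all k.\<close>
    let ?D = "t k / (q * N)"
    let ?b = "B * (8 * 2 ^ CARD('n)) / ?D"
    have D: "?D > 0" using tp q N_bounds by simp
    have tS: "t (Suc k) = t k + real N * ?D" unfolding t_def using q N_bounds by (simp add: field_simps)
    have "measure \<mu> (level_cover a l K F (t (Suc k))) \<le> (2 * W / N) * measure \<mu> (level_cover a l K F (t k))
      + ?b powr q * ?e k powr (q / p)"
      unfolding tS
      by (rule level_step[OF F _ finE half_mono[OF F half] D N_bounds(3)])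
        (use tp[of k] in \<open>auto simp: g_def tS\<close>)
    then have "a' (Suc k) \<le> t (Suc k) powr q * ((2 * W / N) * measure \<mu> (level_cover a l K F (t k))
      + ?b powr q * ?e k powr (q / p))"
      unfolding a'_def by (intro mult_left_mono) auto
    also have "\<dots> \<le> (exp 1 * t k powr q) * ((2 * W / N) * measure \<mu> (level_cover a l K F (t k))
      + ?b powr q * ?e k powr (q / p))"
    proof (rule mult_right_mono)
      have "t (Suc k) = (1 + 1 / q) * t k" unfolding t_def by simp
      then have "t (Suc k) powr q = (1 + 1 / q) powr q * t k powr q" using tp[of k] q by (simp add: powr_mult)
      also have "\<dots> \<le> exp 1 * t k powr q" using one_plus_inverse_powr_le[OF q] by (intro mult_right_mono) auto
      finally show "t (Suc k) powr q \<le> exp 1 * t k powr q" .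
    qed (use W in auto)
    also have "\<dots> = (exp 1 * 2 * W / N) * a' k + exp 1 * (t k powr q * ?b powr q) * ?e k powr (q / p)"
      unfolding a'_def by (simp add: algebra_simps)
    also have "t k powr q * ?b powr q = (8 * 2 ^ CARD('n) * B * q * N) powr q"
    proof -
      have "t k * ?b = 8 * 2 ^ CARD('n) * B * q * N"
        using tp[of k] by simp
      moreover have "t k powr q * ?b powr q = (t k * ?b) powr q"
        by (rule powr_mult[symmetric])
      ultimately show ?thesis by simp
    qed
    also have "(exp 1 * 2 * W / N) * a' k \<le> (1 / 2) * a' k"
    proof (rule mult_right_mono)
      show "exp 1 * 2 * W / N \<le> 1 / 2" using N_bounds by (simp add: field_simps)
    qed (simp add: a'_def)
    finally show ?thesis unfolding e_def c_def by simp
  qed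
  have sumE': "(\<Sum>k<M. ?e k) \<le> enn2real (energy F Q)"
  proof -
    have "ennreal (\<Sum>k<M. ?e k) = (\<Sum>k<M. energy (g k) Q)"
      using finE by (subst sum_ennreal[symmetric]) (auto intro!: sum.cong)
    also have "\<dots> \<le> ennreal (enn2real (energy F Q))" using sumE[of M] fin by simp
    finally show ?thesis by (simp add: ennreal_le_iff)
  qed
  have "(\<Sum>k<M. e k) \<le> total F"
  proof -
    have "(\<Sum>k<M. ?e k powr (q / p)) \<le> (\<Sum>k<M. ?e k) powr (q / p)"
      by (rule sum_powr_le_powr_sum) (use q_ge_p p in \<open>auto simp: field_simps\<close>)
    also have "\<dots> \<le> enn2real (energy F Q) powr (q / p)"
      using sumE' p q by (intro powr_mono2 sum_nonneg) auto
    finally show ?thesis unfolding e_def total_def c_def by (simp add: sum_distrib_left[symmetric] mult_left_mono)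
  qed
  then have "(\<Sum>k<M. a' k) \<le> 2 * a' 0 + 2 * total F"
    by (intro ladder_absorption[where a = a' and e = e, OF _ step]) (auto simp: a'_def)
  moreover have "a' 0 \<le> t0 powr q * measure \<mu> Q0"
  proof -
    have "measure \<mu> (level_cover a l K F (t 0)) \<le> measure \<mu> Q0"
      by (rule \<mu>.finite_measure_mono[OF level_cover_sub[OF l]]) (simp add: sets_mu)
    then show ?thesis unfolding a'_def t_def by (simp add: mult_left_mono)
  qed
  ultimately show ?thesis unfolding a'_def by simp
qed

text \<open>The bound at depth \<open>K\<close> does not depend on \<open>K\<close>, so it passes to
  the limit for each finite number of levels; by the density theorem the limiting covers contain the
  level sets up to null sets.\<close>

lemma ladder:
  fixes F :: "real ^ 'n \<Rightarrow> real"
  assumes F: "F \<in> borel_measurable borel" and fin: "energy F Q < \<infinity>"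
    and half: "m (Q0 \<inter> {x. F x > 0}) \<le> m Q0 / 2" and t0: "t0 > 0"
  defines "t \<equiv> \<lambda>k. t0 * (1 + 1 / q) ^ k"
  shows "(\<Sum>k<M. t k powr q * measure \<mu> (Q0 \<inter> {x. F x > t k})) \<le> 2 * (t0 powr q * measure \<mu> Q0) + 2 * total F"
proof -
  have F_leb: "F \<in> borel_measurable lebesgue" using F by (simp add: measurable_completion)
  have OS: "level_cover a l K F s \<in> sets \<mu>" for K s unfolding sets_mu by (rule level_cover_sets[OF l])
  have lim: "(\<lambda>K. measure \<mu> (level_cover a l K F s)) \<longlonglongrightarrow> measure \<mu> (\<Union>K. level_cover a l K F s)" for s
    by (rule \<mu>.finite_Lim_measure_incseq) (use OS in \<open>auto intro!: incseq_SucI level_cover_mono[OF l]\<close>)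
  have le: "measure \<mu> (Q0 \<inter> {x. F x > s}) \<le> measure \<mu> (\<Union>K. level_cover a l K F s)" for s
  proof (rule \<mu>.finite_measure_mono_AE)
    have "AE x in lebesgue. x \<in> Q0 \<inter> {x. F x > s} \<longrightarrow> x \<in> (\<Union>K. level_cover a l K F s)"
      using AE_in_level_cover[OF l F_leb, of a s] by eventually_elim auto
    then show "AE x in \<mu>. x \<in> Q0 \<inter> {x. F x > s} \<longrightarrow> x \<in> (\<Union>K. level_cover a l K F s)"
      unfolding \<mu>_def wmeasure_def by (subst AE_density) (auto elim: eventually_mono)
    show "(\<Union>K. level_cover a l K F s) \<in> sets \<mu>" using OS by auto
  qed
  have "(\<Sum>k<M. t k powr q * measure \<mu> (Q0 \<inter> {x. F x > t k})) \<le> (\<Sum>k<M. t k powr q * measure \<mu> (\<Union>K. level_cover a l K F (t k)))"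
    by (intro sum_mono mult_left_mono le) auto
  also have "\<dots> \<le> 2 * (t0 powr q * measure \<mu> Q0) + 2 * total F"
  proof (rule LIMSEQ_le_const2)
    show "(\<lambda>K. \<Sum>k<M. t k powr q * measure \<mu> (level_cover a l K F (t k))) \<longlonglongrightarrow> (\<Sum>k<M. t k powr q * measure \<mu> (\<Union>K. level_cover a l K F (t k)))"
      by (intro tendsto_sum tendsto_mult tendsto_const lim)
    show "\<exists>N. \<forall>K\<ge>N. (\<Sum>k<M. t k powr q * measure \<mu> (level_cover a l K F (t k))) \<le> 2 * (t0 powr q * measure \<mu> Q0) + 2 * total F"
      unfolding t_def using ladder_finite_depth[OF F fin half t0] by blast
  qed
  finally show ?thesis .
qed

text \<open>A discrete layer cake formula in which a single term suffices: if t_i < z <= t_(i+1),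
  then z^q <= (1 + 1/q)^q t_i^q <= e t_i^q.\<close>

lemma power_le_ladder_sum:
  fixes z :: real
  assumes t0: "t0 > 0"
  defines "t \<equiv> \<lambda>k. t0 * (1 + 1 / q) ^ k"
  shows "ennreal (max 0 z powr q) \<le> ennreal (t0 powr q) + (\<Sum>k. ennreal (exp 1 * t k powr q) * (if z > t k then 1 else 0))"
proof (cases "z \<le> t0")
  case True
  have "max 0 z powr q \<le> t0 powr q" using True t0 q by (intro powr_mono2) auto
  then have "ennreal (max 0 z powr q) \<le> ennreal (t0 powr q)" by (rule ennreal_leI)
  then show ?thesis by (rule order_trans) simp
next
  case False
  have "1 < 1 + 1 / q" using q by simp
  then obtain j where "z / t0 < (1 + 1 / q) ^ j" using real_arch_pow by blast
  then have ex: "\<exists>j. z \<le> t j" unfolding t_def using t0 by (auto simp: field_simps intro!: exI[of _ j])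
  define j where "j = (LEAST j. z \<le> t j)"
  have j: "z \<le> t j" unfolding j_def using ex by (rule LeastI_ex)
  have "j \<noteq> 0" using j False unfolding t_def by (cases j) auto
  then obtain i where i: "j = Suc i" by (cases j) auto
  have zi: "z > t i" using not_less_Least[of i "\<lambda>j. z \<le> t j"] unfolding j_def[symmetric] i by auto
  have ti: "t i > 0" unfolding t_def using t0 q by (simp add: add_pos_pos)
  have "max 0 z powr q \<le> ((1 + 1 / q) * t i) powr q"
    using j i ti zi q unfolding t_def by (intro powr_mono2) (auto simp: mult_ac)
  also have "\<dots> = (1 + 1 / q) powr q * t i powr q" using ti q by (simp add: powr_mult)
  also have "\<dots> \<le> exp 1 * t i powr q" using one_plus_inverse_powr_le[OF q] by (intro mult_right_mono) auto
  finally have "ennreal (max 0 z powr q) \<le> ennreal (exp 1 * t i powr q) * (if z > t i then 1 else 0)"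
    using zi by (simp add: ennreal_leI)
  also have "\<dots> = (\<Sum>k\<in>{i}. ennreal (exp 1 * t k powr q) * (if z > t k then 1 else 0))" by simp
  also have "\<dots> \<le> (\<Sum>k. ennreal (exp 1 * t k powr q) * (if z > t k then 1 else 0))"
    by (rule sum_le_suminf) auto
  finally show ?thesis by (rule order_trans) simp
qed

text \<open>The ladder inserted into the discrete layer cake formula. All that remains of the lowest
  level is a multiple of t0^q, which tends to 0 with t0.\<close>

lemma one_sided_bound:
  fixes F :: "real ^ 'n \<Rightarrow> real"
  assumes F: "F \<in> borel_measurable borel" and fin: "energy F Q < \<infinity>"
    and half: "m (Q0 \<inter> {x. F x > 0}) \<le> m Q0 / 2"
  shows "(\<integral>\<^sup>+x\<in>Q. ennreal (max 0 (F x) powr q) * ennreal (w x) \<partial>lebesgue) \<le> ennreal (2 * exp 1 * total F)"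
proof -
  have F_leb[measurable]: "F \<in> borel_measurable lebesgue" using F by (simp add: measurable_completion)
  have F_mu[measurable]: "F \<in> borel_measurable \<mu>" using F_leb measurable_cong_sets[OF sets_mu refl] by blast
  \<comment> \<open>The coefficient of t0^q: 1 from the values up to t0, and 2 e from the initial
    term of the ladder.\<close>
  define \<kappa> where "\<kappa> = (1 + 2 * exp 1) * measure \<mu> Q0"
  have \<kappa>: "\<kappa> > 0" unfolding \<kappa>_def using mu_pos[OF Q0_in[of 0]] by (simp add: add_pos_pos)
  let ?f = "\<lambda>x. ennreal (max 0 (F x) powr q)"
  have "(\<integral>\<^sup>+x\<in>Q. ?f x * ennreal (w x) \<partial>lebesgue) = (\<integral>\<^sup>+x\<in>Q0. ?f x * ennreal (w x) \<partial>lebesgue)"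
    by (rule nn_integral_hcube[OF l, symmetric])
  also have "\<dots> = (\<integral>\<^sup>+x. (ennreal (w x) * indicator Q0 x) * (?f x * indicator Q0 x) \<partial>lebesgue)"
    by (intro nn_integral_cong) (auto simp: indicator_def mult.commute)
  also have "\<dots> = (\<integral>\<^sup>+x. ?f x * indicator Q0 x \<partial>\<mu>)"
    unfolding \<mu>_def wmeasure_def by (rule nn_integral_density[symmetric]) measurable
  finally have eq: "(\<integral>\<^sup>+x\<in>Q. ?f x * ennreal (w x) \<partial>lebesgue) = (\<integral>\<^sup>+x. ?f x * indicator Q0 x \<partial>\<mu>)" .
  have Q0mu[measurable]: "Q0 \<in> sets \<mu>" by (simp add: sets_mu)
  have bound: "(\<integral>\<^sup>+x. ?f x * indicator Q0 x \<partial>\<mu>) \<le> ennreal (2 * exp 1 * total F) + ennreal (t0 powr q * \<kappa>)"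
    if t0: "t0 > 0" for t0
  proof -
    define t where "t k = t0 * (1 + 1 / q) ^ k" for k
    let ?S = "\<lambda>k. Q0 \<inter> {x. F x > t k}" and ?c = "\<lambda>k. ennreal (exp 1 * t k powr q)"
    let ?b = "2 * (t0 powr q * measure \<mu> Q0) + 2 * total F"
    have S: "?S k \<in> sets \<mu>" for k
      unfolding sets_mu by (rule fmeasurableD[OF tree_family.sets_level(1)[OF tree F_leb Q0_in]])
    have "(\<integral>\<^sup>+x. ?f x * indicator Q0 x \<partial>\<mu>)
      \<le> (\<integral>\<^sup>+x. ennreal (t0 powr q) * indicator Q0 x + (\<Sum>k. ?c k * indicator (?S k) x) \<partial>\<mu>)"
    proof (rule nn_integral_mono)
      fix x
      show "?f x * indicator Q0 x \<le> ennreal (t0 powr q) * indicator Q0 x + (\<Sum>k. ?c k * indicator (?S k) x)"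
      proof (cases "x \<in> Q0")
        case True
        then have "indicator (?S k) x = (if F x > t k then 1 else (0::ennreal))" for k by simp
        then show ?thesis using True power_le_ladder_sum[OF t0, of "F x"] unfolding t_def by simp
      qed simp
    qed
    also have "\<dots> = ennreal (t0 powr q) * emeasure \<mu> Q0 + (\<Sum>k. ?c k * emeasure \<mu> (?S k))"
      using S by (subst nn_integral_add) (auto simp: nn_integral_suminf nn_integral_cmult_indicator)
    also have "(\<Sum>k. ?c k * emeasure \<mu> (?S k)) \<le> ennreal (exp 1 * ?b)"
      unfolding suminf_eq_SUP
    proof (rule SUP_least)
      fix M
      have "(\<Sum>k<M. ?c k * emeasure \<mu> (?S k))
        = ennreal (exp 1 * (\<Sum>k<M. t k powr q * measure \<mu> (?S k)))"
        unfolding \<mu>.emeasure_eq_measure sum_distrib_left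
        by (subst sum_ennreal[symmetric]) (auto simp: ennreal_mult' mult.assoc intro!: sum.cong)
      also have "\<dots> \<le> ennreal (exp 1 * ?b)"
        using ladder[OF F fin half t0, of M] unfolding t_def by (intro ennreal_leI mult_left_mono) auto
      finally show "(\<Sum>k<M. ?c k * emeasure \<mu> (?S k)) \<le> ennreal (exp 1 * ?b)" .
    qed
    also have "ennreal (t0 powr q) * emeasure \<mu> Q0 + ennreal (exp 1 * ?b)
      = ennreal (t0 powr q * measure \<mu> Q0 + exp 1 * ?b)"
      unfolding \<mu>.emeasure_eq_measure using q B_pos by (simp add: ennreal_plus ennreal_mult' total_def)
    also have "t0 powr q * measure \<mu> Q0 + exp 1 * ?b = 2 * exp 1 * total F + t0 powr q * \<kappa>"
      unfolding \<kappa>_def by (simp add: algebra_simps)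
    also have "ennreal \<dots> = ennreal (2 * exp 1 * total F) + ennreal (t0 powr q * \<kappa>)"
      by (rule ennreal_plus) (use \<kappa> in \<open>auto simp: total_def\<close>)
    finally show ?thesis by (simp add: add_left_mono)
  qed
  show ?thesis unfolding eq
  proof (rule ennreal_le_epsilon)
    fix e :: real assume e: "0 < e"
    \<comment> \<open>This is the choice of t0 for which the error is exactly e.\<close>
    have "((e / \<kappa>) powr (1 / q)) powr q * \<kappa> = e" using e \<kappa> q by (simp add: powr_powr)
    then show "(\<integral>\<^sup>+x. ?f x * indicator Q0 x \<partial>\<mu>) \<le> ennreal (2 * exp 1 * total F) + ennreal e"
      using bound[of "(e / \<kappa>) powr (1 / q)"] e \<kappa> by simp
  qed
qed

text \<open>With \<open>c\<close> a median, both f - c and c - f are positive on at most half of the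
  cube, and both have the energy of f. Adding the two one-sided bounds doubles the constant.\<close>

lemma two_sided_bound:
  fixes f :: "real ^ 'n \<Rightarrow> real"
  assumes f[measurable]: "f \<in> borel_measurable borel" and fin: "energy f Q < \<infinity>"
  shows "\<exists>c. (\<integral>\<^sup>+x\<in>Q. ennreal (\<bar>f x - c\<bar> powr q) * ennreal (w x) \<partial>lebesgue) \<le> ennreal (4 * exp 1 * total f)"
proof -
  let ?p = "\<lambda>F x. ennreal (max 0 (F x) powr q) * ennreal (w x)"
  have f_leb[measurable]: "f \<in> borel_measurable lebesgue" using f by (simp add: measurable_completion)
  obtain c where c: "m (Q0 \<inter> {x. f x > c}) \<le> m Q0 / 2" "m (Q0 \<inter> {x. f x < c}) \<le> m Q0 / 2"
    using exists_median[OF tree_family.fmeas[OF tree Q0_in] f_leb tree_family.pos[OF tree Q0_in]] by blast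
  define F1 where "F1 x = f x - c" for x
  define F2 where "F2 x = c - f x" for x
  have [measurable]: "F1 \<in> borel_measurable borel" "F2 \<in> borel_measurable borel"
    unfolding F1_def F2_def by measurable
  have [measurable]: "F1 \<in> borel_measurable lebesgue" "F2 \<in> borel_measurable lebesgue"
    unfolding F1_def F2_def by measurable
  have e1: "energy F1 Q = energy f Q" unfolding energy_def gagliardo_def F1_def by simp
  have e2: "energy F2 Q = energy f Q" unfolding energy_def gagliardo_def F2_def by (simp add: abs_minus_commute)
  have b1: "(\<integral>\<^sup>+x\<in>Q. ?p F1 x \<partial>lebesgue) \<le> ennreal (2 * exp 1 * total f)"
    using one_sided_bound[of F1] e1 fin c by (simp add: total_def F1_def)
  have b2: "(\<integral>\<^sup>+x\<in>Q. ?p F2 x \<partial>lebesgue) \<le> ennreal (2 * exp 1 * total f)"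
    using one_sided_bound[of F2] e2 fin c by (simp add: total_def F2_def)
  have "(\<integral>\<^sup>+x\<in>Q. ennreal (\<bar>f x - c\<bar> powr q) * ennreal (w x) \<partial>lebesgue)
    \<le> (\<integral>\<^sup>+x. ?p F1 x * indicator Q x + ?p F2 x * indicator Q x \<partial>lebesgue)"
  proof (rule nn_integral_mono)
    fix x
    have "\<bar>f x - c\<bar> powr q \<le> max 0 (F1 x) powr q + max 0 (F2 x) powr q"
      unfolding F1_def F2_def by (cases "f x \<ge> c") auto
    then have "ennreal (\<bar>f x - c\<bar> powr q) \<le> ennreal (max 0 (F1 x) powr q + max 0 (F2 x) powr q)" by (rule ennreal_leI)
    also have "\<dots> = ennreal (max 0 (F1 x) powr q) + ennreal (max 0 (F2 x) powr q)" by (rule ennreal_plus) auto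
    finally have "ennreal (\<bar>f x - c\<bar> powr q) * (ennreal (w x) * indicator Q x)
      \<le> (ennreal (max 0 (F1 x) powr q) + ennreal (max 0 (F2 x) powr q)) * (ennreal (w x) * indicator Q x)"
      by (rule mult_right_mono) simp
    then show "ennreal (\<bar>f x - c\<bar> powr q) * ennreal (w x) * indicator Q x
      \<le> ?p F1 x * indicator Q x + ?p F2 x * indicator Q x"
      by (simp only: distrib_right mult.assoc)
  qed
  also have "\<dots> = (\<integral>\<^sup>+x\<in>Q. ?p F1 x \<partial>lebesgue) + (\<integral>\<^sup>+x\<in>Q. ?p F2 x \<partial>lebesgue)"
    by (rule nn_integral_add) measurable
  also have "\<dots> \<le> ennreal (2 * exp 1 * total f) + ennreal (2 * exp 1 * total f)" by (rule add_mono[OF b1 b2])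
  also have "\<dots> = ennreal (4 * exp 1 * total f)"
    by (subst ennreal_plus[symmetric]) (auto simp: total_def)
  finally show ?thesis by blast
qed

lemma poincare_sobolev:
  fixes f :: "real ^ 'n \<Rightarrow> real"
  assumes f: "f \<in> borel_measurable borel" and fin: "energy f Q < \<infinity>"
  shows "\<exists>c. ((\<integral>\<^sup>+x\<in>Q. ennreal (\<bar>f x - c\<bar> powr q) * ennreal (w x) \<partial>lebesgue) / weight_of w Q) ennpowr (1 / q)
    \<le> ennreal (416 * exp 1 ^ 2 * 2 ^ CARD('n) * c0 * q * A powr (1 / p) * Ar powr (\<delta> / (real CARD('n) * r)) * W
        * ((1 - \<delta>) powr (1 / p) * l powr \<delta>) * (enn2real (energy f Q) / measure \<mu> Q0) powr (1 / p))"
proof -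
  let ?I = "\<lambda>c. \<integral>\<^sup>+x\<in>Q. ennreal (\<bar>f x - c\<bar> powr q) * ennreal (w x) \<partial>lebesgue"
  define e where "e = enn2real (energy f Q)"
  define \<omega> where "\<omega> = measure \<mu> Q0"
  define \<tau> where "\<tau> = \<delta> / (real CARD('n) * r)"
  define k where "k = 8 * 2 ^ CARD('n) * B * q * N"
  have \<omega>: "\<omega> > 0" unfolding \<omega>_def by (rule mu_pos[OF Q0_in])
  have e0: "e \<ge> 0" unfolding e_def by simp
  have k0: "k > 0" unfolding k_def using B_pos q N_bounds by simp
  have wQ: "weight_of w Q = ennreal \<omega>"
    using weight_mu[OF Q0_in] weight_of_hcube[OF l, of w a] unfolding \<omega>_def by simp
  obtain c where c: "?I c \<le> ennreal (4 * exp 1 * total f)"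
    using two_sided_bound[OF f fin] by blast
  have tot: "total f = exp 1 * k powr q * e powr (q / p)" unfolding total_def k_def e_def ..
  have "(?I c / weight_of w Q) ennpowr (1 / q)
    \<le> (ennreal (4 * exp 1 * total f) / ennreal \<omega>) ennpowr (1 / q)"
    unfolding wQ by (intro ennpowr_mono divide_right_mono_ennreal c) (use q in simp)
  also have "\<dots> = ennreal ((4 * exp 1 * total f / \<omega>) powr (1 / q))"
    using \<omega> by (subst divide_ennreal) (auto simp: ennpowr_ennreal tot)
  also have "\<dots> \<le> ennreal (416 * exp 1 ^ 2 * 2 ^ CARD('n) * c0 * q * A powr (1 / p) * Ar powr \<tau> * W
        * ((1 - \<delta>) powr (1 / p) * l powr \<delta>) * (e / \<omega>) powr (1 / p))"
  proof (rule ennreal_leI)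
    have "(4 * exp 1 * total f / \<omega>) powr (1 / q) = (4 * exp 1 ^ 2) powr (1 / q) * k * (e powr (1 / p) * \<omega> powr (- (1 / q)))"
    proof -
      have qp: "q * (inverse p * inverse q) = inverse p" using q by simp
      show ?thesis unfolding tot using q k0 \<omega> p
      by (simp add: qp powr_mult powr_divide powr_powr powr_minus divide_inverse inverse_powr power2_eq_square mult_ac)
    qed
    \<comment> \<open>As q >= p >= 1, the root of the numerical factor is at most the factor itself.
      The constant 416 is 4 * 8 * 13, with 13 from the upper bound for \<open>N\<close>.\<close>
    also have "\<dots> \<le> (4 * exp 1 ^ 2) * (8 * 2 ^ CARD('n) * B * q * (13 * W)) * (e powr (1 / p) * \<omega> powr (- (1 / q)))"
    proof (intro mult_right_mono mult_mono)
      have "(1::real) \<le> exp 1 ^ 2" by (rule one_le_power) simp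
      then have "(1::real) \<le> 4 * exp 1 ^ 2" by linarith
      then have "(4 * exp 1 ^ 2 :: real) powr (1 / q) \<le> (4 * exp 1 ^ 2) powr 1"
        using q_ge_p p q by (intro powr_mono) auto
      then show "(4 * exp 1 ^ 2 :: real) powr (1 / q) \<le> 4 * exp 1 ^ 2" by simp
      show "k \<le> 8 * 2 ^ CARD('n) * B * q * (13 * W)"
        unfolding k_def using N_bounds B_pos q by (intro mult_left_mono) auto
    qed (use k0 in auto)
    also have "\<dots> = 416 * exp 1 ^ 2 * 2 ^ CARD('n) * c0 * q * A powr (1 / p) * Ar powr \<tau> * W
        * ((1 - \<delta>) powr (1 / p) * l powr \<delta>) * (e powr (1 / p) * (\<omega> powr (- \<tau>) * \<omega> powr (- (1 / q))))"
    proof -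
      have "(Ar / \<omega>) powr \<tau> = Ar powr \<tau> * \<omega> powr (- \<tau>)"
        using Ar(2) \<omega> by (simp add: powr_divide powr_minus_divide)
      then show ?thesis
        unfolding B_def \<omega>_def[symmetric] \<tau>_def[symmetric] by (simp only: mult_ac)
    qed
    \<comment> \<open>The weight of the cube enters through \<open>B\<close> and through the
      normalisation of the left side; the exponent relation merges the two into the normalisation of
      the energy.\<close>
    also have "\<omega> powr (- \<tau>) * \<omega> powr (- (1 / q)) = \<omega> powr (- (1 / p))"
    proof -
      have "- \<tau> + - (1 / q) = - (1 / p)" using pq unfolding \<tau>_def by linarith
      then show ?thesis by (simp add: powr_add[symmetric])
    qed
    also have "e powr (1 / p) * \<omega> powr (- (1 / p)) = (e / \<omega>) powr (1 / p)"
      using e0 \<omega> by (simp add: powr_divide powr_minus_divide)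
    finally show "(4 * exp 1 * total f / \<omega>) powr (1 / q) \<le> 416 * exp 1 ^ 2 * 2 ^ CARD('n) * c0 * q * A powr (1 / p) * Ar powr \<tau> * W
        * ((1 - \<delta>) powr (1 / p) * l powr \<delta>) * (e / \<omega>) powr (1 / p)" .
  qed
  finally show ?thesis unfolding e_def \<omega>_def \<tau>_def by blast
qed

end

section \<open>The theorem\<close>

lemma locally_integrable_measurable:
  fixes f :: "real ^ 'n \<Rightarrow> real"
  assumes "locally_integrable f"
  shows "f \<in> borel_measurable lebesgue"
proof (rule borel_measurable_LIMSEQ_real)
  let ?K = "\<lambda>k::nat. cball (0 :: real ^ 'n) (real k)"
  show "(\<lambda>x. indicator (?K k) x *\<^sub>R f x) \<in> borel_measurable lebesgue" for k
    using assms unfolding locally_integrable_def set_integrable_def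
    by (intro borel_measurable_integrable) (use compact_cball in blast)
  fix x :: "real ^ 'n"
  obtain j :: nat where "norm x \<le> real j" using real_arch_simple by blast
  then have "indicator (?K k) x *\<^sub>R f x = f x" if "k \<ge> j" for k
    using that by (auto simp: indicator_def)
  then show "(\<lambda>k. indicator (?K k) x *\<^sub>R f x) \<longlonglongrightarrow> f x"
    by (intro tendsto_eventually) (auto simp: eventually_sequentially)
qed

section \<open>Finiteness and positivity of the constants, and functions of zero energy\<close>

lemma weight_of_cube_finite:
  fixes w :: "real ^ 'n \<Rightarrow> real"
  assumes "locally_integrable w"
  shows "weight_of w (cube a l) < \<infinity>"
proof -
  have "compact (cube a l)" unfolding cube_def by (rule compact_cbox)
  then have i: "integrable lebesgue (\<lambda>x. indicator (cube a l) x *\<^sub>R w x)"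
    using assms unfolding locally_integrable_def set_integrable_def by blast
  have "weight_of w (cube a l) \<le> (\<integral>\<^sup>+x. ennreal (norm (indicator (cube a l) x *\<^sub>R w x)) \<partial>lebesgue)"
    unfolding weight_of_def by (intro nn_integral_mono) (auto simp: indicator_def intro!: ennreal_leI)
  also have "\<dots> < \<infinity>" using i unfolding integrable_iff_bounded by blast
  finally show ?thesis .
qed

text \<open>At each point of the cube the maximal function of 1_Q w is at least the average of w
  over that cube.\<close>

lemma Ainf_const_ge_1:
  fixes w :: "real ^ 'n \<Rightarrow> real"
  assumes l: "l > 0" and fin: "weight_of w (cube a l) < \<infinity>" and pos: "weight_of w (cube a l) \<noteq> 0"
  shows "Ainf_const w \<ge> 1"
proof -
  let ?Q = "cube a l"
  let ?M = "maximal (\<lambda>y. indicator ?Q y * w y)" and ?a = "weight_of w ?Q / ennreal (l ^ CARD('n))"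
  have Qc: "?Q \<in> cubes" unfolding cubes_def using l by blast
  have L: "l ^ CARD('n) > 0" using l by simp
  have "weight_of w ?Q = ennreal (l ^ CARD('n)) * ?a"
    by (rule ennreal_divide_mult_cancel[OF L])
  also have "\<dots> = (\<integral>\<^sup>+x\<in>?Q. ?a \<partial>lebesgue)"
    using emeasure_cube[of l a] l by (subst nn_integral_cmult_indicator) (auto simp: mult.commute)
  also have "\<dots> \<le> (\<integral>\<^sup>+x\<in>?Q. ?M x \<partial>lebesgue)"
  proof (intro nn_integral_mono)
    fix x
    have "?a \<le> ?M x" if x: "x \<in> ?Q"
    proof -
      have "?a \<le> average ?Q (\<lambda>y. \<bar>indicator ?Q y * w y\<bar>)"
        unfolding average_cube[OF l] weight_of_def
        by (intro divide_right_mono_ennreal nn_integral_mono) (auto simp: indicator_def intro!: ennreal_leI)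
      also have "\<dots> \<le> ?M x"
        unfolding maximal_def by (rule SUP_upper) (use Qc x in auto)
      finally show ?thesis .
    qed
    then show "?a * indicator ?Q x \<le> ?M x * indicator ?Q x"
      by (auto simp: indicator_def)
  qed
  finally have "weight_of w ?Q / weight_of w ?Q \<le> (\<integral>\<^sup>+x\<in>?Q. ?M x \<partial>lebesgue) / weight_of w ?Q"
    by (rule divide_right_mono_ennreal)
  also have "\<dots> \<le> Ainf_const w" unfolding Ainf_const_def by (rule SUP_upper[OF Qc])
  finally show ?thesis using fin pos by simp
qed

lemma weight_of_cube_nonzero:
  fixes w :: "real ^ 'n \<Rightarrow> real"
  assumes "l > 0" "w \<in> borel_measurable lebesgue" "AE x in lebesgue. w x > 0"
  shows "weight_of w (cube a l) \<noteq> 0"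
  by (rule weight_of_nonzero[OF assms(2) _ assms(3)]) (use emeasure_cube[of l a] assms(1) in auto)

text \<open>Tested with the constant function 1 on the unit cube. Positivity matters because 0 times
  infinity is 0: a vanishing constant could hide an infinite factor on the right side of the
  theorem.\<close>

lemma Ap_const_nonzero:
  fixes w :: "real ^ 'n \<Rightarrow> real"
  assumes w: "w \<in> borel_measurable lebesgue" and wp: "AE x in lebesgue. w x > 0" and p: "p \<ge> 1"
  shows "Ap_const p w \<noteq> 0"
proof
  assume A0: "Ap_const p w = 0"
  let ?Q = "cube (0 :: real ^ 'n) 1"
  have "(\<integral>\<^sup>+x\<in>?Q. 1 \<partial>lebesgue) ennpowr p * weight_of w ?Q
    \<le> Ap_const p w * (ennreal (1 ^ CARD('n)) ennpowr p) * (\<integral>\<^sup>+x\<in>?Q. (1 ennpowr p) * ennreal (w x) \<partial>lebesgue)"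
    by (rule Ap_weighted_mean[OF wp p zero_less_one w]) simp
  moreover have "(\<integral>\<^sup>+x\<in>?Q. 1 \<partial>lebesgue) = 1" using emeasure_cube[of 1 "0 :: real ^ 'n"] by simp
  ultimately have "weight_of w ?Q = 0" using A0 by simp
  then show False using weight_of_cube_nonzero[OF zero_less_one w wp] by blast
qed

text \<open>One point \<open>x0\<close> with vanishing inner integral is enough, since it forces f =
  f(x0) almost everywhere on the cube.\<close>

lemma gagliardo_zero_constant:
  fixes f w :: "real ^ 'n \<Rightarrow> real"
  assumes f[measurable]: "f \<in> borel_measurable borel" and w[measurable]: "w \<in> borel_measurable lebesgue"
    and wp: "AE x in lebesgue. w x > 0" and l: "l > 0"
    and zero: "(\<integral>\<^sup>+x\<in>cube a l. gagliardo \<delta> p (cube a l) f x * ennreal (w x) \<partial>lebesgue) = 0"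
  shows "\<exists>c. AE x in lebesgue. x \<in> cube a l \<longrightarrow> f x = c"
proof -
  let ?Q = "cube a l"
  have Qs[measurable]: "?Q \<in> sets lebesgue" by simp
  have G[measurable]: "gagliardo \<delta> p ?Q f \<in> borel_measurable lebesgue"
    by (rule measurable_completion) (simp add: gagliardo_measurable f)
  have "AE x in lebesgue. gagliardo \<delta> p ?Q f x * ennreal (w x) * indicator ?Q x = 0"
    using zero by (subst (asm) nn_integral_0_iff_AE) auto
  with wp have ae: "AE x in lebesgue. x \<in> ?Q \<longrightarrow> gagliardo \<delta> p ?Q f x = 0"
    by eventually_elim auto
  have "\<exists>x0. x0 \<in> ?Q \<and> gagliardo \<delta> p ?Q f x0 = 0"
  proof (rule ccontr)
    assume "\<not> ?thesis"
    then have "AE x in lebesgue. x \<notin> ?Q" using ae by (auto elim: eventually_mono)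
    then have "emeasure lebesgue ?Q = 0" by (subst (asm) AE_iff_measurable[of ?Q]) auto
    then show False using emeasure_cube[of l a] l by simp
  qed
  then obtain x0 where x0: "x0 \<in> ?Q" "gagliardo \<delta> p ?Q f x0 = 0" by blast
  have "AE y in lborel. ennreal (\<bar>f x0 - f y\<bar> powr p / norm (x0 - y) powr (real CARD('n) + \<delta> * p)) * indicator ?Q y = 0"
    using x0(2) unfolding gagliardo_def by (subst (asm) nn_integral_0_iff_AE) auto
  then have "AE y in lborel. y \<in> ?Q \<longrightarrow> f y = f x0"
  proof eventually_elim
    case (elim y)
    show ?case
    proof (cases "y = x0")
      case False
      then have "norm (x0 - y) powr (real CARD('n) + \<delta> * p) > 0" by simp
      then show ?thesis using elim by (auto simp: ennreal_eq_0_iff divide_le_0_iff)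
    qed simp
  qed
  then show ?thesis by (intro exI[of _ "f x0"]) (rule AE_completion)
qed

lemma weighted_fractional_poincare:
  fixes f w :: "real ^ 'n \<Rightarrow> real" and a :: "real ^ 'n"
  assumes \<delta>: "0 < \<delta>" "\<delta> < 1" and r: "1 \<le> r" "r \<le> p" and pn: "p < real CARD('n) / \<delta>"
    and f: "f \<in> borel_measurable borel" and w: "w \<in> Ap r"
    and pq: "1 / p - 1 / q = \<delta> / (real CARD('n) * r)" and l: "l > 0"
  defines "Q \<equiv> cube a l"
  shows "(INF c::real. ((\<integral>\<^sup>+x\<in>Q. ennreal (\<bar>f x - c\<bar> powr q) * ennreal (w x) \<partial>lebesgue)
                          / weight_of w Q) ennpowr (1 / q))
    \<le> ennreal ((416 * exp 1 ^ 2 * 2 ^ CARD('n) * (8 * 2 ^ CARD('n) * real CARD('n) ^ (CARD('n) + 1))) * q) * Ap_const p w ennpowr (1 / p)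
        * Ap_const r w ennpowr (\<delta> / (real CARD('n) * r)) * Ainf_const w
        * ennreal ((1 - \<delta>) powr (1 / p) / \<delta> powr (1 - 1 / p) * l powr \<delta>)
        * ((\<integral>\<^sup>+x\<in>Q. gagliardo \<delta> p Q f x * ennreal (w x) \<partial>lebesgue) / weight_of w Q) ennpowr (1 / p)"
    (is "?L \<le> ennreal (?C * q) * ?Ap * ?Ar * Ainf_const w * ennreal ?k * ?E")
proof -
  let ?I = "\<lambda>c. \<integral>\<^sup>+x\<in>Q. ennreal (\<bar>f x - c\<bar> powr q) * ennreal (w x) \<partial>lebesgue"
  let ?t = "\<delta> / (real CARD('n) * r)"
  have p1: "p \<ge> 1" using r by simp
  have n1: "real CARD('n) \<ge> 1" by (simp add: Suc_leI)
  \<comment> \<open>The assumption p < n/\<delta> with r >= 1 makes 1/q positive.\<close>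
  have q: "q > 0"
  proof -
    have "\<delta> / (real CARD('n) * r) \<le> \<delta> / real CARD('n)"
      using \<delta> r n1 by (intro divide_left_mono) (auto simp: mult_le_cancel_left1)
    also have "\<dots> < 1 / p" using pn p1 \<delta> n1 by (simp add: field_simps)
    finally have "1 / q > 0" using pq by linarith
    then show ?thesis by simp
  qed
  have wloc: "locally_integrable w" and wp: "AE x in lebesgue. w x > 0" and Arf: "Ap_const r w < \<infinity>"
    using w unfolding Ap_def weight_def by auto
  have wm[measurable]: "w \<in> borel_measurable lebesgue" by (rule locally_integrable_measurable[OF wloc])
  have wf: "weight_of w Q < \<infinity>" unfolding Q_def by (rule weight_of_cube_finite[OF wloc])
  have w0: "weight_of w Q \<noteq> 0" unfolding Q_def by (rule weight_of_cube_nonzero[OF l wm wp])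
  have A0: "Ap_const p w \<noteq> 0" by (rule Ap_const_nonzero[OF wm wp p1])
  have Ar0: "Ap_const r w \<noteq> 0" by (rule Ap_const_nonzero[OF wm wp r(1)])
  have W1: "Ainf_const w \<ge> 1" unfolding Q_def by (rule Ainf_const_ge_1[OF l]) (use wf w0 in \<open>auto simp: Q_def\<close>)
  have C: "?C > 0" by simp
  have k: "?k > 0" using \<delta> l by simp
  define E where "E = (\<integral>\<^sup>+x\<in>Q. gagliardo \<delta> p Q f x * ennreal (w x) \<partial>lebesgue)"
  \<comment> \<open>With 0 times infinity equal to 0, zero energy makes the right side 0 whatever
    the constants, so the left side must vanish. If the energy is nonzero and some factor is
    infinite, the right side is infinite because no factor is zero.\<close>
  consider "E = 0" | "E \<noteq> 0" "E = \<infinity> \<or> Ap_const p w = \<infinity> \<or> Ainf_const w = \<infinity>"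
    | "E < \<infinity>" "Ap_const p w < \<infinity>" "Ainf_const w < \<infinity>"
    unfolding infinity_ennreal_def less_top[symmetric] by blast
  then show ?thesis
  proof cases
    case 1
    then obtain c where c: "AE x in lebesgue. x \<in> Q \<longrightarrow> f x = c"
      using gagliardo_zero_constant[OF f wm wp l] unfolding E_def Q_def by blast
    have "?I c = (\<integral>\<^sup>+x. 0 \<partial>(lebesgue :: (real ^ 'n) measure))"
      by (rule nn_integral_cong_AE, use c in eventually_elim) (auto simp: indicator_def)
    then have "(?I c / weight_of w Q) ennpowr (1 / q) = 0"
      by simp
    then have "?L \<le> 0" by (metis (lifting) INF_lower UNIV_I)
    then show ?thesis by simp
  next
    case 2
    have E0: "E / weight_of w Q \<noteq> 0" using 2(1) wf by (simp add: ennreal_divide_eq_0_iff less_top)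
    have Ei: "E / weight_of w Q = \<infinity>" if "E = \<infinity>" using that wf by (simp add: ennreal_top_divide less_top)
    have W0: "Ainf_const w \<noteq> 0" using W1 by auto
    have "ennreal (?C * q) * ?Ap * ?Ar * Ainf_const w * ennreal ?k * ?E = \<infinity>"
      unfolding E_def[symmetric]
      using 2(2) Ei E0 A0 Ar0 W0 C q k by (auto simp: ennreal_mult_eq_top_iff)
    then show ?thesis by simp
  next
    case 3
    obtain A where A: "Ap_const p w = ennreal A" "A > 0" using 3(2) A0 by (cases "Ap_const p w") (auto simp: less_le)
    obtain Ar where Ar: "Ap_const r w = ennreal Ar" "Ar > 0" using Arf Ar0 by (cases "Ap_const r w") (auto simp: less_le)
    obtain W where W: "Ainf_const w = ennreal W" "W \<ge> 1" using 3(3) W1 by (cases "Ainf_const w") auto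
    have W0: "0 \<le> W" using W(2) by simp
    interpret weighted_cube a l \<delta> p q r A Ar W w
      by unfold_locales (use l \<delta> r p1 q pq wm wp wf A Ar W in \<open>auto simp: Q_def\<close>)
    let ?e = "(enn2real E / measure \<mu> (hcube a l)) powr (1 / p)"
    have en: "energy f Q = E" unfolding energy_def E_def Q_def ..
    have wQ: "weight_of w Q = ennreal (measure \<mu> (hcube a l))"
      using weight_mu[OF Q0_in] weight_of_hcube[OF l, of w a] unfolding Q_def by simp
    have mu0: "measure \<mu> (hcube a l) > 0" by (rule mu_pos[OF Q0_in])
    obtain c where c: "(?I c / weight_of w Q) ennpowr (1 / q)
      \<le> ennreal (416 * exp 1 ^ 2 * 2 ^ CARD('n) * c0 * q * A powr (1 / p) * Ar powr ?t * W
        * ((1 - \<delta>) powr (1 / p) * l powr \<delta>) * ?e)"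
      using poincare_sobolev[OF f] 3(1) en unfolding Q_def by auto
    have "?L \<le> (?I c / weight_of w Q) ennpowr (1 / q)"
      by (rule INF_lower) simp
    also note c
    also have "ennreal (416 * exp 1 ^ 2 * 2 ^ CARD('n) * c0 * q * A powr (1 / p) * Ar powr ?t * W
        * ((1 - \<delta>) powr (1 / p) * l powr \<delta>) * ?e)
      \<le> ennreal (?C * q * A powr (1 / p) * Ar powr ?t * W * ?k * ?e)"
      unfolding c0_def
    proof (intro ennreal_leI mult_right_mono mult_left_mono)
      \<comment> \<open>The estimate is obtained with (1-\<delta>)^(1/p) alone; dividing by
        \<delta>^(1-1/p) <= 1 only increases the right side.\<close>
      have "\<delta> powr (1 - 1 / p) \<le> 1" using \<delta> p1 by (intro powr_le1) auto
      then have "(1 - \<delta>) powr (1 / p) * 1 \<le> (1 - \<delta>) powr (1 / p) * (1 / \<delta> powr (1 - 1 / p))"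
        using \<delta> by (intro mult_left_mono) auto
      then show "(1 - \<delta>) powr (1 / p) \<le> (1 - \<delta>) powr (1 / p) / \<delta> powr (1 - 1 / p)" by simp
    qed (use q W in auto)
    also have "\<dots> = ennreal (?C * q) * ennreal (A powr (1 / p)) * ennreal (Ar powr ?t) * ennreal W * ennreal ?k * ennreal (?e)"
      by (simp only: ennreal_mult''[OF powr_ge_zero] ennreal_mult''[OF less_imp_le[OF k]] ennreal_mult''[OF W0])
    also have "\<dots> = ennreal (?C * q) * ?Ap * ?Ar * Ainf_const w * ennreal ?k * ?E"
    proof -
      have "E / weight_of w Q = ennreal (enn2real E / measure \<mu> (hcube a l))"
        unfolding wQ using 3(1) mu0 by (subst divide_ennreal[symmetric]) auto
      then have "?E = ennreal (?e)"
        unfolding E_def[symmetric] by (simp add: ennpowr_ennreal)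
      moreover have "?Ap = ennreal (A powr (1 / p))" "?Ar = ennreal (Ar powr ?t)"
        using A Ar by (simp_all add: ennpowr_ennreal)
      ultimately show ?thesis using W(1) by simp
    qed
    finally show ?thesis .
  qed
qed

theorem theorem5p7:
  shows "\<exists>C::real. C > 0 \<and>
    (\<forall>\<delta> r p q (f :: real ^ 'n \<Rightarrow> real) (w :: real ^ 'n \<Rightarrow> real).
       0 < \<delta> \<longrightarrow> \<delta> < 1 \<longrightarrow> 1 \<le> r \<longrightarrow> r \<le> p \<longrightarrow> p < real CARD('n) / \<delta> \<longrightarrow>
       locally_integrable f \<longrightarrow> w \<in> Ap r \<longrightarrow>
       1 / p - 1 / q = \<delta> / (real CARD('n) * r) \<longrightarrow>
       (\<forall>a l. l > 0 \<longrightarrow> (let Q = cube a l in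
         (INF c::real. ((\<integral>\<^sup>+x\<in>Q. ennreal (\<bar>f x - c\<bar> powr q) * ennreal (w x) \<partial>lebesgue)
                          / weight_of w Q) ennpowr (1 / q))
         \<le> ennreal (C * q) * Ap_const p w ennpowr (1 / p)
             * Ap_const r w ennpowr (\<delta> / (real CARD('n) * r)) * Ainf_const w
             * ennreal ((1 - \<delta>) powr (1 / p) / \<delta> powr (1 - 1 / p) * l powr \<delta>)
             * ((\<integral>\<^sup>+x\<in>Q. (\<integral>\<^sup>+y\<in>Q. ennreal (\<bar>f x - f y\<bar> powr p
                                     / norm (x - y) powr (real CARD('n) + \<delta> * p)) \<partial>lebesgue)
                      * ennreal (w x) \<partial>lebesgue)
                 / weight_of w Q) ennpowr (1 / p))))"
proof -
  let ?C = "416 * exp 1 ^ 2 * 2 ^ CARD('n) * (8 * 2 ^ CARD('n) * real CARD('n) ^ (CARD('n) + 1))"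
  show ?thesis
  proof (rule exI[of _ ?C], intro conjI allI impI, unfold Let_def)
    show "?C > 0" by simp
    fix \<delta> r p q l :: real and f w :: "real ^ 'n \<Rightarrow> real" and a :: "real ^ 'n"
    assume *: "0 < \<delta>" "\<delta> < 1" "1 \<le> r" "r \<le> p" "p < real CARD('n) / \<delta>"
      and f: "locally_integrable f" and **: "w \<in> Ap r" "1 / p - 1 / q = \<delta> / (real CARD('n) * r)" "l > 0"
    let ?Q = "cube a l"
    \<comment> \<open>Midpoint substitution and Fubini need measurability on the product Borel
      space, so f is replaced by a Borel function equal to it almost everywhere. No integral in the
      statement changes.\<close>
    obtain g where g: "g \<in> borel_measurable borel" "AE x in lborel. f x = g x"
      using completion_ex_borel_measurable_real[OF locally_integrable_measurable[OF f]] by auto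
    have ae: "AE x in lebesgue. f x = g x" using g(2) by (rule AE_completion)
    have 1: "(\<integral>\<^sup>+x\<in>?Q. ennreal (\<bar>f x - c\<bar> powr q) * ennreal (w x) \<partial>lebesgue) = (\<integral>\<^sup>+x\<in>?Q. ennreal (\<bar>g x - c\<bar> powr q) * ennreal (w x) \<partial>lebesgue)" for c
      by (rule nn_integral_cong_AE, use ae in eventually_elim) simp
    have 2: "(\<integral>\<^sup>+x\<in>?Q. (\<integral>\<^sup>+y\<in>?Q. ennreal (\<bar>f x - f y\<bar> powr p / norm (x - y) powr (real CARD('n) + \<delta> * p)) \<partial>lebesgue) * ennreal (w x) \<partial>lebesgue)
      = (\<integral>\<^sup>+x\<in>?Q. gagliardo \<delta> p ?Q g x * ennreal (w x) \<partial>lebesgue)"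
    proof (rule nn_integral_cong_AE, use ae in eventually_elim)
      case (elim x)
      have "(\<integral>\<^sup>+y\<in>?Q. ennreal (\<bar>f x - f y\<bar> powr p / norm (x - y) powr (real CARD('n) + \<delta> * p)) \<partial>lebesgue) = gagliardo \<delta> p ?Q g x"
        unfolding gagliardo_def nn_integral_completion
        by (rule nn_integral_cong_AE, use g(2) in eventually_elim) (simp add: elim)
      then show ?case by simp
    qed
    show "(INF c::real. ((\<integral>\<^sup>+x\<in>?Q. ennreal (\<bar>f x - c\<bar> powr q) * ennreal (w x) \<partial>lebesgue) / weight_of w ?Q) ennpowr (1 / q))
         \<le> ennreal (?C * q) * Ap_const p w ennpowr (1 / p)
             * Ap_const r w ennpowr (\<delta> / (real CARD('n) * r)) * Ainf_const w
             * ennreal ((1 - \<delta>) powr (1 / p) / \<delta> powr (1 - 1 / p) * l powr \<delta>)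
             * ((\<integral>\<^sup>+x\<in>?Q. (\<integral>\<^sup>+y\<in>?Q. ennreal (\<bar>f x - f y\<bar> powr p / norm (x - y) powr (real CARD('n) + \<delta> * p)) \<partial>lebesgue)
                      * ennreal (w x) \<partial>lebesgue) / weight_of w ?Q) ennpowr (1 / p)"
      unfolding 1 2 by (rule weighted_fractional_poincare[OF * g(1) **])
  qed
qed

end
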